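(* For all $\alpha>0$, every finitely generated subgroup of $\mathrm{Diff}_+^{1+\alpha}([0,1])$ with sub-exponential growth is almost nilpotent.
   Context: $\mathrm{Diff}_+^{1+\alpha}([0,1])$ is the group of orientation preserving $C^1$ diffeomorphisms of $[0,1]$ whose derivative is $\alpha$-H\"older continuous. A group is almost nilpotent if it contains a finite index nilpotent subgroup. For a group generated by a finite symmetric set $S$, let $f(n)$ be the number of elements that can be written as a product of no more than $n$ elements of $S$; the group has sub-exponential growth if $\lim_{n\to\infty} f(n)^{1/n}=1$ (this does not depend on $S$). *)

theory Defs
  imports "HOL-Analysis.Analysis" "HOL-Algebra.Bij" "HOL-Algebra.Generated_Groups"
begin

section \<open>The group of orientation preserving diffeomorphisms of class C^(1+alpha)\<close>

text \<open>Derivatives are taken within the set, so they are one-sided at the endpoints of an interval.\<close>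

definition derivative_on :: "real set \<Rightarrow> (real \<Rightarrow> real) \<Rightarrow> real \<Rightarrow> real" where
  "derivative_on I f x = vector_derivative f (at x within I)"

definition C1_on :: "real set \<Rightarrow> (real \<Rightarrow> real) \<Rightarrow> bool" where
  "C1_on I f \<longleftrightarrow> f differentiable_on I \<and> continuous_on I (derivative_on I f)"

definition holder_on :: "real \<Rightarrow> real set \<Rightarrow> (real \<Rightarrow> real) \<Rightarrow> bool" where
  "holder_on \<alpha> I h \<longleftrightarrow> (\<exists>C. \<forall>x\<in>I. \<forall>y\<in>I. \<bar>h x - h y\<bar> \<le> C * \<bar>x - y\<bar> powr \<alpha>)"

definition Diff_carrier :: "real \<Rightarrow> (real \<Rightarrow> real) set" where
  "Diff_carrier \<alpha> =
     {f \<in> Bij {0..1}. C1_on {0..1} f \<and> C1_on {0..1} (inv_into {0..1} f) \<and>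
        strict_mono_on {0..1} f \<and> holder_on \<alpha> {0..1} (derivative_on {0..1} f)}"

text \<open>As in \<^const>\<open>BijGroup\<close>, elements are maps extended by \<^const>\<open>undefined\<close> outside \<open>{0..1}\<close>,
  and the product is composition.\<close>

definition Diff :: "real \<Rightarrow> (real \<Rightarrow> real) monoid" where
  "Diff \<alpha> = BijGroup {0..1} \<lparr>carrier := Diff_carrier \<alpha>\<rparr>"

section \<open>Nilpotency and growth\<close>

primrec lower_central :: "('a, 'b) monoid_scheme \<Rightarrow> nat \<Rightarrow> 'a set" where
  "lower_central G 0 = carrier G"
| "lower_central G (Suc n) = generate G
     {x \<otimes>\<^bsub>G\<^esub> y \<otimes>\<^bsub>G\<^esub> inv\<^bsub>G\<^esub> x \<otimes>\<^bsub>G\<^esub> inv\<^bsub>G\<^esub> y | x y. x \<in> lower_central G n \<and> y \<in> carrier G}"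

definition nilpotent_group :: "('a, 'b) monoid_scheme \<Rightarrow> bool" where
  "nilpotent_group G \<longleftrightarrow> group G \<and> (\<exists>n. lower_central G n = {\<one>\<^bsub>G\<^esub>})"

definition almost_nilpotent :: "('a, 'b) monoid_scheme \<Rightarrow> bool" where
  "almost_nilpotent G \<longleftrightarrow> group G \<and>
     (\<exists>N. subgroup N G \<and> finite (rcosets\<^bsub>G\<^esub> N) \<and> nilpotent_group (G\<lparr>carrier := N\<rparr>))"

definition finitely_generated :: "('a, 'b) monoid_scheme \<Rightarrow> bool" where
  "finitely_generated G \<longleftrightarrow> (\<exists>S. finite S \<and> S \<subseteq> carrier G \<and> generate G S = carrier G)"

definition symmetric_generating_set :: "('a, 'b) monoid_scheme \<Rightarrow> 'a set \<Rightarrow> bool" where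
  "symmetric_generating_set G S \<longleftrightarrow>
     S \<subseteq> carrier G \<and> (\<forall>s\<in>S. inv\<^bsub>G\<^esub> s \<in> S) \<and> generate G S = carrier G"

definition growth_fun :: "('a, 'b) monoid_scheme \<Rightarrow> 'a set \<Rightarrow> nat \<Rightarrow> nat" where
  "growth_fun G S n =
     card {foldr (\<lambda>x y. x \<otimes>\<^bsub>G\<^esub> y) xs \<one>\<^bsub>G\<^esub> | xs. set xs \<subseteq> S \<and> length xs \<le> n}"

text \<open>The limit condition does not depend on the finite symmetric generating set, so it is
  required of some such set.\<close>

definition subexponential_growth :: "('a, 'b) monoid_scheme \<Rightarrow> bool" where
  "subexponential_growth G \<longleftrightarrow>
     (\<exists>S. finite S \<and> symmetric_generating_set G S \<and>
          (\<lambda>n. root n (real (growth_fun G S n))) \<longlonglongrightarrow> 1)"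

section \<open>\<open>Diff \<alpha>\<close> is a group\<close>

lemma derivative_on_eq:
  assumes "(f has_real_derivative d) (at x within {0..1})" "x \<in> {0..1}"
  shows "derivative_on {0..1} f x = d"
  using assms vector_derivative_within_cbox[of 0 1 x f d]
  by (simp add: derivative_on_def has_real_derivative_iff_has_vector_derivative)

lemma C1_on_derivative:
  assumes "C1_on I f" "x \<in> I"
  shows "(f has_real_derivative derivative_on I f x) (at x within I)"
  using assms vector_derivative_works[of f "at x within I"]
  by (simp add: C1_on_def derivative_on_def differentiable_on_def
      has_real_derivative_iff_has_vector_derivative)

lemma C1_onI:
  assumes "\<And>x. x \<in> {0..1} \<Longrightarrow> (f has_real_derivative d x) (at x within {0..1})"
    and "continuous_on {0..1} d"
  shows "C1_on {0..1} f"
proof -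
  have "continuous_on {0..1} (derivative_on {0..1} f)"
    using assms continuous_on_cong[of "{0..1}" "{0..1}" "derivative_on {0..1} f" d]
      derivative_on_eq by blast
  moreover have "f differentiable_on {0..1}"
    unfolding differentiable_on_def
    using assms(1) has_field_derivative_imp_has_derivative differentiableI by blast
  ultimately show ?thesis by (simp add: C1_on_def)
qed

lemma C1_on_cong:
  assumes "C1_on {0..1} f" "\<And>x. x \<in> {0..1} \<Longrightarrow> f x = g x"
  shows "C1_on {0..1} g"
proof (rule C1_onI)
  show "continuous_on {0..1} (derivative_on {0..1} f)" using assms by (simp add: C1_on_def)
  fix x :: real assume "x \<in> {0..1}"
  then show "(g has_real_derivative derivative_on {0..1} f x) (at x within {0..1})"
    using C1_on_derivative[OF assms(1)] assms(2)
      has_field_derivative_transform_within[of f _ x "{0..1}" 1 g] by auto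
qed

lemma C1_on_bounded:
  assumes "C1_on {0..1} f"
  obtains B where "B > 0" "\<And>x. x \<in> {0..1} \<Longrightarrow> \<bar>derivative_on {0..1} f x\<bar> \<le> B"
    "\<And>x y. x \<in> {0..1} \<Longrightarrow> y \<in> {0..1} \<Longrightarrow> \<bar>f x - f y\<bar> \<le> B * \<bar>x - y\<bar>"
proof -
  have "compact (derivative_on {0..1} f ` {0..1})"
    using assms compact_continuous_image by (auto simp: C1_on_def)
  then obtain B where B: "B > 0" "\<And>x. x \<in> {0..1} \<Longrightarrow> \<bar>derivative_on {0..1} f x\<bar> \<le> B"
    by (metis bounded_pos compact_imp_bounded image_eqI real_norm_def)
  have "\<bar>f x - f y\<bar> \<le> B * \<bar>x - y\<bar>" if "x \<in> {0..1}" "y \<in> {0..1}" for x y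
    using field_differentiable_bound[of "{0..1}" f "derivative_on {0..1} f" B y x]
      C1_on_derivative[OF assms] B that by (simp add: abs_minus_commute)
  with B show ?thesis using that by blast
qed

lemma C1_on_comp:
  assumes f: "C1_on {0..1} f" and g: "C1_on {0..1} g" and gI: "g ` {0..1} \<subseteq> {0..1}"
  shows "C1_on {0..1} (f \<circ> g)"
    and "x \<in> {0..1} \<Longrightarrow>
      derivative_on {0..1} (f \<circ> g) x = derivative_on {0..1} f (g x) * derivative_on {0..1} g x"
proof -
  let ?d = "\<lambda>x. derivative_on {0..1} f (g x) * derivative_on {0..1} g x"
  have D: "((f \<circ> g) has_real_derivative ?d x) (at x within {0..1})" if "x \<in> {0..1}" for x
  proof (rule DERIV_image_chain)
    show "(g has_real_derivative derivative_on {0..1} g x) (at x within {0..1})"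
      by (rule C1_on_derivative[OF g that])
    show "(f has_real_derivative derivative_on {0..1} f (g x)) (at (g x) within g ` {0..1})"
      using C1_on_derivative[OF f] gI that DERIV_subset by blast
  qed
  have "continuous_on {0..1} g"
    using g by (simp add: C1_on_def differentiable_imp_continuous_on)
  moreover have "continuous_on {0..1} (\<lambda>x. derivative_on {0..1} f (g x))"
    using f gI calculation continuous_on_compose2 unfolding C1_on_def by blast
  ultimately have "continuous_on {0..1} ?d"
    using g by (auto simp: C1_on_def intro!: continuous_intros)
  with D show "C1_on {0..1} (f \<circ> g)" by (rule C1_onI)
  show "x \<in> {0..1} \<Longrightarrow> derivative_on {0..1} (f \<circ> g) x = ?d x"
    using D derivative_on_eq by blast
qed

lemma derivative_on_cong:
  assumes "C1_on {0..1} f" "\<And>x. x \<in> {0..1} \<Longrightarrow> f x = g x" "x \<in> {0..1}"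
  shows "derivative_on {0..1} g x = derivative_on {0..1} f x"
  using assms C1_on_derivative[OF assms(1,3)]
      has_field_derivative_transform_within[of f _ x "{0..1}" 1 g]
  by (intro derivative_on_eq) auto

lemma holder_on_cong:
  assumes "\<And>x. x \<in> I \<Longrightarrow> f x = g x"
  shows "holder_on \<alpha> I f \<longleftrightarrow> holder_on \<alpha> I g"
  using assms by (simp add: holder_on_def)

lemma holder_onE:
  assumes "holder_on \<alpha> I h"
  obtains C where "C \<ge> 0" "\<And>x y. x \<in> I \<Longrightarrow> y \<in> I \<Longrightarrow> \<bar>h x - h y\<bar> \<le> C * \<bar>x - y\<bar> powr \<alpha>"
proof -
  obtain C where C: "\<And>x y. x \<in> I \<Longrightarrow> y \<in> I \<Longrightarrow> \<bar>h x - h y\<bar> \<le> C * \<bar>x - y\<bar> powr \<alpha>"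
    using assms by (auto simp: holder_on_def)
  have "\<bar>h x - h y\<bar> \<le> max C 0 * \<bar>x - y\<bar> powr \<alpha>" if "x \<in> I" "y \<in> I" for x y
    using C[OF that] mult_right_mono[of C "max C 0" "\<bar>x - y\<bar> powr \<alpha>"] by auto
  then show ?thesis using that[of "max C 0"] by auto
qed

lemma holder_on_comp:
  assumes h: "holder_on \<alpha> I h" and gI: "g ` J \<subseteq> I" and "\<alpha> > 0" "B > 0"
    and g: "\<And>x y. x \<in> J \<Longrightarrow> y \<in> J \<Longrightarrow> \<bar>g x - g y\<bar> \<le> B * \<bar>x - y\<bar>"
  shows "holder_on \<alpha> J (\<lambda>x. h (g x))"
proof -
  obtain C where C: "C \<ge> 0" "\<And>x y. x \<in> I \<Longrightarrow> y \<in> I \<Longrightarrow> \<bar>h x - h y\<bar> \<le> C * \<bar>x - y\<bar> powr \<alpha>"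
    using holder_onE[OF h] by blast
  have "\<bar>h (g x) - h (g y)\<bar> \<le> (C * B powr \<alpha>) * \<bar>x - y\<bar> powr \<alpha>" if "x \<in> J" "y \<in> J" for x y
  proof -
    have "\<bar>h (g x) - h (g y)\<bar> \<le> C * \<bar>g x - g y\<bar> powr \<alpha>" using C(2) gI that by blast
    also have "\<dots> \<le> C * (B * \<bar>x - y\<bar>) powr \<alpha>"
      using g[OF that] C(1) \<open>\<alpha> > 0\<close> by (intro mult_left_mono powr_mono2) auto
    also have "\<dots> = (C * B powr \<alpha>) * \<bar>x - y\<bar> powr \<alpha>" using \<open>B > 0\<close> by (simp add: powr_mult)
    finally show ?thesis .
  qed
  then show ?thesis unfolding holder_on_def by blast
qed

lemma holder_on_mult:
  assumes h: "holder_on \<alpha> I h" and k: "holder_on \<alpha> I k"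
    and A: "\<And>x. x \<in> I \<Longrightarrow> \<bar>h x\<bar> \<le> A" and B: "\<And>x. x \<in> I \<Longrightarrow> \<bar>k x\<bar> \<le> B"
  shows "holder_on \<alpha> I (\<lambda>x. h x * k x)"
proof -
  obtain C where C: "C \<ge> 0" "\<And>x y. x \<in> I \<Longrightarrow> y \<in> I \<Longrightarrow> \<bar>h x - h y\<bar> \<le> C * \<bar>x - y\<bar> powr \<alpha>"
    using holder_onE[OF h] by blast
  obtain E where E: "E \<ge> 0" "\<And>x y. x \<in> I \<Longrightarrow> y \<in> I \<Longrightarrow> \<bar>k x - k y\<bar> \<le> E * \<bar>x - y\<bar> powr \<alpha>"
    using holder_onE[OF k] by blast
  have "\<bar>h x * k x - h y * k y\<bar> \<le> (A * E + C * B) * \<bar>x - y\<bar> powr \<alpha>" if "x \<in> I" "y \<in> I" for x y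
  proof -
    have "\<bar>h x * k x - h y * k y\<bar> = \<bar>h x * (k x - k y) + (h x - h y) * k y\<bar>"
      by (simp add: algebra_simps)
    also have "\<dots> \<le> \<bar>h x\<bar> * \<bar>k x - k y\<bar> + \<bar>h x - h y\<bar> * \<bar>k y\<bar>"
      by (metis abs_mult abs_triangle_ineq)
    also have "\<dots> \<le> A * (E * \<bar>x - y\<bar> powr \<alpha>) + (C * \<bar>x - y\<bar> powr \<alpha>) * B"
      using A[OF that(1)] B[OF that(2)] C(2)[OF that] E(2)[OF that] C(1)
      by (intro add_mono mult_mono) auto
    finally show ?thesis by (simp add: algebra_simps)
  qed
  then show ?thesis unfolding holder_on_def by blast
qed

lemma holder_on_inverse:
  assumes h: "holder_on \<alpha> I h" and B: "\<And>x. x \<in> I \<Longrightarrow> \<bar>inverse (h x)\<bar> \<le> B"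
    and h0: "\<And>x. x \<in> I \<Longrightarrow> h x \<noteq> 0"
  shows "holder_on \<alpha> I (\<lambda>x. inverse (h x))"
proof -
  obtain C where C: "C \<ge> 0" "\<And>x y. x \<in> I \<Longrightarrow> y \<in> I \<Longrightarrow> \<bar>h x - h y\<bar> \<le> C * \<bar>x - y\<bar> powr \<alpha>"
    using holder_onE[OF h] by blast
  have "\<bar>inverse (h x) - inverse (h y)\<bar> \<le> (B * C * B) * \<bar>x - y\<bar> powr \<alpha>"
    if "x \<in> I" "y \<in> I" for x y
  proof -
    have B0: "0 \<le> B" using B[OF that(1)] abs_ge_zero order_trans by blast
    have "\<bar>inverse (h x) - inverse (h y)\<bar> = \<bar>inverse (h x)\<bar> * \<bar>h x - h y\<bar> * \<bar>inverse (h y)\<bar>"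
      using h0 that by (simp add: inverse_diff_inverse abs_mult)
    also have "\<dots> \<le> B * (C * \<bar>x - y\<bar> powr \<alpha>) * B"
      using B[OF that(1)] B[OF that(2)] C(2)[OF that] C(1) B0
      by (intro mult_mono mult_nonneg_nonneg) auto
    finally show ?thesis by (simp add: algebra_simps)
  qed
  then show ?thesis unfolding holder_on_def by blast
qed

lemma id_C1_on: "C1_on {0..1} (\<lambda>x\<in>{0..1}. x)"
  using C1_on_cong[of "\<lambda>x. x" "\<lambda>x\<in>{0..1}. x"] C1_onI[of "\<lambda>x. x" "\<lambda>_. 1"] by auto

lemma Diff_carrier_id: "(\<lambda>x\<in>{0..1}. x) \<in> Diff_carrier \<alpha>"
proof -
  let ?i = "\<lambda>x\<in>{0..1::real}. x"
  have bij: "bij_betw ?i {0..1} {0..1}" using id_Bij by (auto simp: Bij_def)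
  have inv: "inv_into {0..1} ?i x = x" if "x \<in> {0..1}" for x
    using inv_into_f_f[OF bij_betw_imp_inj_on[OF bij] that] that by simp
  have d: "derivative_on {0..1} ?i x = 1" if "x \<in> {0..1}" for x
    using that derivative_on_cong[of "\<lambda>x. x" ?i x] C1_onI[of "\<lambda>x. x" "\<lambda>_. 1"]
      derivative_on_eq[of "\<lambda>x. x" 1 x] by simp
  have "holder_on \<alpha> {0..1} (derivative_on {0..1} ?i)"
    unfolding holder_on_def using d by (intro exI[of _ 0]) auto
  then show ?thesis
    using id_Bij id_C1_on C1_on_cong[OF id_C1_on, of "inv_into {0..1} ?i"] inv
    by (auto simp: Diff_carrier_def strict_mono_on_def)
qed

lemma Diff_carrier_comp:
  assumes "\<alpha> > 0" and f: "f \<in> Diff_carrier \<alpha>" and g: "g \<in> Diff_carrier \<alpha>"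
  shows "compose {0..1} f g \<in> Diff_carrier \<alpha>"
proof -
  let ?I = "{0..1::real}" and ?c = "compose {0..1::real} f g"
  have fB: "f \<in> Bij ?I" "C1_on ?I f" "C1_on ?I (inv_into ?I f)" "strict_mono_on ?I f"
      "holder_on \<alpha> ?I (derivative_on ?I f)"
    and gB: "g \<in> Bij ?I" "C1_on ?I g" "C1_on ?I (inv_into ?I g)" "strict_mono_on ?I g"
      "holder_on \<alpha> ?I (derivative_on ?I g)"
    using f g by (auto simp: Diff_carrier_def)
  have bf: "bij_betw f ?I ?I" and bg: "bij_betw g ?I ?I" using fB gB by (auto simp: Bij_def)
  have gI: "g ` ?I \<subseteq> ?I" and fiI: "inv_into ?I f ` ?I \<subseteq> ?I"
    using bg bij_betw_inv_into[OF bf] by (auto simp: bij_betw_def)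
  have eq: "(f \<circ> g) x = ?c x" if "x \<in> ?I" for x using that by (simp add: compose_def)
  have cB: "?c \<in> Bij ?I" using compose_Bij fB gB by blast
  have C: "C1_on ?I (f \<circ> g)" by (rule C1_on_comp(1)[OF fB(2) gB(2) gI])
  then have cC: "C1_on ?I ?c" using C1_on_cong eq by blast
  have "(inv_into ?I g \<circ> inv_into ?I f) x = inv_into ?I ?c x" if x: "x \<in> ?I" for x
  proof -
    let ?y = "inv_into ?I f x" and ?z = "inv_into ?I g (inv_into ?I f x)"
    have y: "?y \<in> ?I" "f ?y = x" using fiI x bij_betw_inv_into_right[OF bf x] by blast+
    have z: "?z \<in> ?I" "g ?z = ?y"
      using bij_betw_inv_into[OF bg] y bij_betw_inv_into_right[OF bg y(1)]
      by (auto dest: bij_betwE)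
    have "?c ?z = x" using y z by (simp add: compose_def)
    moreover have "inj_on ?c ?I" using cB by (auto simp: Bij_def bij_betw_def)
    ultimately show ?thesis using z by (metis comp_apply inv_into_f_f)
  qed
  then have ci: "C1_on ?I (inv_into ?I ?c)"
    using C1_on_cong C1_on_comp(1)[OF gB(3) fB(3) fiI] by blast
  have cm: "strict_mono_on ?I ?c"
  proof (rule strict_mono_onI)
    fix r s :: real assume rs: "r \<in> ?I" "s \<in> ?I" "r < s"
    then have "g r < g s" using gB(4) by (auto simp: strict_mono_on_def)
    then have "f (g r) < f (g s)" using fB(4) gI rs by (auto simp: strict_mono_on_def image_subset_iff)
    then show "?c r < ?c s" using rs by (simp add: compose_def)
  qed
  obtain B where B: "B > 0" "\<And>x. x \<in> ?I \<Longrightarrow> \<bar>derivative_on ?I f x\<bar> \<le> B"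
    using C1_on_bounded[OF fB(2)] by metis
  obtain E where E: "E > 0" "\<And>x. x \<in> ?I \<Longrightarrow> \<bar>derivative_on ?I g x\<bar> \<le> E"
     "\<And>x y. x \<in> ?I \<Longrightarrow> y \<in> ?I \<Longrightarrow> \<bar>g x - g y\<bar> \<le> E * \<bar>x - y\<bar>"
    using C1_on_bounded[OF gB(2)] by metis
  have "holder_on \<alpha> ?I (\<lambda>x. derivative_on ?I f (g x) * derivative_on ?I g x)"
  proof (rule holder_on_mult[where A = B and B = E])
    show "holder_on \<alpha> ?I (\<lambda>x. derivative_on ?I f (g x))"
      by (rule holder_on_comp[OF fB(5) gI \<open>\<alpha> > 0\<close> E(1) E(3)])
    show "holder_on \<alpha> ?I (derivative_on ?I g)" by (rule gB(5))
  qed (use B E gI in blast)+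
  moreover have "derivative_on ?I f (g x) * derivative_on ?I g x = derivative_on ?I ?c x"
    if "x \<in> ?I" for x
    using C1_on_comp(2)[OF fB(2) gB(2) gI that] derivative_on_cong[OF C eq that] by metis
  ultimately have "holder_on \<alpha> ?I (derivative_on ?I ?c)"
    using holder_on_cong[of ?I "\<lambda>x. derivative_on ?I f (g x) * derivative_on ?I g x"] by blast
  with cB cC ci cm show ?thesis by (simp add: Diff_carrier_def)
qed

lemma Diff_carrier_inv:
  assumes "\<alpha> > 0" and f: "f \<in> Diff_carrier \<alpha>"
  shows "(\<lambda>x\<in>{0..1}. inv_into {0..1} f x) \<in> Diff_carrier \<alpha>"
proof -
  let ?I = "{0..1::real}" and ?g = "inv_into {0..1::real} f"
  let ?h = "\<lambda>x\<in>{0..1::real}. inv_into {0..1} f x"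
  have fB: "f \<in> Bij ?I" "C1_on ?I f" "C1_on ?I ?g" "strict_mono_on ?I f"
      "holder_on \<alpha> ?I (derivative_on ?I f)"
    using f by (auto simp: Diff_carrier_def)
  have bf: "bij_betw f ?I ?I" using fB by (auto simp: Bij_def)
  have gI: "?g ` ?I \<subseteq> ?I" and gI': "\<And>x. x \<in> ?I \<Longrightarrow> ?g x \<in> ?I"
    using bij_betw_inv_into[OF bf] by (auto simp: bij_betw_def)
  have hB: "?h \<in> Bij ?I" using restrict_inv_into_Bij fB by blast
  have hC: "C1_on ?I ?h" using C1_on_cong[OF fB(3)] by auto
  have "f x = inv_into ?I ?h x" if x: "x \<in> ?I" for x
  proof -
    have fx: "f x \<in> ?I" using bf x by (auto dest: bij_betwE)
    then have "?h (f x) = x" using bij_betw_inv_into_left[OF bf x] by simp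
    moreover have "inj_on ?h ?I" using hB by (auto simp: Bij_def bij_betw_def)
    ultimately show ?thesis using fx by (metis inv_into_f_f)
  qed
  then have hi: "C1_on ?I (inv_into ?I ?h)" using C1_on_cong fB(2) by blast
  have hm: "strict_mono_on ?I ?h"
  proof (rule strict_mono_onI)
    fix r s :: real assume rs: "r \<in> ?I" "s \<in> ?I" "r < s"
    then have "f (?g r) < f (?g s)" using bij_betw_inv_into_right[OF bf] by simp
    then have "?g r < ?g s" using fB(4) gI' rs
      by (metis strict_mono_on_less)
    then show "?h r < ?h s" using rs by simp
  qed
  have ge: "(f \<circ> ?g) x = x" if "x \<in> ?I" for x
    using bij_betw_inv_into_right[OF bf that] by simp
  have dd: "derivative_on ?I f (?g x) * derivative_on ?I ?g x = 1" if x: "x \<in> ?I" for x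
  proof -
    have "derivative_on ?I (\<lambda>x. x) x = derivative_on ?I (f \<circ> ?g) x"
      by (rule derivative_on_cong[OF C1_on_comp(1)[OF fB(2,3) gI] ge x])
    moreover have "derivative_on ?I (\<lambda>x. x) x = 1"
      using x by (intro derivative_on_eq) auto
    ultimately show ?thesis using C1_on_comp(2)[OF fB(2,3) gI x] by simp
  qed
  obtain E where E: "E > 0" "\<And>x. x \<in> ?I \<Longrightarrow> \<bar>derivative_on ?I ?g x\<bar> \<le> E"
     "\<And>x y. x \<in> ?I \<Longrightarrow> y \<in> ?I \<Longrightarrow> \<bar>?g x - ?g y\<bar> \<le> E * \<bar>x - y\<bar>"
    using C1_on_bounded[OF fB(3)] by metis
  have di: "inverse (derivative_on ?I f (?g x)) = derivative_on ?I ?g x" if "x \<in> ?I" for x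
    using dd[OF that] by (rule inverse_unique)
  have "holder_on \<alpha> ?I (\<lambda>x. inverse (derivative_on ?I f (?g x)))"
  proof (rule holder_on_inverse[where B = E])
    show "holder_on \<alpha> ?I (\<lambda>x. derivative_on ?I f (?g x))"
      by (rule holder_on_comp[OF fB(5) gI \<open>\<alpha> > 0\<close> E(1) E(3)])
    show "\<bar>inverse (derivative_on ?I f (?g x))\<bar> \<le> E" if "x \<in> ?I" for x
      using E(2) di that by simp
    show "derivative_on ?I f (?g x) \<noteq> 0" if "x \<in> ?I" for x using dd[OF that] by auto
  qed
  moreover have "inverse (derivative_on ?I f (?g x)) = derivative_on ?I ?h x" if "x \<in> ?I" for x
    using di[OF that] derivative_on_cong[OF fB(3) _ that, of ?h] by simp
  ultimately have "holder_on \<alpha> ?I (derivative_on ?I ?h)"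
    using holder_on_cong[of ?I "\<lambda>x. inverse (derivative_on ?I f (?g x))"] by blast
  with hB hC hi hm show ?thesis by (simp add: Diff_carrier_def)
qed

lemma subgroup_Diff_carrier:
  assumes "\<alpha> > 0"
  shows "subgroup (Diff_carrier \<alpha>) (BijGroup {0..1})"
proof (rule group.subgroupI[OF group_BijGroup])
  show "Diff_carrier \<alpha> \<subseteq> carrier (BijGroup {0..1})"
    by (auto simp: Diff_carrier_def BijGroup_def)
  show "Diff_carrier \<alpha> \<noteq> {}" using Diff_carrier_id by blast
  fix f g assume f: "f \<in> Diff_carrier \<alpha>"
  then have fB: "f \<in> Bij {0..1}" by (simp add: Diff_carrier_def)
  show "inv\<^bsub>BijGroup {0..1}\<^esub> f \<in> Diff_carrier \<alpha>"
    using Diff_carrier_inv[OF assms f] by (simp add: inv_BijGroup[OF fB])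
  assume g: "g \<in> Diff_carrier \<alpha>"
  then have "g \<in> Bij {0..1}" by (simp add: Diff_carrier_def)
  with fB show "f \<otimes>\<^bsub>BijGroup {0..1}\<^esub> g \<in> Diff_carrier \<alpha>"
    using Diff_carrier_comp[OF assms f g] by (simp add: BijGroup_def)
qed

lemma group_Diff: "\<alpha> > 0 \<Longrightarrow> group (Diff \<alpha>)"
  unfolding Diff_def
  by (rule subgroup.subgroup_is_group[OF subgroup_Diff_carrier group_BijGroup])

end

theory Submission
  imports Defs "HOL-Computational_Algebra.Computational_Algebra"
begin

text \<open>The group embeds into an additively written group of homeomorphisms of the line, and its
  growth enters only through the absence of free subsemigroups on two generators. This excludes
  crossings, so for a finitely generated group \<open>K\<close> the elements with a fixed point in every
  component of the complement of \<open>Fix K\<close> form a normal subgroup with torsion free abelian quotient.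
  By Milnor's argument this subgroup is again finitely generated, and iterating gives a descending
  series.

  Modulo every term of the series the group is almost nilpotent (Milnor--Wolf): on an abelian factor
  \<open>A\<close>, an element acting trivially on \<open>A / 3A\<close> has eigenvalues in the unit disc because
  there are no free subsemigroups, and is therefore unipotent.

  The series reaches the trivial group after about \<open>2 / \<alpha>\<close> steps. Otherwise there are nested
  components \<open>J\<^sub>0 \<supset> \<dots> \<supset> J\<^sub>k\<close> and elements \<open>f\<^sub>0, \<dots>, f\<^sub>k\<close> such that
  \<open>f\<^sub>i\<close> acts on \<open>J\<^sub>i\<close> without fixed points and is central up to elements having
  fixed points there. The images of \<open>J\<^sub>k\<close> under products of the \<open>f\<^sub>i\<close> are indexed by
  \<open>\<nat>\<^sup>k\<close>, and averaging over straight paths yields (as in the work of Deroin, Kleptsyn and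
  Navas) arbitrarily long paths along which the sum of the \<open>\<alpha>\<close>-th powers of the lengths is
  bounded. The resulting control of distortion contradicts Kopell's argument.\<close>

text \<open>The order of the argument is forced by a near circularity. The elements
  \<open>f i\<close> have to be central up to elements with fixed points, and such elements come
  only from the nilpotency half of the argument; yet that half seems to need a series that ends. It
  is therefore carried out relative to a cutoff \<open>d\<close>, for the first \<open>d\<close>
  factors of a series that need not end, and is used twice: inside the contradiction, where it
  supplies the \<open>f i\<close>, and at the very end, when the series is known to be trivial.

  Centrality matters because the \<open>f i\<close> do not commute: it lets the number of
  occurrences of \<open>f i\<close> in a walk be recovered from the place to which the walk carries
  the innermost component. The bound 2/\<alpha> + 2 weighs multiplicity against length. At time n at
  most (2N/n)^k of the N^k parameters share an image, and by disjointness at most n^(2/\<alpha>)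
  distinct images are longer than n^(-2/\<alpha>). Hence the mean of the \<alpha>-th powers of the
  lengths is O(1/n^2), which is summable, once k is at least 2/\<alpha> + 2.\<close>

section \<open>Subgroups of additively written, not necessarily commutative groups\<close>

definition subgrp :: "'a::group_add set \<Rightarrow> bool" where
  "subgrp A \<longleftrightarrow> 0 \<in> A \<and> (\<forall>x\<in>A. \<forall>y\<in>A. x - y \<in> A)"

lemma subgrp_0: "subgrp A \<Longrightarrow> 0 \<in> A"
  and subgrp_diff: "subgrp A \<Longrightarrow> x \<in> A \<Longrightarrow> y \<in> A \<Longrightarrow> x - y \<in> A"
  by (auto simp: subgrp_def)

lemma subgrp_uminus: "subgrp A \<Longrightarrow> x \<in> A \<Longrightarrow> - x \<in> A"
  using subgrp_diff[of A 0 x] subgrp_0 by auto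

lemma subgrp_add: "subgrp A \<Longrightarrow> x \<in> A \<Longrightarrow> y \<in> A \<Longrightarrow> x + y \<in> A"
  using subgrp_diff[of A x "- y"] subgrp_uminus by auto

lemmas subgrp_closed = subgrp_0 subgrp_diff subgrp_uminus subgrp_add

lemma subgrpI:
  assumes "0 \<in> A" "\<And>x y. x \<in> A \<Longrightarrow> y \<in> A \<Longrightarrow> x + y \<in> A" "\<And>x. x \<in> A \<Longrightarrow> - x \<in> A"
  shows "subgrp A"
  unfolding subgrp_def using assms by (metis diff_conv_add_uminus)

lemma subgrp_add_cancel_left: "subgrp A \<Longrightarrow> x \<in> A \<Longrightarrow> x + y \<in> A \<longleftrightarrow> y \<in> A"
  using subgrp_add subgrp_uminus by (metis minus_add_cancel)

lemma subgrp_add_cancel_right: "subgrp A \<Longrightarrow> y \<in> A \<Longrightarrow> x + y \<in> A \<longleftrightarrow> x \<in> A"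
  using subgrp_add subgrp_diff by (metis add_diff_cancel)

abbreviation gen :: "'a::group_add set \<Rightarrow> 'a set" where
  "gen S \<equiv> subgrp hull S"

lemma subgrp_gen: "subgrp (gen S)"
  by (rule hull_in) (auto simp: subgrp_def)

lemma gen_minimal: "S \<subseteq> A \<Longrightarrow> subgrp A \<Longrightarrow> gen S \<subseteq> A"
  by (rule hull_minimal)

lemma gen_superset: "S \<subseteq> gen S"
  by (rule hull_subset)

lemma gen_mono: "S \<subseteq> T \<Longrightarrow> gen S \<subseteq> gen T"
  by (rule hull_mono)

lemma gen_subgrp: "subgrp A \<Longrightarrow> gen A = A"
  by (simp add: hull_same)

definition fg :: "'a::group_add set \<Rightarrow> bool" where
  "fg A \<longleftrightarrow> (\<exists>S. finite S \<and> gen S = A)"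

definition conj_by :: "'a::group_add \<Rightarrow> 'a \<Rightarrow> 'a" where
  "conj_by g x = g + x - g"

lemma conj_by_add: "conj_by g (x + y) = conj_by g x + conj_by g y"
  by (simp add: conj_by_def add.assoc diff_conv_add_uminus del: add_uminus_conv_diff)

lemma conj_by_0 [simp]: "conj_by g 0 = 0" "conj_by 0 x = x"
  by (simp_all add: conj_by_def)

lemma conj_by_uminus: "conj_by g (- x) = - conj_by g x"
  by (simp add: conj_by_def diff_conv_add_uminus minus_add add.assoc del: add_uminus_conv_diff)

lemma conj_by_diff: "conj_by g (x - y) = conj_by g x - conj_by g y"
  by (metis conj_by_add conj_by_uminus diff_conv_add_uminus)

lemma conj_by_conj_by: "conj_by g (conj_by h x) = conj_by (g + h) x"
  by (simp add: conj_by_def diff_conv_add_uminus minus_add add.assoc del: add_uminus_conv_diff)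

lemma conj_by_inverse [simp]: "conj_by (- g) (conj_by g x) = x" "conj_by g (conj_by (- g) x) = x"
  by (simp_all add: conj_by_conj_by)

lemma conj_by_closed: "subgrp A \<Longrightarrow> g \<in> A \<Longrightarrow> x \<in> A \<Longrightarrow> conj_by g x \<in> A"
  by (simp add: conj_by_def subgrp_closed)

definition comm :: "'a::group_add \<Rightarrow> 'a \<Rightarrow> 'a" where
  "comm g x = g + x - g - x"

lemma conj_by_eq_comm: "conj_by g x = comm g x + x"
  by (simp add: conj_by_def comm_def)

lemma comm_eq_conj_by: "comm g x = conj_by g x - x"
  by (simp add: conj_by_def comm_def)

lemma uminus_comm: "- comm g x = comm x g"
  by (simp add: comm_def diff_conv_add_uminus minus_add add.assoc del: add_uminus_conv_diff)

lemma comm_closed: "subgrp A \<Longrightarrow> g \<in> A \<Longrightarrow> x \<in> A \<Longrightarrow> comm g x \<in> A"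
  by (simp add: comm_def subgrp_closed)

definition normalizes :: "'a::group_add set \<Rightarrow> 'a set \<Rightarrow> bool" where
  "normalizes G K \<longleftrightarrow> (\<forall>g\<in>G. \<forall>x\<in>K. conj_by g x \<in> K)"

lemma normalizesD: "normalizes G K \<Longrightarrow> g \<in> G \<Longrightarrow> x \<in> K \<Longrightarrow> conj_by g x \<in> K"
  by (simp add: normalizes_def)

lemma normalizes_comm:
  assumes "subgrp A" "\<And>x y. x \<in> A \<Longrightarrow> y \<in> A \<Longrightarrow> comm x y \<in> B" "subgrp B" "B \<subseteq> A"
  shows "normalizes A B"
  unfolding normalizes_def using assms by (metis conj_by_eq_comm subgrp_add subsetD)

text \<open>The elements that conjugation by \<open>t\<close> sends into \<open>A\<close> form a
  subgroup, so it suffices to look at generators.\<close>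

lemma conj_by_gen:
  assumes "x \<in> gen S" "\<And>s. s \<in> S \<Longrightarrow> conj_by t s \<in> A" "subgrp A"
  shows "conj_by t x \<in> A"
proof -
  have "subgrp {x. conj_by t x \<in> A}"
    using assms(3) by (intro subgrpI) (auto simp: conj_by_add conj_by_uminus subgrp_closed)
  then show ?thesis using gen_minimal[of S "{x. conj_by t x \<in> A}"] assms by auto
qed

section \<open>Integer multiples\<close>

definition zmul :: "int \<Rightarrow> 'a::group_add \<Rightarrow> 'a" where
  "zmul c x = (if c \<ge> 0 then ((+) x ^^ nat c) 0 else - ((+) x ^^ nat (- c)) 0)"

lemma zmul_0 [simp]: "zmul 0 x = 0" and zmul_1 [simp]: "zmul 1 x = x"
  by (simp_all add: zmul_def)

lemma zmul_plus_1: "zmul (c + 1) x = x + zmul c x"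
proof (cases "c \<ge> 0")
  case True
  then have "nat (c + 1) = Suc (nat c)" by simp
  with True show ?thesis by (simp add: zmul_def)
next
  case False
  define n where "n = nat (- c - 1)"
  have c: "c = - int n - 1" using False by (simp add: n_def)
  have comm: "x + (((+) x ^^ n) 0) = ((+) x ^^ n) 0 + x" for n
  proof (induction n)
    case (Suc n)
    have "x + ((+) x ^^ Suc n) 0 = x + (((+) x ^^ n) 0 + x)" using Suc by simp
    then show ?case using Suc by (metis add.assoc funpow.simps(2) o_apply)
  qed simp
  have 1: "zmul (c + 1) x = - ((+) x ^^ n) 0" by (simp add: c zmul_def)
  have "nat (- c) = Suc n" using c by simp
  then have "zmul c x = - (x + ((+) x ^^ n) 0)" using c by (simp add: zmul_def)
  also have "\<dots> = - x + - ((+) x ^^ n) 0" by (simp only: comm minus_add)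
  finally show ?thesis using 1 by (simp only: add.assoc[symmetric] right_minus add_0)
qed

lemma zmul_minus_1: "zmul (c - 1) x = - x + zmul c x"
  using zmul_plus_1[of "c - 1" x] by (simp add: add.assoc[symmetric])

lemma zmul_add: "zmul (c + d) x = zmul c x + zmul d x"
proof (induction c rule: int_induct[where k=0])
  case base
  show ?case by simp
next
  case (step1 i)
  have e: "i + 1 + d = (i + d) + 1" by simp
  show ?case unfolding e zmul_plus_1 step1(2) by (simp only: add.assoc)
next
  case (step2 i)
  have e: "i - 1 + d = (i + d) - 1" by simp
  show ?case unfolding e zmul_minus_1 step2(2) by (simp only: add.assoc)
qed

lemma zmul_uminus: "zmul (- c) x = - zmul c x"
  using zmul_add[of "- c" c x] by (simp add: eq_neg_iff_add_eq_0)

lemma zmul_diff: "zmul (c - d) x = zmul c x - zmul d x"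
  using zmul_add[of c "- d" x] by (simp add: zmul_uminus)

lemma zmul_commute: "zmul c x + zmul d x = zmul d x + zmul c x"
  by (metis zmul_add add.commute)

lemma zmul_zero [simp]: "zmul c 0 = 0"
  by (induction c rule: int_induct[where k=0]) (simp_all add: zmul_plus_1 zmul_minus_1)

lemma zmul_mult: "zmul (c * d) x = zmul c (zmul d x)"
proof (induction c rule: int_induct[where k=0])
  case (step1 i)
  then show ?case using zmul_add[of d "i * d" x]
    by (simp add: zmul_plus_1 distrib_right add.commute[of "i * d"])
next
  case (step2 i)
  have "(i - 1) * d = - d + i * d" by (simp add: algebra_simps)
  then show ?case using step2 by (simp only: zmul_add zmul_uminus zmul_minus_1)
qed simp

lemma zmul_closed: "subgrp A \<Longrightarrow> x \<in> A \<Longrightarrow> zmul c x \<in> A"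
  by (induction c rule: int_induct[where k=0]) (simp_all add: zmul_plus_1 zmul_minus_1 subgrp_closed)

lemma conj_by_zmul: "conj_by g (zmul c x) = zmul c (conj_by g x)"
  by (induction c rule: int_induct[where k=0])
    (simp_all add: zmul_plus_1 zmul_minus_1 conj_by_add conj_by_uminus)

text \<open>Conjugation moves multiples of \<open>t\<close> past \<open>B\<close>, so the product of
  \<open>B\<close> with the cyclic group of \<open>t\<close> is a group. Both \<open>t\<close> and
  \<open>- t\<close> occur because conjugation by \<open>t\<close> alone may map \<open>B\<close>
  onto a proper subgroup of itself, as in Baumslag-Solitar groups.\<close>

lemma subgrp_cosets_cyclic:
  assumes "subgrp B" "\<And>x. x \<in> B \<Longrightarrow> conj_by t x \<in> B" "\<And>x. x \<in> B \<Longrightarrow> conj_by (- t) x \<in> B"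
  shows "subgrp {b + zmul j t | b j. b \<in> B}"
    and "x \<in> B \<Longrightarrow> conj_by (zmul j t) x \<in> B"
proof -
  show cl: "conj_by (zmul j t) x \<in> B" if "x \<in> B" for j x
    using that
  proof (induction j rule: int_induct[where k=0])
    case (step1 i)
    then show ?case using assms(2) by (metis zmul_plus_1 conj_by_conj_by)
  next
    case (step2 i)
    then show ?case using assms(3) by (metis zmul_minus_1 conj_by_conj_by)
  qed simp
  show "subgrp {b + zmul j t | b j. b \<in> B}" (is "subgrp ?C")
  proof (rule subgrpI)
    have "0 + zmul 0 t \<in> ?C" using assms(1) subgrp_0 by blast
    then show "0 \<in> ?C" by simp
  next
    fix x y assume "x \<in> ?C" "y \<in> ?C"
    then obtain b j b' j' where b: "b \<in> B" "b' \<in> B" and x: "x = b + zmul j t" and y: "y = b' + zmul j' t"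
      by blast
    have "x + y = (b + conj_by (zmul j t) b') + zmul (j + j') t"
      by (simp add: x y conj_by_def zmul_add add.assoc diff_conv_add_uminus del: add_uminus_conv_diff)
    moreover have "b + conj_by (zmul j t) b' \<in> B" using b cl assms(1) subgrp_add by blast
    ultimately show "x + y \<in> ?C" by blast
  next
    fix x assume "x \<in> ?C"
    then obtain b j where b: "b \<in> B" and x: "x = b + zmul j t" by blast
    have "- x = conj_by (zmul (- j) t) (- b) + zmul (- j) t"
      by (simp add: x conj_by_def zmul_uminus minus_add add.assoc diff_conv_add_uminus del: add_uminus_conv_diff)
    moreover have "conj_by (zmul (- j) t) (- b) \<in> B" using b cl assms(1) subgrp_uminus by blast
    ultimately show "- x \<in> ?C" by blast
  qed
qed

section \<open>Groups without free subsemigroups\<close>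

definition word :: "'a::monoid_add \<Rightarrow> 'a \<Rightarrow> bool list \<Rightarrow> 'a" where
  "word a b w = sum_list (map (\<lambda>c. if c then a else b) w)"

text \<open>Equal lengths are what counting the words of one length provides, and they make the
  powers of \<open>t\<close> cancel when two words in \<open>a + t\<close> and \<open>t\<close> are
  compared.\<close>

definition nofree :: "'a::group_add set \<Rightarrow> bool" where
  "nofree G \<longleftrightarrow> (\<forall>a\<in>G. \<forall>b\<in>G. \<exists>v w. length v = length w \<and> v \<noteq> w \<and> word a b v = word a b w)"

lemma nofree_subset: "nofree G \<Longrightarrow> K \<subseteq> G \<Longrightarrow> nofree K"
  by (meson nofree_def subsetD)

text \<open>The sum of \<open>conj_by (zmul i t) a\<close> over the positions \<open>i\<close> of
  the letters \<open>True\<close>. It is what remains of a word in \<open>a + t\<close> and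
  \<open>t\<close> when all letters \<open>t\<close> have been moved to its right end.\<close>

primrec csum :: "'a::group_add \<Rightarrow> 'a \<Rightarrow> bool list \<Rightarrow> 'a" where
  "csum t a [] = 0"
| "csum t a (c # w) = (if c then a else 0) + conj_by t (csum t a w)"

lemma word_eq_csum: "word (a + t) t w = csum t a w + zmul (int (length w)) t"
proof (induction w)
  case (Cons c w)
  have "zmul (int (length (c # w))) t = t + zmul (int (length w)) t"
    using zmul_plus_1[of "int (length w)" t] by (simp add: add.commute)
  with Cons show ?case
    by (simp add: word_def conj_by_def add.assoc diff_conv_add_uminus del: add_uminus_conv_diff)
qed (simp add: word_def)

lemma nofree_csum:
  assumes "nofree G" "subgrp G" "a \<in> G" "t \<in> G"
  obtains v w where "length v = length w" "v \<noteq> w" "csum t a v = csum t a w"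
proof -
  have "a + t \<in> G" using assms subgrp_add by blast
  then obtain v w where *: "length v = length w" "v \<noteq> w" "word (a + t) t v = word (a + t) t w"
    using assms unfolding nofree_def by blast
  then have "csum t a v = csum t a w" by (simp add: word_eq_csum)
  with * that show ?thesis by blast
qed

lemma csum_in_gen:
  "csum t a w \<in> gen {conj_by (zmul i t) a | i. 0 \<le> i \<and> i < int (length w)}"
proof (induction w)
  case (Cons c w)
  let ?S = "{conj_by (zmul i t) a | i. 0 \<le> i \<and> i < int (length (c # w))}"
  have "conj_by t (csum t a w) \<in> gen ?S"
  proof (rule conj_by_gen[OF Cons _ subgrp_gen])
    fix s assume "s \<in> {conj_by (zmul i t) a | i. 0 \<le> i \<and> i < int (length w)}"
    then obtain i where i: "s = conj_by (zmul i t) a" "0 \<le> i" "i < int (length w)" by blast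
    have "conj_by t s = conj_by (zmul (i + 1) t) a" by (simp add: i zmul_plus_1 conj_by_conj_by)
    then show "conj_by t s \<in> gen ?S" using i by (intro hull_inc) force
  qed
  moreover have "conj_by (zmul 0 t) a \<in> ?S" by force
  then have "a \<in> gen ?S" by (intro hull_inc) simp
  ultimately show ?case by (auto intro: subgrp_add[OF subgrp_gen])
qed (simp add: subgrp_0[OF subgrp_gen])

section \<open>Milnor's argument on finite generation\<close>

text \<open>A common prefix cancels, as conjugation by \<open>t\<close> is injective. At the first
  difference exactly one side contains \<open>a\<close> itself, and all other terms are conjugates
  by positive multiples of \<open>t\<close>, so the equation can be solved for
  \<open>a\<close>.\<close>

lemma collision_recurrence:
  assumes "length v = length w" "v \<noteq> w" "csum t a v = csum t a w"
  shows "\<exists>n::nat. a \<in> gen {conj_by (zmul i t) a | i. 1 \<le> i \<and> i \<le> int n}"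
  using assms
proof (induction v w rule: list_induct2)
  case (Cons c v d w)
  have *: "conj_by t (csum t a u) \<in> gen {conj_by (zmul i t) a | i. 1 \<le> i \<and> i \<le> int (length u)}" for u
  proof (rule conj_by_gen[OF csum_in_gen _ subgrp_gen])
    fix s assume "s \<in> {conj_by (zmul i t) a | i. 0 \<le> i \<and> i < int (length u)}"
    then obtain i where i: "s = conj_by (zmul i t) a" "0 \<le> i" "i < int (length u)" by blast
    have "conj_by t s = conj_by (zmul (i + 1) t) a" by (simp add: i zmul_plus_1 conj_by_conj_by)
    then show "conj_by t s \<in> gen {conj_by (zmul i t) a | i. 1 \<le> i \<and> i \<le> int (length u)}"
      using i by (intro hull_inc) force
  qed
  show ?case
  proof (cases "c = d")
    case True
    then have "conj_by t (csum t a v) = conj_by t (csum t a w)" using Cons.prems by simp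
    then have "csum t a v = csum t a w" by (metis conj_by_inverse(1))
    with True Cons show ?thesis by auto
  next
    case False
    let ?X = "gen {conj_by (zmul i t) a | i. 1 \<le> i \<and> i \<le> int (length v)}"
    have X: "conj_by t (csum t a v) \<in> ?X" "conj_by t (csum t a w) \<in> ?X"
      using *[of v] *[of w] Cons.hyps by auto
    have "a + conj_by t (csum t a v) = conj_by t (csum t a w) \<or>
        conj_by t (csum t a v) = a + conj_by t (csum t a w)"
      using False Cons.prems by (cases c; cases d) simp_all
    then have "a \<in> ?X"
    proof
      assume "a + conj_by t (csum t a v) = conj_by t (csum t a w)"
      then show ?thesis using X subgrp_add_cancel_right[OF subgrp_gen X(1), of a] by simp
    next
      assume "conj_by t (csum t a v) = a + conj_by t (csum t a w)"
      then show ?thesis using X(1) subgrp_add_cancel_right[OF subgrp_gen X(2), of a] by simp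
    qed
    then show ?thesis by blast
  qed
qed simp

text \<open>The recurrence for \<open>t\<close> expresses \<open>a\<close> through its later
  conjugates, the one for \<open>- t\<close> through its earlier ones; together they reduce every
  conjugate to a finite window.\<close>

lemma fg_conjugates:
  assumes "nofree G" "subgrp G" "a \<in> G" "t \<in> G"
  shows "\<exists>M. \<forall>j. conj_by (zmul j t) a \<in> gen {conj_by (zmul i t) a | i. \<bar>i\<bar> \<le> int M}"
proof -
  have rec: "\<exists>n::nat. a \<in> gen {conj_by (zmul i s) a | i. 1 \<le> i \<and> i \<le> int n}" if s: "s \<in> G" for s
  proof -
    obtain v w where "length v = length w" "v \<noteq> w" "csum s a v = csum s a w"
      using nofree_csum[OF assms(1-3) s] by blast
    then show ?thesis by (rule collision_recurrence)
  qed
  obtain n where n: "a \<in> gen {conj_by (zmul i t) a | i. 1 \<le> i \<and> i \<le> int n}"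
    using rec assms(4) by blast
  obtain m where m: "a \<in> gen {conj_by (zmul i (- t)) a | i. 1 \<le> i \<and> i \<le> int m}"
    using rec[of "- t"] assms subgrp_uminus by blast
  \<comment> \<open>The window is so wide that a recurrence reaching back by at most
    \<open>m\<close> or \<open>n\<close> from just outside cannot jump across it.\<close>
  define M where "M = n + m"
  let ?Z = "gen {conj_by (zmul i t) a | i. \<bar>i\<bar> \<le> int M}"
  have base: "conj_by (zmul j t) a \<in> ?Z" if "\<bar>j\<bar> \<le> int M" for j
    using that by (intro hull_inc) blast
  have up: "conj_by (zmul (int M + int k) t) a \<in> ?Z" for k :: nat
  proof (induction k rule: less_induct)
    case (less k)
    let ?j = "int M + int k"
    show ?case
    proof (cases "k = 0")
      case False
      show ?thesis
      proof (rule conj_by_gen[OF m _ subgrp_gen])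
        fix s assume "s \<in> {conj_by (zmul i (- t)) a | i. 1 \<le> i \<and> i \<le> int m}"
        then obtain i where i: "s = conj_by (zmul i (- t)) a" "1 \<le> i" "i \<le> int m" by blast
        have "zmul i (- t) = zmul (- i) t" using zmul_mult[of i "-1" t] by (simp add: zmul_uminus)
        then have s: "conj_by (zmul ?j t) s = conj_by (zmul (?j - i) t) a"
          using zmul_add[of ?j "- i" t] by (simp add: i conj_by_conj_by)
        show "conj_by (zmul ?j t) s \<in> ?Z"
        proof (cases "?j - i \<ge> int M")
          case True
          define k' where "k' = nat (int k - i)"
          have "k' < k" "?j - i = int M + int k'" using True i by (auto simp: k'_def)
          then show ?thesis unfolding s using less.IH[of k'] by (simp only:)
        next
          case False
          then have "\<bar>?j - i\<bar> \<le> int M" using i M_def by auto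
          then show ?thesis unfolding s by (rule base)
        qed
      qed
    qed (use base in simp)
  qed
  have down: "conj_by (zmul (- int M - int k) t) a \<in> ?Z" for k :: nat
  proof (induction k rule: less_induct)
    case (less k)
    let ?j = "- int M - int k"
    show ?case
    proof (cases "k = 0")
      case False
      show ?thesis
      proof (rule conj_by_gen[OF n _ subgrp_gen])
        fix s assume "s \<in> {conj_by (zmul i t) a | i. 1 \<le> i \<and> i \<le> int n}"
        then obtain i where i: "s = conj_by (zmul i t) a" "1 \<le> i" "i \<le> int n" by blast
        have s: "conj_by (zmul ?j t) s = conj_by (zmul (?j + i) t) a"
          by (simp only: i conj_by_conj_by zmul_add)
        show "conj_by (zmul ?j t) s \<in> ?Z"
        proof (cases "?j + i \<le> - int M")
          case True
          define k' where "k' = nat (int k - i)"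
          have "k' < k" "?j + i = - int M - int k'" using True i by (auto simp: k'_def)
          then show ?thesis unfolding s using less.IH[of k'] by (simp only:)
        next
          case False
          then have "\<bar>?j + i\<bar> \<le> int M" using i M_def by auto
          then show ?thesis unfolding s by (rule base)
        qed
      qed
    qed (use base in simp)
  qed
  have "conj_by (zmul j t) a \<in> ?Z" for j
  proof -
    consider "\<bar>j\<bar> \<le> int M" | "j = int M + int (nat (j - int M))" | "j = - int M - int (nat (- j - int M))"
      by linarith
    then show ?thesis
    proof cases
      case 2
      show ?thesis by (subst 2) (rule up)
    next
      case 3
      show ?thesis by (subst 3) (rule down)
    qed (rule base)
  qed
  then show ?thesis by blast
qed

text \<open>Every generator of the extension is \<open>b + zmul j t\<close> with \<open>b\<close> in
  \<open>N\<close>. The conjugates of these \<open>b\<close> under multiples of \<open>t\<close>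
  generate \<open>N\<close>, up to the multiples of \<open>t\<close> that lie in \<open>N\<close>,
  and finitely many of them suffice.\<close>

lemma fg_cyclic_extension:
  assumes "nofree G" "subgrp G" "subgrp N" "N \<subseteq> G" "t \<in> G"
    and nt: "\<And>x. x \<in> N \<Longrightarrow> conj_by t x \<in> N" "\<And>x. x \<in> N \<Longrightarrow> conj_by (- t) x \<in> N"
    and fgL: "fg (gen (insert t N))"
  shows "fg N"
proof -
  obtain S where S: "finite S" "gen S = gen (insert t N)" using fgL by (auto simp: fg_def)
  have N1: "subgrp {b + zmul j t | b j. b \<in> N}" by (rule subgrp_cosets_cyclic[OF assms(3) nt])
  have "insert t N \<subseteq> {b + zmul j t | b j. b \<in> N}"
  proof
    fix x assume "x \<in> insert t N"
    then consider "x = 0 + zmul 1 t" | "x = x + zmul 0 t" "x \<in> N" by auto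
    then show "x \<in> {b + zmul j t | b j. b \<in> N}" using subgrp_0[OF assms(3)] by cases blast+
  qed
  then have "S \<subseteq> {b + zmul j t | b j. b \<in> N}"
    using gen_minimal[OF _ N1] S gen_superset[of S] by blast
  then have "\<forall>s\<in>S. \<exists>b. b \<in> N \<and> (\<exists>j. s = b + zmul j t)" by blast
  then obtain f where f: "\<And>s. s \<in> S \<Longrightarrow> f s \<in> N \<and> (\<exists>j. s = f s + zmul j t)" by metis
  have "\<forall>a\<in>f ` S. \<exists>M. \<forall>j. conj_by (zmul j t) a \<in> gen {conj_by (zmul i t) a | i. \<bar>i\<bar> \<le> int M}"
    using fg_conjugates[OF assms(1,2) _ assms(5)] f assms(4) by blast
  from bchoice[OF this] obtain M where M: "\<forall>a\<in>f ` S. \<forall>j.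
      conj_by (zmul j t) a \<in> gen {conj_by (zmul i t) a | i. \<bar>i\<bar> \<le> int (M a)}" ..
  define T where "T = (\<Union>a\<in>f ` S. (\<lambda>i. conj_by (zmul i t) a) ` {- int (M a)..int (M a)})"
  have finT: "finite T" using S by (auto simp: T_def)
  have T: "conj_by (zmul j t) a \<in> gen T" if "a \<in> f ` S" for a j
  proof -
    have "{conj_by (zmul i t) a | i. \<bar>i\<bar> \<le> int (M a)} \<subseteq> T" using that by (force simp: T_def)
    then show ?thesis using M that gen_mono by blast
  qed
  have TN: "T \<subseteq> N" using subgrp_cosets_cyclic(2)[OF assms(3) nt] f by (auto simp: T_def)
  \<comment> \<open>If \<open>t\<close> has finite order modulo \<open>N\<close>, its least positive
    multiple in \<open>N\<close> has to join the generators; otherwise \<open>E\<close> is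
    empty.\<close>
  define P where "P = (\<lambda>m::nat. m > 0 \<and> zmul (int m) t \<in> N)"
  define E where "E = (if \<exists>m. P m then {zmul (int (LEAST m. P m)) t} else {})"
  define B where "B = gen (T \<union> E)"
  have EN: "E \<subseteq> N" using LeastI_ex[of P] by (auto simp: E_def P_def)
  have Bs: "subgrp B" by (simp add: B_def subgrp_gen)
  have BN: "B \<subseteq> N" unfolding B_def using TN EN by (intro gen_minimal assms(3)) auto
  have conjE: "conj_by (zmul k t) s \<in> B" if "s \<in> T \<union> E" for k s
  proof -
    consider a j where "a \<in> f ` S" "s = conj_by (zmul j t) a" | "s \<in> E"
      using \<open>s \<in> T \<union> E\<close> by (auto simp: T_def)
    then show ?thesis
    proof cases
      case 1
      then have "conj_by (zmul k t) s = conj_by (zmul (k + j) t) a"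
        by (simp only: conj_by_conj_by zmul_add)
      then show ?thesis using T[OF 1(1)] gen_mono[of T "T \<union> E"] by (auto simp: B_def)
    next
      case 2
      then obtain m where m: "s = zmul m t" by (auto simp: E_def split: if_splits)
      have "conj_by (zmul k t) s = s"
        using zmul_commute[of k t m] by (simp add: m conj_by_def)
      moreover have "s \<in> B" using 2 hull_inc[of s "T \<union> E"] by (simp add: B_def)
      ultimately show ?thesis by simp
    qed
  qed
  have Bt: "conj_by (zmul k t) x \<in> B" if "x \<in> B" for x k
    using conj_by_gen[of x "T \<union> E" "zmul k t" B] that conjE Bs by (simp add: B_def)
  have B1: "subgrp {b + zmul j t | b j. b \<in> B}"
    using Bt[of _ 1] Bt[of _ "-1"] by (intro subgrp_cosets_cyclic(1) Bs) (auto simp: zmul_uminus)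
  have "S \<subseteq> {b + zmul j t | b j. b \<in> B}"
  proof
    fix s assume s: "s \<in> S"
    have "conj_by (zmul 0 t) (f s) \<in> gen T" using T s by blast
    then have "f s \<in> B" using gen_mono[of T "T \<union> E"] by (auto simp: B_def)
    then show "s \<in> {b + zmul j t | b j. b \<in> B}" using f[OF s] by blast
  qed
  then have sub: "gen (insert t N) \<subseteq> {b + zmul j t | b j. b \<in> B}"
    using gen_minimal[OF _ B1, of S] by (simp only: S(2))
  \<comment> \<open>If \<open>b + zmul j t\<close> lies in \<open>N\<close>, so does
    \<open>zmul j t\<close>; division with remainder by the least positive exponent shows that it is
    a multiple of the element of \<open>E\<close>.\<close>
  have "N \<subseteq> B"
  proof
    fix x assume x: "x \<in> N"
    then have "x \<in> gen (insert t N)" by (simp add: hull_inc)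
    then obtain b j where b: "b \<in> B" "x = b + zmul j t" using sub by blast
    have jN: "zmul j t \<in> N" using b x BN assms(3) subgrp_add_cancel_left by blast
    have "zmul j t \<in> B"
    proof (cases "j = 0")
      case False
      have "zmul \<bar>j\<bar> t \<in> N" using jN subgrp_uminus[OF assms(3)] by (cases "j \<ge> 0") (auto simp: zmul_uminus)
      then have "P (nat \<bar>j\<bar>)" using False by (simp add: P_def)
      then have ex: "\<exists>m. P m" by blast
      define m where "m = (LEAST m. P m)"
      have m: "P m" using ex LeastI_ex m_def by metis
      have "zmul (int m) t \<in> B" using ex by (simp add: B_def E_def m_def hull_inc)
      then have mB: "zmul (j div int m * int m) t \<in> B" using zmul_closed[OF Bs] by (simp add: zmul_mult)
      have "zmul (j mod int m) t = - zmul (j div int m * int m) t + zmul j t"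
        by (metis minus_div_mult_eq_mod zmul_diff zmul_uminus zmul_add add.commute diff_conv_add_uminus)
      then have "zmul (j mod int m) t \<in> N"
        using mB jN BN assms(3) by (auto intro!: subgrp_add subgrp_uminus)
      moreover have "0 \<le> j mod int m" "j mod int m < int m" using m by (auto simp: P_def)
      ultimately have "\<not> 0 < j mod int m"
        using not_less_Least[of "nat (j mod int m)" P] m_def by (auto simp: P_def)
      then have "j mod int m = 0" using \<open>0 \<le> j mod int m\<close> by simp
      then show ?thesis using mB by (metis mult.commute mult_div_mod_eq add.right_neutral)
    qed (simp add: subgrp_0[OF Bs])
    then show "x \<in> B" using b Bs subgrp_add by blast
  qed
  then have "gen (T \<union> E) = N" using BN by (auto simp: B_def)
  moreover have "finite (T \<union> E)" using finT by (simp add: E_def)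
  ultimately show ?thesis unfolding fg_def by blast
qed

text \<open>The generators of \<open>L\<close> are removed one at a time. Each intermediate group
  contains all commutators of \<open>L\<close>, hence is normal, and the cyclic extension step
  passes finite generation down to the next one.\<close>

lemma fg_between_derived:
  assumes "fg L" "nofree L" "subgrp L" "subgrp N" "N \<subseteq> L"
    and comm: "\<And>x y. x \<in> L \<Longrightarrow> y \<in> L \<Longrightarrow> comm x y \<in> N"
  shows "fg N"
proof -
  obtain S where S: "finite S" "gen S = L" using assms(1) by (auto simp: fg_def)
  have step: "fg (gen (N \<union> S')) \<longrightarrow> fg N" if "finite S'" "S' \<subseteq> L" for S'
    using that
  proof (induction S' rule: finite_induct)
    case empty
    then show ?case using assms(4) by (simp add: gen_subgrp)
  next
    case (insert s S')
    let ?N = "gen (N \<union> S')"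
    have NL: "?N \<subseteq> L" using insert.prems assms by (intro gen_minimal) auto
    have conj: "conj_by g x \<in> ?N" if "g \<in> L" "x \<in> ?N" for g x
      using comm[of g x] that NL gen_superset[of "N \<union> S'"] subgrp_add[OF subgrp_gen, of "comm g x" _ x]
      by (auto simp: conj_by_eq_comm)
    have "gen (insert s ?N) = gen (N \<union> insert s S')"
    proof
      show "gen (insert s ?N) \<subseteq> gen (N \<union> insert s S')"
        using gen_mono[of "N \<union> S'" "N \<union> insert s S'"]
        by (intro gen_minimal subgrp_gen) (auto simp: hull_inc)
      show "gen (N \<union> insert s S') \<subseteq> gen (insert s ?N)"
        using gen_superset[of "N \<union> S'"] by (intro gen_mono) auto
    qed
    moreover have "s \<in> L" "- s \<in> L" using insert.prems assms(3) subgrp_uminus by auto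
    ultimately have "fg (gen (N \<union> insert s S')) \<longrightarrow> fg ?N"
      using fg_cyclic_extension[OF assms(2,3) subgrp_gen NL] conj by metis
    then show ?case using insert by auto
  qed
  have "S \<subseteq> L" using S gen_superset by blast
  moreover have "gen (N \<union> S) = L"
  proof
    show "gen (N \<union> S) \<subseteq> L" using \<open>S \<subseteq> L\<close> assms by (intro gen_minimal) auto
    show "L \<subseteq> gen (N \<union> S)" using S gen_mono[of S "N \<union> S"] by auto
  qed
  ultimately show ?thesis using step S assms(1) by metis
qed

text \<open>The union of the chain contains all commutators, so it is finitely generated, and its
  generators already lie in one member. This Noetherian property of the abelian factors takes the
  place of arguments about rank.\<close>

lemma ascending_chain_stops:
  assumes "fg L" "nofree L" "subgrp L"
    and comm: "\<And>x y. x \<in> L \<Longrightarrow> y \<in> L \<Longrightarrow> comm x y \<in> X 0"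
    and X: "\<And>n::nat. subgrp (X n)" "\<And>n. X n \<subseteq> X (Suc n)" "\<And>n. X n \<subseteq> L"
  shows "\<exists>n. \<forall>m. X m \<subseteq> X n"
proof -
  have mono: "X m \<subseteq> X n" if "m \<le> n" for m n
    using that X(2) by (rule lift_Suc_mono_le[rotated])
  have "subgrp (\<Union>n. X n)"
  proof (rule subgrpI)
    show "0 \<in> (\<Union>n. X n)" using X(1) subgrp_0 by blast
    show "- x \<in> (\<Union>n. X n)" if "x \<in> (\<Union>n. X n)" for x using that X(1) subgrp_uminus by blast
    fix x y assume "x \<in> (\<Union>n. X n)" "y \<in> (\<Union>n. X n)"
    then obtain i j where "x \<in> X i" "y \<in> X j" by blast
    then have "x + y \<in> X (max i j)"
      using mono[of i "max i j"] mono[of j "max i j"] \<open>x \<in> X i\<close> \<open>y \<in> X j\<close>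
      by (intro subgrp_add[OF X(1)]) auto
    then show "x + y \<in> (\<Union>n. X n)" by blast
  qed
  then have "fg (\<Union>n. X n)"
    using X(3) comm by (intro fg_between_derived[OF assms(1-3)]) blast+
  then obtain S where S: "finite S" "gen S = (\<Union>n. X n)" by (auto simp: fg_def)
  have "\<forall>s\<in>S. \<exists>n. s \<in> X n" using S gen_superset by blast
  then obtain f where f: "\<And>s. s \<in> S \<Longrightarrow> s \<in> X (f s)" by metis
  define n where "n = Max (insert 0 (f ` S))"
  have "S \<subseteq> X n"
  proof
    fix s assume s: "s \<in> S"
    have "f s \<le> n" unfolding n_def using S s by (intro Max_ge) auto
    then show "s \<in> X n" using f[OF s] mono by blast
  qed
  then have "(\<Union>n. X n) \<subseteq> X n" using gen_minimal[OF _ X(1)] S by metis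
  then show ?thesis by blast
qed

section \<open>Integer polynomials with small roots\<close>

abbreviation cpoly :: "int poly \<Rightarrow> complex \<Rightarrow> complex" where
  "cpoly p \<equiv> poly (map_poly of_int p)"

lemma cpoly_pCons [simp]: "cpoly (pCons c p) x = of_int c + x * cpoly p x"
  by (simp add: map_poly_pCons)

lemma cpoly_add: "cpoly (p + q) x = cpoly p x + cpoly q x"
  by (induction p q rule: poly_induct2) (simp_all add: algebra_simps)

lemma cpoly_smult: "cpoly (smult c p) x = of_int c * cpoly p x"
  by (induction p) (simp_all add: algebra_simps)

lemma cpoly_mult: "cpoly (p * q) x = cpoly p x * cpoly q x"
  by (induction p) (simp_all add: algebra_simps cpoly_add cpoly_smult)

lemma cpoly_power: "cpoly (p ^ n) x = cpoly p x ^ n"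
  by (induction n) (simp_all add: cpoly_mult one_pCons)

lemma cpoly_sum: "cpoly (\<Sum>i\<in>A. f i) x = (\<Sum>i\<in>A. cpoly (f i) x)"
  by (induction A rule: infinite_finite_induct) (simp_all add: cpoly_add)

text \<open>Up to sign, the constant coefficient is the leading coefficient times the product of the
  roots; the induction splits off one root at a time.\<close>

lemma norm_poly_0_le_roots:
  fixes p :: "complex poly"
  assumes "p \<noteq> 0" "\<And>z. poly p z = 0 \<Longrightarrow> norm z \<le> r" "r \<ge> 0"
  shows "norm (poly p 0) \<le> norm (lead_coeff p) * r ^ degree p"
  using assms
proof (induction "degree p" arbitrary: p)
  case 0
  then obtain c where "p = [:c:]" by (metis degree_eq_zeroE)
  then show ?case by simp
next
  case (Suc n)
  have "\<not> constant (poly p)" using Suc.hyps(2) by (simp add: constant_degree)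
  then obtain z where z: "poly p z = 0" using fundamental_theorem_of_algebra by blast
  then obtain q where q: "p = [:- z, 1:] * q" by (auto simp: poly_eq_0_iff_dvd elim: dvdE)
  have q0: "q \<noteq> 0" using q Suc.prems(1) by auto
  have dp: "degree p = Suc (degree q)"
    unfolding q using q0 by (subst degree_mult_eq) auto
  have lp: "lead_coeff p = lead_coeff q" unfolding q by (simp only: lead_coeff_mult) simp
  have "norm (poly q 0) \<le> norm (lead_coeff q) * r ^ degree q"
    using Suc.hyps dp q0 Suc.prems by (intro Suc.hyps(1)) (auto simp: q)
  moreover have "norm z \<le> r" using Suc.prems(2) z by blast
  ultimately have "norm z * norm (poly q 0) \<le> r * (norm (lead_coeff q) * r ^ degree q)"
    using Suc.prems(3) by (intro mult_mono) auto
  moreover have "norm (poly p 0) = norm z * norm (poly q 0)" by (simp add: q norm_mult)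
  ultimately show ?case unfolding lp by (simp add: dp algebra_simps)
qed

text \<open>The highest term with nonzero coefficient dominates: for modulus at least 2, the lower
  powers add up to at most \<open>norm z ^ n - 1\<close>.\<close>

lemma unit_coefficients_nonzero_sum:
  fixes z :: complex and \<delta> :: "nat \<Rightarrow> int"
  assumes "norm z \<ge> 2" "\<exists>i<n. \<delta> i \<noteq> 0" "\<And>i. i < n \<Longrightarrow> \<bar>\<delta> i\<bar> \<le> 1"
  shows "(\<Sum>i<n. of_int (\<delta> i) * z ^ i) \<noteq> 0"
  using assms(2,3)
proof (induction n)
  case (Suc n)
  show ?case
  proof (cases "\<delta> n = 0")
    case True
    then have "\<exists>i<n. \<delta> i \<noteq> 0" using Suc.prems(1) less_Suc_eq by metis
    then show ?thesis using Suc True by auto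
  next
    case False
    have geo: "(\<Sum>i<m. norm z ^ i) \<le> norm z ^ m - 1" for m
    proof (induction m)
      case (Suc m)
      have "2 * norm z ^ m \<le> norm z * norm z ^ m" using assms(1) by (intro mult_right_mono) auto
      then show ?case using Suc by simp
    qed simp
    have "norm (\<Sum>i<n. of_int (\<delta> i) * z ^ i) \<le> (\<Sum>i<n. norm (of_int (\<delta> i) * z ^ i))"
      by (rule norm_sum)
    also have "\<dots> \<le> (\<Sum>i<n. norm z ^ i)"
    proof (rule sum_mono)
      fix i assume "i \<in> {..<n}"
      then have "\<bar>\<delta> i\<bar> \<le> 1" using Suc.prems(2) by simp
      then have "real_of_int \<bar>\<delta> i\<bar> \<le> 1" by linarith
      then have "norm (of_int (\<delta> i) :: complex) \<le> 1" by (simp add: norm_of_int)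
      then show "norm (of_int (\<delta> i) * z ^ i) \<le> norm z ^ i"
        by (simp add: norm_mult norm_power mult_left_le_one_le)
    qed
    also have "\<dots> < norm z ^ n" using geo[of n] by simp
    also have "\<dots> = norm (of_int (\<delta> n) * z ^ n)"
    proof -
      have "\<bar>\<delta> n\<bar> = 1" using False Suc.prems(2)[of n] by linarith
      then have "real_of_int \<bar>\<delta> n\<bar> = 1" by simp
      then have "norm (of_int (\<delta> n) :: complex) = 1" by (simp add: norm_of_int)
      then show ?thesis by (simp add: norm_mult norm_power)
    qed
    finally show ?thesis by (auto simp: add_eq_0_iff2)
  qed
qed simp

text \<open>Think of \<open>I\<close> as the annihilator of an element of a torsion free abelian group under an
  endomorphism \<open>U\<close>, with \<open>T = 1 + 3 U\<close>. The relations with unit coefficients between the powers of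
  \<open>T\<close> force its eigenvalues into the unit disc, so those of \<open>U\<close> have modulus at most \<open>2/3\<close>; being
  algebraic integers, they vanish.\<close>

lemma annihilator_contains_power:
  fixes I :: "int poly set"
  assumes diff: "\<And>p q. p \<in> I \<Longrightarrow> q \<in> I \<Longrightarrow> p - q \<in> I"
    and mult: "\<And>p q. p \<in> I \<Longrightarrow> q * p \<in> I"
    and sat: "\<And>p c. smult c p \<in> I \<Longrightarrow> c \<noteq> 0 \<Longrightarrow> p \<in> I"
    and monic: "F \<in> I" "lead_coeff F = 1"
    and coll: "\<And>m::nat. m > 0 \<Longrightarrow> \<exists>\<delta>::nat \<Rightarrow> int. \<exists>n. (\<exists>i<n. \<delta> i \<noteq> 0) \<and> (\<forall>i<n. \<bar>\<delta> i\<bar> \<le> 1) \<and>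
        (\<Sum>i<n. smult (\<delta> i) ([:1, 3:] ^ (m * i))) \<in> I"
  shows "\<exists>e. monom 1 e \<in> I"
proof -
  have F0: "F \<noteq> 0" using monic by auto
  \<comment> \<open>Take \<open>f0\<close> of least degree in \<open>I\<close>; by saturation its
    primitive part \<open>f\<close> stays in \<open>I\<close>.\<close>
  define d where "d = (LEAST d. \<exists>p\<in>I. p \<noteq> 0 \<and> degree p = d)"
  have ex: "\<exists>d. \<exists>p\<in>I. p \<noteq> 0 \<and> degree p = d" using monic F0 by blast
  from LeastI_ex[OF ex] obtain f0 where f0: "f0 \<in> I" "f0 \<noteq> 0" "degree f0 = d"
    unfolding d_def by blast
  have min: "d \<le> degree p" if "p \<in> I" "p \<noteq> 0" for p
    unfolding d_def using that by (intro Least_le) blast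
  define f where "f = primitive_part f0"
  have c0: "content f0 \<noteq> 0" using f0 by simp
  have f: "f \<in> I" "f \<noteq> 0" "degree f = d" "content f = 1"
    using sat[of "content f0" f] c0 f0 by (simp_all add: f_def)
  \<comment> \<open>The remainder of pseudo-division lies in \<open>I\<close> and has smaller
    degree, so it vanishes. Only a multiple of \<open>p\<close> is divisible so far, since the
    leading coefficient of \<open>f\<close> is still unknown.\<close>
  have dvd: "\<exists>c. c \<noteq> 0 \<and> f dvd smult c p" if p: "p \<in> I" for p
  proof -
    obtain q r where qr: "pseudo_divmod p f = (q, r)" by (cases "pseudo_divmod p f")
    define c where "c = coeff f (degree f) ^ (Suc (degree p) - degree f)"
    have eq: "smult c p = f * q + r" and r: "r = 0 \<or> degree r < degree f"
      using pseudo_divmod[OF f(2) qr] by (simp_all add: c_def)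
    have "r = [:c:] * p - q * f" using eq by (simp add: algebra_simps)
    then have "r \<in> I" using diff mult p f(1) by metis
    then have "r = 0" using r min f(3) by fastforce
    moreover have "c \<noteq> 0" using f(2) by (simp add: c_def)
    ultimately show ?thesis using eq by auto
  qed
  \<comment> \<open>Gauss's lemma: content is multiplicative and \<open>f\<close> is primitive, so
    the leading coefficient of \<open>f\<close> divides that of the monic \<open>F\<close>.\<close>
  have lead: "\<bar>lead_coeff f\<bar> = 1"
  proof -
    obtain c where c: "c \<noteq> 0" "f dvd smult c F" using dvd[OF monic(1)] by blast
    then obtain q where q: "smult c F = f * q" by blast
    have "content F dvd lead_coeff F" by (rule content_dvd_coeff)
    then have "content F = 1" using monic(2) by (metis is_unit_content_iff)
    then have "normalize c = content q"
      using arg_cong[OF q, of content] f(4) by (simp add: content_mult)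
    then have "smult c F = smult (normalize c) (f * primitive_part q)"
      using q by (metis content_times_primitive_part mult_smult_right)
    then have "lead_coeff (smult c F) = lead_coeff (smult (normalize c) (f * primitive_part q))" by simp
    then have "c = \<bar>c\<bar> * (lead_coeff f * lead_coeff (primitive_part q))"
      by (simp only: lead_coeff_smult lead_coeff_mult monic(2) normalize_int_def mult_1_right)
    then have "\<bar>c\<bar> = \<bar>c\<bar> * \<bar>lead_coeff f * lead_coeff (primitive_part q)\<bar>"
      by (metis abs_mult abs_abs)
    then have "\<bar>lead_coeff f * lead_coeff (primitive_part q)\<bar> = 1" using c(1) by simp
    then show ?thesis by (rule abs_zmult_eq_1)
  qed
  \<comment> \<open>If \<open>1 + 3 * z\<close> left the closed unit disc, one of its powers would
    have modulus above 2, where no nonzero polynomial with coefficients -1, 0, 1 vanishes.\<close>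
  have roots: "norm z \<le> 2 / 3" if z: "cpoly f z = 0" for z
  proof (rule ccontr)
    assume "\<not> norm z \<le> 2 / 3"
    moreover have "norm (3 * z) \<le> norm (1 + 3 * z) + norm (1::complex)"
      using norm_triangle_ineq4[of "1 + 3 * z" 1] by simp
    ultimately have "norm (1 + 3 * z) > 1" by (simp add: norm_mult)
    then obtain m where m: "norm (1 + 3 * z) ^ m > 2" using real_arch_pow by blast
    then have "m > 0" by (cases m) auto
    then obtain \<delta> :: "nat \<Rightarrow> int" and n where \<delta>: "\<exists>i<n. \<delta> i \<noteq> 0" "\<forall>i<n. \<bar>\<delta> i\<bar> \<le> 1"
      "(\<Sum>i<n. smult (\<delta> i) ([:1, 3:] ^ (m * i))) \<in> I" using coll by blast
    obtain c where c: "c \<noteq> 0" "f dvd smult c (\<Sum>i<n. smult (\<delta> i) ([:1, 3:] ^ (m * i)))"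
      using dvd[OF \<delta>(3)] by blast
    from c(2) obtain q where q: "smult c (\<Sum>i<n. smult (\<delta> i) ([:1, 3:] ^ (m * i))) = f * q" by blast
    have "of_int c * cpoly (\<Sum>i<n. smult (\<delta> i) ([:1, 3:] ^ (m * i))) z = 0"
      using arg_cong[OF q, of "\<lambda>p. cpoly p z"] z by (simp add: cpoly_smult cpoly_mult)
    then have "cpoly (\<Sum>i<n. smult (\<delta> i) ([:1, 3:] ^ (m * i))) z = 0" using c(1) by simp
    then have "(\<Sum>i<n. of_int (\<delta> i) * ((1 + 3 * z) ^ m) ^ i) = 0"
      by (simp add: cpoly_sum cpoly_smult cpoly_power power_mult mult.commute[of z])
    moreover have "norm ((1 + 3 * z) ^ m) \<ge> 2" using m by (simp add: norm_power)
    ultimately show False using unit_coefficients_nonzero_sum \<delta>(1,2) by blast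
  qed
  \<comment> \<open>Once the root 0 is removed, the constant coefficient is a nonzero integer
    bounded by \<open>(2 / 3) ^ degree g\<close>, so \<open>g\<close> is constant.\<close>
  obtain g where g: "f = [:- 0, 1:] ^ Polynomial.order 0 f * g" "\<not> [:- 0, 1:] dvd g"
    using order_decomp[OF f(2)] by blast
  define e where "e = Polynomial.order 0 f"
  have fe: "f = monom 1 e * g" using g(1) by (simp add: e_def monom_altdef)
  have "coeff g 0 \<noteq> 0" using g(2) by (metis poly_0_coeff_0 minus_zero poly_eq_0_iff_dvd)
  have g0: "g \<noteq> 0" using f(2) fe by auto
  have lg: "\<bar>lead_coeff g\<bar> = 1" using lead unfolding fe by (simp add: lead_coeff_mult degree_monom_eq)
  let ?g = "map_poly of_int g :: complex poly"
  have dg: "degree ?g = degree g" by (rule degree_map_poly) auto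
  have "norm z \<le> 2 / 3" if "poly ?g z = 0" for z
    using roots[of z] that by (simp add: fe cpoly_mult)
  moreover have "?g \<noteq> 0" using g0 by (simp add: map_poly_eq_0_iff)
  ultimately have "norm (poly ?g 0) \<le> norm (lead_coeff ?g) * (2 / 3) ^ degree ?g"
    by (intro norm_poly_0_le_roots) auto
  moreover have "norm (lead_coeff ?g) = 1"
    using lg by (simp add: dg coeff_map_poly norm_of_int flip: of_int_abs)
  moreover have "norm (poly ?g 0) = \<bar>real_of_int (coeff g 0)\<bar>"
    by (simp add: poly_0_coeff_0 coeff_map_poly norm_of_int)
  moreover have "\<bar>real_of_int (coeff g 0)\<bar> \<ge> 1" using \<open>coeff g 0 \<noteq> 0\<close> by linarith
  ultimately have "(1::real) \<le> (2 / 3) ^ degree g" by (simp add: dg)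
  then have "degree g = 0"
    using power_strict_decreasing[of 0 "degree g" "2/3 :: real"] by (cases "degree g") auto
  then obtain c where c: "g = [:c:]" by (metis degree_eq_zeroE)
  have "c \<noteq> 0" using c g0 by auto
  moreover have "smult c (monom 1 e) \<in> I" using f(1) by (simp add: fe c)
  ultimately show ?thesis using sat by blast
qed

section \<open>Quotients treated as congruences\<close>

locale normal_subgrp =
  fixes A B :: "'a::group_add set"
  assumes A: "subgrp A" and B: "subgrp B" and BA: "B \<subseteq> A" and normal: "normalizes A B"
begin

text \<open>The congruence stands for equality in \<open>A / B\<close>, so that all calculations
  stay in one type. Membership in \<open>A\<close> is built in, which keeps transitivity chains free
  of side conditions.\<close>

definition eqv :: "'a \<Rightarrow> 'a \<Rightarrow> bool" (infix "\<asymp>" 50) where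
  "x \<asymp> y \<longleftrightarrow> x \<in> A \<and> y \<in> A \<and> x - y \<in> B"

lemma conj_in_B: "x \<in> A \<Longrightarrow> b \<in> B \<Longrightarrow> conj_by x b \<in> B"
  by (rule normalizesD[OF normal])

lemma eqv_refl: "x \<in> A \<Longrightarrow> x \<asymp> x"
  by (simp add: eqv_def subgrp_0[OF B])

lemma eqv_sym: "x \<asymp> y \<Longrightarrow> y \<asymp> x"
  using subgrp_uminus[OF B, of "x - y"] by (simp add: eqv_def)

lemma eqv_trans [trans]: "x \<asymp> y \<Longrightarrow> y \<asymp> z \<Longrightarrow> x \<asymp> z"
  using subgrp_add[OF B, of "x - y" "y - z"] by (simp add: eqv_def add_diff_eq)

lemma eqv_add:
  assumes "x \<asymp> x'" "y \<asymp> y'"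
  shows "x + y \<asymp> x' + y'"
proof -
  have "(x + y) - (x' + y') = conj_by x (y - y') + (x - x')"
    by (simp add: conj_by_def diff_conv_add_uminus minus_add add.assoc del: add_uminus_conv_diff)
  then show ?thesis using assms conj_in_B[of x "y - y'"] A B subgrp_add by (auto simp: eqv_def)
qed

lemma eqv_uminus: "x \<asymp> y \<Longrightarrow> - x \<asymp> - y"
proof -
  assume "x \<asymp> y"
  then have *: "x \<in> A" "y \<in> A" "y - x \<in> B" using eqv_sym by (auto simp: eqv_def)
  have "- x - - y = conj_by (- x) (y - x)"
    by (simp add: conj_by_def diff_conv_add_uminus add.assoc del: add_uminus_conv_diff)
  then show "- x \<asymp> - y" using * conj_in_B[of "- x" "y - x"] A subgrp_uminus by (auto simp: eqv_def)
qed

lemma eqv_diff: "x \<asymp> x' \<Longrightarrow> y \<asymp> y' \<Longrightarrow> x - y \<asymp> x' - y'"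
  using eqv_add[of x x' "- y" "- y'"] eqv_uminus[of y y'] by simp

lemma eqv_0_iff: "x \<asymp> 0 \<longleftrightarrow> x \<in> B"
  using BA subgrp_0[OF A] by (auto simp: eqv_def)

lemma eqv_zmul: "x \<asymp> y \<Longrightarrow> zmul c x \<asymp> zmul c y"
proof (induction c rule: int_induct[where k=0])
  case base
  then show ?case using eqv_refl subgrp_0[OF A] by simp
next
  case (step1 i)
  then show ?case by (simp add: zmul_plus_1 eqv_add)
next
  case (step2 i)
  then show ?case by (simp add: zmul_minus_1 eqv_add eqv_uminus)
qed

text \<open>Modulo \<open>B\<close>, conjugation by \<open>s\<close> fixes \<open>f\<close> and
  therefore its multiples.\<close>

lemma central_commute:
  assumes "s \<in> A" "f \<in> A" "comm s f \<in> B"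
  shows "zmul c f + s \<asymp> s + zmul c f"
proof -
  have "conj_by s f \<asymp> f" using assms conj_by_closed[OF A] by (simp add: eqv_def comm_eq_conj_by)
  then have "zmul c (conj_by s f) \<asymp> zmul c f" by (rule eqv_zmul)
  then have "conj_by s (zmul c f) \<asymp> zmul c f" by (simp add: conj_by_zmul)
  then have "conj_by s (zmul c f) + s \<asymp> zmul c f + s" by (intro eqv_add eqv_refl assms)
  moreover have "conj_by s (zmul c f) + s = s + zmul c f" by (simp add: conj_by_def)
  ultimately show ?thesis using eqv_sym by simp
qed

end

locale abelian_quotient =
  fixes A B :: "'a::group_add set"
  assumes A: "subgrp A" and B: "subgrp B" and BA: "B \<subseteq> A"
    and commB: "x \<in> A \<Longrightarrow> y \<in> A \<Longrightarrow> comm x y \<in> B"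
begin

sublocale normal_subgrp A B
  by unfold_locales (use A B BA commB normalizes_comm in blast)+

lemma eqv_add_commute: "x \<in> A \<Longrightarrow> y \<in> A \<Longrightarrow> x + y \<asymp> y + x"
proof -
  have "(x + y) - (y + x) = comm x y"
    by (simp add: comm_def diff_conv_add_uminus minus_add add.assoc del: add_uminus_conv_diff)
  then show "x \<in> A \<Longrightarrow> y \<in> A \<Longrightarrow> x + y \<asymp> y + x" using commB A subgrp_add by (auto simp: eqv_def)
qed

lemma eqv_add_add_swap:
  assumes "p \<in> A" "q \<in> A" "r \<in> A" "s \<in> A"
  shows "(p + q) + (r + s) \<asymp> (p + r) + (q + s)"
proof -
  have "(p + q) + (r + s) = p + ((q + r) + s)" by (simp add: add.assoc)
  also have "\<dots> \<asymp> p + ((r + q) + s)"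
    using assms A subgrp_add by (intro eqv_add eqv_add_commute eqv_refl)
  finally show ?thesis by (simp add: add.assoc)
qed

lemma eqv_add_diff_swap:
  assumes "p \<in> A" "q \<in> A" "r \<in> A" "s \<in> A"
  shows "(p + q) - (r + s) \<asymp> (p - r) + (q - s)"
proof -
  have "(p + q) - (r + s) = (p + q) + (- s + - r)" by (simp only: diff_conv_add_uminus minus_add)
  also have "\<dots> \<asymp> (p + q) + (- r + - s)"
    using assms A by (intro eqv_add eqv_add_commute eqv_refl) (auto simp: subgrp_closed)
  also have "\<dots> \<asymp> (p + - r) + (q + - s)"
    using assms A by (intro eqv_add_add_swap) (auto simp: subgrp_closed)
  finally show ?thesis by simp
qed

lemma eqv_zmul_distrib: "x \<in> A \<Longrightarrow> y \<in> A \<Longrightarrow> zmul c (x + y) \<asymp> zmul c x + zmul c y"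
proof (induction c rule: int_induct[where k=0])
  case base
  then show ?case using eqv_refl subgrp_0[OF A] by simp
next
  case (step1 i)
  have "zmul (i + 1) (x + y) = (x + y) + zmul i (x + y)" by (rule zmul_plus_1)
  also have "\<dots> \<asymp> (x + y) + (zmul i x + zmul i y)"
    using step1 by (intro eqv_add eqv_refl) (auto intro: subgrp_add[OF A])
  also have "\<dots> \<asymp> (x + zmul i x) + (y + zmul i y)"
    using step1 by (intro eqv_add_add_swap) (auto intro: zmul_closed[OF A])
  finally show ?case by (simp only: zmul_plus_1)
next
  case (step2 i)
  have m: "- x \<in> A" "- y \<in> A" using step2 A subgrp_uminus by auto
  have "zmul (i - 1) (x + y) = (- y + - x) + zmul i (x + y)" by (simp only: zmul_minus_1 minus_add)
  also have "\<dots> \<asymp> (- x + - y) + (zmul i x + zmul i y)"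
    using step2 m by (intro eqv_add eqv_add_commute)
  also have "\<dots> \<asymp> (- x + zmul i x) + (- y + zmul i y)"
    using step2 m by (intro eqv_add_add_swap) (auto intro: zmul_closed[OF A])
  finally show ?case by (simp only: zmul_minus_1)
qed

lemma eqv_comm_add:
  assumes "x \<in> A" "y \<in> A" "conj_by t x \<in> A" "conj_by t y \<in> A"
  shows "comm t (x + y) \<asymp> comm t x + comm t y"
  using eqv_add_diff_swap[of "conj_by t x" "conj_by t y" x y] assms
  by (simp add: comm_eq_conj_by conj_by_add)

lemma eqv_comm_diff:
  assumes "x \<in> A" "y \<in> A" "conj_by t x \<in> A" "conj_by t y \<in> A"
  shows "comm t (x - y) \<asymp> comm t x - comm t y"
proof -
  have *: "x - y \<in> A" "conj_by t (x - y) \<in> A" using assms A subgrp_diff by (auto simp: conj_by_diff)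
  have c: "comm t x \<in> A" "comm t y \<in> A" "comm t (x - y) \<in> A"
    using assms * subgrp_diff[OF A] by (auto simp: comm_eq_conj_by)
  have "comm t (x - y + y) \<asymp> comm t (x - y) + comm t y" using assms * by (intro eqv_comm_add)
  then have "comm t x - comm t y \<asymp> comm t (x - y) + comm t y - comm t y"
    using c by (intro eqv_diff eqv_refl) simp_all
  then show ?thesis using eqv_sym by simp
qed

end

section \<open>Unipotent action on a torsion free abelian factor\<close>

locale unipotent_action = abelian_quotient A B for A B :: "'a::group_add set" +
  fixes G :: "'a set" and t a :: 'a
  assumes G: "subgrp G" "nofree G" and AG: "A \<subseteq> G" and fgA: "fg A" and t: "t \<in> G" and a: "a \<in> A"
    and tf: "x \<in> A \<Longrightarrow> n \<noteq> 0 \<Longrightarrow> zmul n x \<in> B \<Longrightarrow> x \<in> B"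
    and tA: "x \<in> A \<Longrightarrow> conj_by t x \<in> A" and tB: "x \<in> B \<Longrightarrow> conj_by t x \<in> B"
    and cong3: "x \<in> A \<Longrightarrow> \<exists>y\<in>A. comm t x - zmul 3 y \<in> B"
begin

lemma zmul_cancel: "zmul c x \<asymp> zmul c y \<Longrightarrow> c \<noteq> 0 \<Longrightarrow> x \<in> A \<Longrightarrow> y \<in> A \<Longrightarrow> x \<asymp> y"
proof -
  assume *: "zmul c x \<asymp> zmul c y" "c \<noteq> 0" "x \<in> A" "y \<in> A"
  have m: "- y \<in> A" using * A subgrp_uminus by blast
  have "zmul c (- y) = - zmul c y" using zmul_mult[of c "-1" y] zmul_uminus[of c y] zmul_uminus[of 1 y] by simp
  then have "zmul c (x - y) \<asymp> zmul c x - zmul c y"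
    using eqv_zmul_distrib[OF *(3) m, of c] by simp
  also have "\<dots> \<asymp> zmul c y - zmul c y"
    using * by (intro eqv_diff eqv_refl) (auto intro: zmul_closed[OF A])
  finally have "zmul c (x - y) \<in> B" by (simp add: eqv_0_iff)
  then show "x \<asymp> y" using tf[OF subgrp_diff[OF A *(3,4)] *(2)] *(3,4) by (simp add: eqv_def)
qed

text \<open>A representative of the endomorphism (T - 1) / 3 of \<open>A / B\<close>, where T is
  conjugation by \<open>t\<close>; \<open>cong3\<close> gives existence and torsion freeness makes
  it well defined modulo \<open>B\<close>. The value at 0 is exactly 0, so that the recursion of
  \<open>ev\<close> below holds as an equation even for \<open>pCons 0 0\<close>.\<close>

definition U :: "'a \<Rightarrow> 'a" where
  "U x = (if x = 0 then 0 else SOME y. y \<in> A \<and> comm t x - zmul 3 y \<in> B)"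

lemma comm_A: "x \<in> A \<Longrightarrow> comm t x \<in> A"
  using tA subgrp_diff[OF A] by (simp add: comm_eq_conj_by)

lemma U: "x \<in> A \<Longrightarrow> U x \<in> A" "x \<in> A \<Longrightarrow> comm t x \<asymp> zmul 3 (U x)"
proof -
  assume x: "x \<in> A"
  have "U x \<in> A \<and> comm t x - zmul 3 (U x) \<in> B"
  proof (cases "x = 0")
    case True
    then show ?thesis using A B subgrp_0 by (auto simp: U_def comm_def)
  next
    case False
    then show ?thesis using someI_ex[of "\<lambda>y. y \<in> A \<and> comm t x - zmul 3 y \<in> B"] cong3[OF x]
      by (auto simp: U_def)
  qed
  then show "U x \<in> A" "comm t x \<asymp> zmul 3 (U x)"
    using comm_A[OF x] zmul_closed[OF A] by (auto simp: eqv_def)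
qed

lemma comm_cong: "x \<asymp> y \<Longrightarrow> comm t x \<asymp> comm t y"
proof -
  assume xy: "x \<asymp> y"
  have "conj_by t x - conj_by t y \<in> B" using tB[of "x - y"] xy by (simp add: eqv_def conj_by_diff)
  then have "conj_by t x \<asymp> conj_by t y" using xy tA by (auto simp: eqv_def)
  then show ?thesis using xy by (simp add: comm_eq_conj_by eqv_diff)
qed

lemma U_add: "x \<in> A \<Longrightarrow> y \<in> A \<Longrightarrow> U (x + y) \<asymp> U x + U y"
proof -
  assume xy: "x \<in> A" "y \<in> A"
  then have s: "x + y \<in> A" using A subgrp_add by blast
  have "zmul 3 (U (x + y)) \<asymp> comm t (x + y)" by (rule eqv_sym[OF U(2)[OF s]])
  also have "\<dots> \<asymp> comm t x + comm t y" using xy tA by (intro eqv_comm_add)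
  also have "\<dots> \<asymp> zmul 3 (U x) + zmul 3 (U y)" by (intro eqv_add U xy)
  also have "\<dots> \<asymp> zmul 3 (U x + U y)" by (intro eqv_sym[OF eqv_zmul_distrib] U xy)
  finally show ?thesis by (rule zmul_cancel) (use xy s U(1) subgrp_add[OF A] in auto)
qed

lemma U_cong: "x \<asymp> y \<Longrightarrow> U x \<asymp> U y"
proof -
  assume xy: "x \<asymp> y"
  then have m: "x \<in> A" "y \<in> A" by (auto simp: eqv_def)
  have "zmul 3 (U x) \<asymp> comm t x" by (rule eqv_sym[OF U(2)[OF m(1)]])
  also have "\<dots> \<asymp> comm t y" by (rule comm_cong[OF xy])
  also have "\<dots> \<asymp> zmul 3 (U y)" by (rule U(2)[OF m(2)])
  finally show ?thesis by (rule zmul_cancel) (use m U(1) in auto)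
qed

text \<open>Horner's scheme for a polynomial in \<open>U\<close>, applied to \<open>a\<close>; its
  kernel modulo \<open>B\<close> is the annihilator of \<open>a\<close>.\<close>

definition ev :: "int poly \<Rightarrow> 'a" where
  "ev p = fold_coeffs (\<lambda>c y. zmul c a + U y) p 0"

lemma ev_0 [simp]: "ev 0 = 0"
  by (simp add: ev_def)

lemma ev_pCons: "ev (pCons c p) = zmul c a + U (ev p)"
proof (cases "c = 0 \<and> p = 0")
  case True
  then show ?thesis by (simp add: U_def)
next
  case False
  then show ?thesis by (cases "p = 0") (auto simp: ev_def fold_coeffs_def cCons_def)
qed

lemma ev_in_A: "ev p \<in> A"
  by (induction p) (auto simp: ev_pCons subgrp_0[OF A] intro!: subgrp_add[OF A] zmul_closed[OF A] a U)

lemma ev_add: "ev (p + q) \<asymp> ev p + ev q"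
proof (induction p q rule: poly_induct2)
  case 0
  then show ?case using eqv_refl subgrp_0[OF A] by simp
next
  case (pCons c p d q)
  have za: "zmul k a \<in> A" for k by (rule zmul_closed[OF A a])
  have "ev (pCons c p + pCons d q) = (zmul c a + zmul d a) + U (ev (p + q))"
    by (simp add: ev_pCons zmul_add)
  also have "\<dots> \<asymp> (zmul c a + zmul d a) + U (ev p + ev q)"
    using za subgrp_add[OF A] by (intro eqv_add eqv_refl U_cong pCons) auto
  also have "\<dots> \<asymp> (zmul c a + zmul d a) + (U (ev p) + U (ev q))"
    using za subgrp_add[OF A] by (intro eqv_add eqv_refl U_add ev_in_A) auto
  also have "\<dots> \<asymp> (zmul c a + U (ev p)) + (zmul d a + U (ev q))"
    by (intro eqv_add_add_swap za U ev_in_A)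
  finally show ?case by (simp only: ev_pCons)
qed

lemma ev_diff: "ev (p - q) \<asymp> ev p - ev q"
proof -
  have "ev p \<asymp> ev (p - q) + ev q" using ev_add[of "p - q" q] by simp
  then have "ev p - ev q \<asymp> ev (p - q) + ev q - ev q" by (intro eqv_diff eqv_refl ev_in_A)
  then show ?thesis using eqv_sym by simp
qed

lemma ev_smult: "ev (smult c p) \<asymp> zmul c (ev p)"
proof (induction c rule: int_induct[where k=0])
  case base
  then show ?case using eqv_refl subgrp_0[OF A] by simp
next
  case (step1 i)
  have "ev (smult (i + 1) p) \<asymp> ev p + ev (smult i p)"
    using ev_add[of p "smult i p"] by (simp add: smult_add_left add.commute)
  also have "\<dots> \<asymp> ev p + zmul i (ev p)" by (intro eqv_add eqv_refl ev_in_A step1)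
  finally show ?case by (simp only: zmul_plus_1)
next
  case (step2 i)
  have "ev (smult (i - 1) p) \<asymp> ev (smult i p) - ev p"
    using ev_diff[of "smult i p" p] by (simp add: smult_diff_left)
  also have "\<dots> \<asymp> zmul i (ev p) + - ev p" using step2 by (simp add: eqv_diff eqv_refl ev_in_A)
  also have "\<dots> \<asymp> - ev p + zmul i (ev p)"
    by (intro eqv_add_commute zmul_closed[OF A] ev_in_A subgrp_uminus[OF A])
  finally show ?case by (simp only: zmul_minus_1)
qed

lemma ev_X: "ev (pCons 0 p) = U (ev p)"
  by (simp add: ev_pCons)

lemma ev_1: "ev 1 = a"
  by (simp add: one_pCons ev_pCons U_def)

text \<open>Conjugation by \<open>t\<close> is 1 + 3 \<open>U\<close>, hence multiplication by
  \<open>[:1, 3:]\<close> on polynomials.\<close>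

lemma ev_conj: "ev ([:1, 3:] * p) \<asymp> conj_by t (ev p)"
proof -
  have "ev ([:1, 3:] * p) = ev (p + smult 3 (pCons 0 p))" by simp
  also have "\<dots> \<asymp> ev p + ev (smult 3 (pCons 0 p))" by (rule ev_add)
  also have "\<dots> \<asymp> ev p + zmul 3 (U (ev p))"
    using ev_smult[of 3 "pCons 0 p"] by (intro eqv_add eqv_refl ev_in_A) (simp add: ev_X)
  also have "\<dots> \<asymp> ev p + comm t (ev p)"
    by (intro eqv_add eqv_refl ev_in_A eqv_sym[OF U(2)])
  also have "\<dots> \<asymp> comm t (ev p) + ev p"
    by (intro eqv_add_commute ev_in_A comm_A)
  finally show ?thesis by (simp add: conj_by_eq_comm)
qed

lemma conj_cong: "x \<asymp> y \<Longrightarrow> conj_by t x \<asymp> conj_by t y"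
  using tB[of "x - y"] tA by (auto simp: eqv_def conj_by_diff)

lemma ev_conj_power: "x \<asymp> ev p \<Longrightarrow> conj_by (zmul (int k) t) x \<asymp> ev ([:1, 3:] ^ k * p)"
proof (induction k)
  case (Suc k)
  have "conj_by (zmul (int (Suc k)) t) x = conj_by t (conj_by (zmul (int k) t) x)"
    using zmul_plus_1[of "int k" t] by (simp add: conj_by_conj_by add.commute)
  also have "\<dots> \<asymp> conj_by t (ev ([:1, 3:] ^ k * p))" by (intro conj_cong Suc)
  also have "\<dots> \<asymp> ev ([:1, 3:] * ([:1, 3:] ^ k * p))" by (rule eqv_sym[OF ev_conj])
  finally show ?case by (simp only: power_Suc mult.assoc)
qed simp

text \<open>The kernel of \<open>ev\<close> modulo \<open>B\<close> fits
  \<open>annihilator_contains_power\<close>: saturation is torsion freeness, a monic element comes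
  from finite generation, and the relations with unit coefficients come from the absence of free
  subsemigroups.\<close>

lemma power_in_annihilator: "\<exists>e. ev (monom 1 e) \<in> B"
proof -
  define I where "I = {p. ev p \<in> B}"
  have "\<exists>e. monom 1 e \<in> I"
  proof -
    have add: "p + q \<in> I" if "p \<in> I" "q \<in> I" for p q
    proof -
      have "ev (p + q) \<asymp> ev p + ev q" by (rule ev_add)
      also have "\<dots> \<asymp> 0 + 0" using that by (intro eqv_add) (simp_all add: eqv_0_iff I_def)
      finally show ?thesis by (simp add: I_def eqv_0_iff)
    qed
    have diff: "p - q \<in> I" if "p \<in> I" "q \<in> I" for p q
    proof -
      have "ev (p - q) \<asymp> ev p - ev q" by (rule ev_diff)
      also have "\<dots> \<asymp> 0 - 0" using that by (intro eqv_diff) (simp_all add: eqv_0_iff I_def)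
      finally show ?thesis by (simp add: I_def eqv_0_iff)
    qed
    have smult: "smult c p \<in> I" if "p \<in> I" for c p
    proof -
      have "ev (smult c p) \<asymp> zmul c (ev p)" by (rule ev_smult)
      moreover have "zmul c (ev p) \<in> B" using that zmul_closed[OF B] by (simp add: I_def)
      ultimately show ?thesis using eqv_trans[of _ _ 0] by (simp add: I_def eqv_0_iff)
    qed
    have X: "pCons 0 p \<in> I" if "p \<in> I" for p
    proof -
      have "U (ev p) \<asymp> U 0" using that by (intro U_cong) (simp add: I_def eqv_0_iff)
      then show ?thesis by (simp add: I_def ev_X eqv_0_iff U_def)
    qed
    have mult: "q * p \<in> I" if "p \<in> I" for p q
      using that
    proof (induction q)
      case 0
      then show ?case using diff[of p p] by simp
    next
      case (pCons c q)
      then show ?case by (simp add: add smult X)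
    qed
    have sat: "p \<in> I" if "smult c p \<in> I" "c \<noteq> 0" for c p
    proof -
      have "zmul c (ev p) \<asymp> ev (smult c p)" by (rule eqv_sym[OF ev_smult])
      moreover have "ev (smult c p) \<asymp> 0" using that by (simp add: I_def eqv_0_iff)
      ultimately have "zmul c (ev p) \<in> B" using eqv_trans eqv_0_iff by blast
      then show ?thesis using tf ev_in_A that(2) by (simp add: I_def)
    qed
    have monic: "\<exists>F\<in>I. lead_coeff F = 1"
    proof -
      \<comment> \<open>\<open>X n\<close> is spanned modulo \<open>B\<close> by the images of
        \<open>a\<close> under the powers of \<open>U\<close> below \<open>n\<close>. When the chain
        stops, the \<open>n\<close>-th power of \<open>U\<close> applied to \<open>a\<close> is a
        combination of lower ones, which is a monic relation.\<close>
      define X where "X n = {y. \<exists>p. (p = 0 \<or> degree p < n) \<and> y \<asymp> ev p}" for n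
      have mem: "0 \<in> X n" for n
      proof -
        have "0 \<asymp> ev 0" using eqv_refl subgrp_0[OF A] by simp
        then show ?thesis unfolding X_def by blast
      qed
      have "\<exists>n. \<forall>m. X m \<subseteq> X n"
      proof (rule ascending_chain_stops[OF fgA nofree_subset[OF G(2) AG] A])
        show "comm x y \<in> X 0" if "x \<in> A" "y \<in> A" for x y
        proof -
          have "comm x y \<asymp> ev 0" using commB[OF that] by (simp add: eqv_0_iff)
          then show ?thesis unfolding X_def by blast
        qed
        show "X n \<subseteq> X (Suc n)" for n unfolding X_def using less_SucI by blast
        show "X n \<subseteq> A" for n unfolding X_def eqv_def by blast
        show "subgrp (X n)" for n
          unfolding subgrp_def
        proof (intro conjI ballI)
          fix x y assume "x \<in> X n" "y \<in> X n"
          then obtain p q where p: "p = 0 \<or> degree p < n" "x \<asymp> ev p"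
            and q: "q = 0 \<or> degree q < n" "y \<asymp> ev q" by (auto simp: X_def)
          have "x - y \<asymp> ev p - ev q" by (rule eqv_diff[OF p(2) q(2)])
          also have "\<dots> \<asymp> ev (p - q)" by (rule eqv_sym[OF ev_diff])
          finally have "x - y \<asymp> ev (p - q)" .
          moreover have "p - q = 0 \<or> degree (p - q) < n"
            using p(1) q(1) degree_diff_less[of p n q] by (cases "p = 0"; cases "q = 0") auto
          ultimately show "x - y \<in> X n" by (auto simp: X_def)
        qed (rule mem)
      qed
      then obtain n where "X (Suc n) \<subseteq> X n" by blast
      moreover have "ev (monom 1 n) \<in> X (Suc n)"
      proof -
        have "degree (monom (1::int) n) < Suc n" by (simp add: degree_monom_eq)
        then show ?thesis unfolding X_def using eqv_refl[OF ev_in_A] by blast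
      qed
      ultimately have "ev (monom 1 n) \<in> X n" by blast
      then obtain p where p: "p = 0 \<or> degree p < n" "ev (monom 1 n) \<asymp> ev p"
        unfolding X_def by blast
      have "ev (monom 1 n - p) \<asymp> ev (monom 1 n) - ev p" by (rule ev_diff)
      also have "\<dots> \<asymp> ev p - ev p" by (intro eqv_diff eqv_refl ev_in_A p)
      finally have "monom 1 n - p \<in> I" by (simp add: I_def eqv_0_iff)
      moreover have "lead_coeff (monom 1 n - p) = 1"
      proof -
        have "coeff p n = 0" "degree p \<le> n" using p(1) by (auto simp: coeff_eq_0)
        then have c: "coeff (monom 1 n - p) n = 1" by simp
        then have "n \<le> degree (monom 1 n - p)" by (intro le_degree) simp
        moreover have "degree (monom 1 n - p) \<le> n"
          using \<open>degree p \<le> n\<close> by (intro degree_diff_le) (auto simp: degree_monom_le)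
        ultimately show ?thesis using c by simp
      qed
      ultimately show ?thesis by blast
    qed
    have coll: "\<exists>\<delta>::nat \<Rightarrow> int. \<exists>n. (\<exists>i<n. \<delta> i \<noteq> 0) \<and> (\<forall>i<n. \<bar>\<delta> i\<bar> \<le> 1) \<and>
        (\<Sum>i<n. smult (\<delta> i) ([:1, 3:] ^ (m * i))) \<in> I" if "m > 0" for m :: nat
    proof -
      let ?s = "zmul (int m) t"
      obtain v w where vw: "length v = length w" "v \<noteq> w" "csum ?s a v = csum ?s a w"
        using nofree_csum[OF G(2,1), of a ?s] a AG zmul_closed[OF G(1) t] by blast
      \<comment> \<open>Conjugation by \<open>zmul m t\<close> multiplies by the \<open>m\<close>-th
        power of \<open>[:1, 3:]\<close>. Two colliding sums thus become two combinations of its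
        powers with coefficients 0 and 1, whose difference is the relation.\<close>
      define Q where "Q u = (\<Sum>i<length u. smult (of_bool (u ! i)) ([:1, 3:] ^ (m * i)) :: int poly)" for u
      have Q: "csum ?s a u \<asymp> ev (Q u)" for u
      proof (induction u)
        case Nil
        then show ?case using eqv_refl subgrp_0[OF A] by (simp add: Q_def)
      next
        case (Cons c u)
        have q: "Q (c # u) = (if c then 1 else 0) + [:1, 3:] ^ m * Q u"
        proof -
          have "Q (c # u) = (\<Sum>i<Suc (length u). smult (of_bool ((c # u) ! i)) ([:1, 3:] ^ (m * i)))"
            by (simp only: Q_def length_Cons)
          also have "\<dots> = smult (of_bool ((c # u) ! 0)) ([:1, 3:] ^ (m * 0)) +
              (\<Sum>i<length u. smult (of_bool ((c # u) ! Suc i)) ([:1, 3:] ^ (m * Suc i)))"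
            by (rule sum.lessThan_Suc_shift)
          finally show ?thesis
            by (simp add: Q_def sum_distrib_left power_add del: mult_pCons_left)
        qed
        have "csum ?s a (c # u) = (if c then a else 0) + conj_by ?s (csum ?s a u)" by simp
        also have "\<dots> \<asymp> ev (if c then 1 else 0) + ev ([:1, 3:] ^ m * Q u)"
          using eqv_refl[OF a] eqv_refl[OF subgrp_0[OF A]]
          by (intro eqv_add ev_conj_power Cons) (auto simp: ev_1)
        also have "\<dots> \<asymp> ev (Q (c # u))" unfolding q by (rule eqv_sym[OF ev_add])
        finally show ?case .
      qed
      define \<delta> :: "nat \<Rightarrow> int" where "\<delta> i = of_bool (v ! i) - of_bool (w ! i)" for i
      have "ev (Q v - Q w) \<asymp> ev (Q v) - ev (Q w)" by (rule ev_diff)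
      also have "\<dots> \<asymp> csum ?s a v - csum ?s a w" by (intro eqv_diff eqv_sym[OF Q])
      finally have "Q v - Q w \<in> I" by (simp add: I_def vw(3) eqv_0_iff)
      moreover have "Q v - Q w = (\<Sum>i<length v. smult (\<delta> i) ([:1, 3:] ^ (m * i)))"
        by (simp add: Q_def \<delta>_def vw(1) smult_diff_left flip: sum_subtractf)
      moreover have "\<exists>i<length v. \<delta> i \<noteq> 0"
      proof -
        obtain i where "i < length v" "v ! i \<noteq> w ! i" using vw(1,2) nth_equalityI by blast
        then show ?thesis by (auto simp: \<delta>_def)
      qed
      moreover have "\<forall>i<length v. \<bar>\<delta> i\<bar> \<le> 1" by (auto simp: \<delta>_def)
      ultimately show ?thesis by metis
    qed
    obtain F where F: "F \<in> I" "lead_coeff F = 1" using monic by blast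
    show ?thesis by (rule annihilator_contains_power[OF diff mult sat F coll])
  qed
  then show ?thesis by (simp add: I_def)
qed

text \<open>Modulo \<open>B\<close>, \<open>comm t\<close> acts as 3 \<open>U\<close>, so a power of
  \<open>U\<close> that kills \<open>a\<close> gives a power of \<open>comm t\<close> that kills
  it.\<close>

lemma unipotent: "\<exists>e. (comm t ^^ e) a \<in> B"
proof -
  obtain e where e: "ev (monom 1 e) \<in> B" using power_in_annihilator by blast
  have ev: "(comm t ^^ k) a \<asymp> ev (monom (3 ^ k) k)" for k
  proof (induction k)
    case 0
    then show ?case using eqv_refl[OF a] ev_1 by (simp add: monom_0 one_pCons)
  next
    case (Suc k)
    have "(comm t ^^ Suc k) a = comm t ((comm t ^^ k) a)" by simp
    also have "\<dots> \<asymp> comm t (ev (monom (3 ^ k) k))" by (rule comm_cong[OF Suc])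
    also have "\<dots> \<asymp> zmul 3 (U (ev (monom (3 ^ k) k)))" by (rule U(2)[OF ev_in_A])
    also have "\<dots> = zmul 3 (ev (monom (3 ^ k) (Suc k)))" by (simp add: monom_Suc ev_X)
    also have "\<dots> \<asymp> ev (smult 3 (monom (3 ^ k) (Suc k)))" by (rule eqv_sym[OF ev_smult])
    finally show ?case by (simp add: smult_monom)
  qed
  have "ev (monom (3 ^ e) e) \<asymp> zmul (3 ^ e) (ev (monom 1 e))"
    using ev_smult[of "3 ^ e" "monom 1 e"] by (simp add: smult_monom)
  moreover have "zmul (3 ^ e) (ev (monom 1 e)) \<asymp> 0"
    using zmul_closed[OF B e] by (simp add: eqv_0_iff)
  ultimately have "(comm t ^^ e) a \<asymp> 0" using ev[of e] eqv_trans by blast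
  then show ?thesis by (auto simp: eqv_0_iff)
qed

end

section \<open>Finiteness of abelian factors modulo 3\<close>

lemma subgrp_Int: "subgrp A \<Longrightarrow> subgrp B \<Longrightarrow> subgrp (A \<inter> B)"
  by (simp add: subgrp_def)

lemma comm_add_left: "comm (g + h) x = conj_by g (comm h x) + comm g x"
  by (simp add: comm_eq_conj_by conj_by_diff conj_by_conj_by add_diff_eq)

lemma zmul_minus_right: "zmul c (- x) = - zmul c x"
  using zmul_mult[of c "-1" x] zmul_uminus[of c x] zmul_uminus[of 1 x] by simp

lemma comm_uminus_left: "comm (- g) x = - conj_by (- g) (comm g x)"
  by (simp add: comm_eq_conj_by conj_by_diff)

lemma comm_conj_by: "comm g (conj_by t x) = conj_by t (comm (conj_by (- t) g) x)"
proof -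
  have "conj_by g (conj_by t x) = conj_by t (conj_by (conj_by (- t) g) x)"
    by (simp add: conj_by_conj_by) (simp add: conj_by_def add.assoc[symmetric])
  then show ?thesis by (simp add: comm_eq_conj_by conj_by_diff)
qed

lemma subgrp_comm_stabilizer:
  assumes "subgrp H" "subgrp F" "normalizes H F"
  shows "subgrp {g \<in> H. comm g x \<in> F}"
proof (rule subgrpI)
  show "0 \<in> {g \<in> H. comm g x \<in> F}" using subgrp_0[OF assms(1)] subgrp_0[OF assms(2)] by (simp add: comm_def)
  show "g + h \<in> {g \<in> H. comm g x \<in> F}"
    if "g \<in> {g \<in> H. comm g x \<in> F}" "h \<in> {g \<in> H. comm g x \<in> F}" for g h
    using that subgrp_add[OF assms(1)] subgrp_add[OF assms(2)] normalizesD[OF assms(3)]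
    by (auto simp: comm_add_left)
  show "- g \<in> {g \<in> H. comm g x \<in> F}" if "g \<in> {g \<in> H. comm g x \<in> F}" for g
    using that subgrp_uminus[OF assms(1)] subgrp_uminus[OF assms(2)] normalizesD[OF assms(3)]
    by (auto simp: comm_uminus_left)
qed

lemma subgrp_sum_normal:
  assumes "subgrp A" "subgrp B" "normalizes A B"
  shows "subgrp {a + b | a b. a \<in> A \<and> b \<in> B}" (is "subgrp ?C")
proof (rule subgrpI)
  have "0 + 0 \<in> ?C" using assms subgrp_0 by blast
  then show "0 \<in> ?C" by simp
next
  fix x y assume "x \<in> ?C" "y \<in> ?C"
  then obtain a b a' b' where ab: "a \<in> A" "b \<in> B" "a' \<in> A" "b' \<in> B" and x: "x = a + b" and y: "y = a' + b'"
    by blast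
  have "x + y = (a + a') + (conj_by (- a') b + b')"
    by (simp add: x y conj_by_def add.assoc)
  moreover have "conj_by (- a') b \<in> B" using ab assms normalizesD subgrp_uminus by blast
  ultimately show "x + y \<in> ?C" using ab assms subgrp_add by blast
next
  fix x assume "x \<in> ?C"
  then obtain a b where ab: "a \<in> A" "b \<in> B" and x: "x = a + b" by blast
  have "- x = - a + conj_by a (- b)"
    by (simp add: x conj_by_def minus_add add.assoc diff_conv_add_uminus del: add_uminus_conv_diff)
  moreover have "conj_by a (- b) \<in> B" using ab assms normalizesD subgrp_uminus by blast
  ultimately show "- x \<in> ?C" using ab assms subgrp_uminus by blast
qed

context abelian_quotient
begin

text \<open>The preimage in \<open>A\<close> of 3 (\<open>A / B\<close>).\<close>

definition triples :: "'a set" where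
  "triples = {y. \<exists>z\<in>A. y \<asymp> zmul 3 z}"

lemma triples_subset: "triples \<subseteq> A"
  by (auto simp: triples_def eqv_def)

lemma B_subset_triples: "B \<subseteq> triples"
  using subgrp_0[OF A] by (force simp: triples_def eqv_0_iff)

lemma subgrp_triples: "subgrp triples"
proof (rule subgrpI)
  show "0 \<in> triples" using B_subset_triples subgrp_0[OF B] by blast
next
  fix x y assume "x \<in> triples" "y \<in> triples"
  then obtain u v where *: "u \<in> A" "v \<in> A" "x \<asymp> zmul 3 u" "y \<asymp> zmul 3 v" by (auto simp: triples_def)
  have "x + y \<asymp> zmul 3 u + zmul 3 v" by (intro eqv_add *)
  also have "\<dots> \<asymp> zmul 3 (u + v)" by (rule eqv_sym[OF eqv_zmul_distrib[OF *(1,2)]])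
  finally show "x + y \<in> triples" using * subgrp_add[OF A] by (auto simp: triples_def)
next
  fix x assume "x \<in> triples"
  then obtain u where *: "u \<in> A" "x \<asymp> zmul 3 u" by (auto simp: triples_def)
  have "- x \<asymp> - zmul 3 u" by (intro eqv_uminus *)
  also have "\<dots> = zmul 3 (- u)"
    by (simp add: zmul_minus_right)
  finally show "- x \<in> triples" using * subgrp_uminus[OF A] by (auto simp: triples_def)
qed

lemma conj_by_triples:
  assumes "\<And>x. x \<in> A \<Longrightarrow> conj_by t x \<in> A" "\<And>x. x \<in> B \<Longrightarrow> conj_by t x \<in> B" "x \<in> triples"
  shows "conj_by t x \<in> triples"
proof -
  obtain u where *: "u \<in> A" "x \<asymp> zmul 3 u" using assms(3) by (auto simp: triples_def)
  then have "conj_by t x \<asymp> conj_by t (zmul 3 u)"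
    using assms(1,2) by (auto simp: eqv_def simp flip: conj_by_diff)
  then have "conj_by t x \<asymp> zmul 3 (conj_by t u)" by (simp add: conj_by_zmul)
  then show ?thesis using * assms(1) by (auto simp: triples_def)
qed

text \<open>\<open>triples\<close> contains all commutators, so generators can be added one at a
  time; each multiplies the number of classes by at most 3.\<close>

lemma finite_mod_triples:
  assumes "fg A"
  obtains C where "finite C" "C \<subseteq> A" "\<And>x. x \<in> A \<Longrightarrow> \<exists>c\<in>C. x - c \<in> triples"
proof -
  obtain S where S: "finite S" "gen S = A" using assms by (auto simp: fg_def)
  have claim: "\<exists>C. finite C \<and> C \<subseteq> A \<and> (\<forall>x\<in>gen (triples \<union> T). \<exists>c\<in>C. x - c \<in> triples)"
    if "finite T" "T \<subseteq> A" for T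
    using that
  proof (induction T rule: finite_induct)
    case empty
    then show ?case using subgrp_0[OF A] by (intro exI[of _ "{0}"]) (simp add: gen_subgrp subgrp_triples)
  next
    case (insert s T)
    then obtain C where C: "finite C" "C \<subseteq> A" "\<forall>x\<in>gen (triples \<union> T). \<exists>c\<in>C. x - c \<in> triples" by auto
    let ?B = "gen (triples \<union> T)"
    have BA': "?B \<subseteq> A" using triples_subset insert.prems by (intro gen_minimal A) auto
    have "B \<subseteq> ?B" using B_subset_triples gen_superset[of "triples \<union> T"] by auto
    then have "conj_by g x \<in> ?B" if "g \<in> A" "x \<in> ?B" for g x
      using commB[of g x] that BA' subgrp_add[OF subgrp_gen, of "comm g x" _ x]
      by (auto simp: conj_by_eq_comm)
    then have sub: "subgrp {b + zmul j s | b j. b \<in> ?B}"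
      using insert.prems A subgrp_uminus by (intro subgrp_cosets_cyclic(1) subgrp_gen) auto
    have "gen (triples \<union> insert s T) \<subseteq> {b + zmul j s | b j. b \<in> ?B}"
    proof (rule gen_minimal[OF _ sub], rule subsetI)
      fix x assume "x \<in> triples \<union> insert s T"
      then consider "x = 0 + zmul 1 s" | "x = x + zmul 0 s" "x \<in> ?B"
        using gen_superset[of "triples \<union> T"] by auto
      then show "x \<in> {b + zmul j s | b j. b \<in> ?B}" using subgrp_0[OF subgrp_gen] by cases blast+
    qed
    moreover have "\<exists>c\<in>(\<lambda>(c, k). c + zmul k s) ` (C \<times> {0..2}). (b + zmul j s) - c \<in> triples"
      if b: "b \<in> ?B" for b j
    proof -
      obtain c where c: "c \<in> C" "b - c \<in> triples" using C b by blast
      have s: "s \<in> A" using insert.prems by blast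
      have m: "b \<in> A" "c \<in> A" using b c C BA' by auto
      have "(b + zmul j s) - (c + zmul (j mod 3) s) \<asymp> (b - c) + (zmul j s - zmul (j mod 3) s)"
        using m zmul_closed[OF A s] by (intro eqv_add_diff_swap)
      also have "zmul j s - zmul (j mod 3) s = zmul (3 * (j div 3)) s"
        by (simp flip: zmul_diff add: minus_mod_eq_mult_div)
      finally have e: "(b + zmul j s) - (c + zmul (j mod 3) s) \<asymp> (b - c) + zmul 3 (zmul (j div 3) s)"
        by (simp add: zmul_mult)
      have "zmul 3 (zmul (j div 3) s) \<in> triples"
        unfolding triples_def using eqv_refl[OF zmul_closed[OF A zmul_closed[OF A s]]] zmul_closed[OF A s]
        by blast
      then have "(b - c) + zmul 3 (zmul (j div 3) s) \<in> triples"
        using c subgrp_add[OF subgrp_triples] by blast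
      then obtain z where z: "z \<in> A" "(b - c) + zmul 3 (zmul (j div 3) s) \<asymp> zmul 3 z"
        by (auto simp: triples_def)
      have "(b + zmul j s) - (c + zmul (j mod 3) s) \<asymp> zmul 3 z" by (rule eqv_trans[OF e z(2)])
      then have "(b + zmul j s) - (c + zmul (j mod 3) s) \<in> triples" using z(1) by (auto simp: triples_def)
      moreover have "c + zmul (j mod 3) s \<in> (\<lambda>(c, k). c + zmul k s) ` (C \<times> {0..2})"
        using c(1) by (intro image_eqI[of _ _ "(c, j mod 3)"]) auto
      ultimately show ?thesis by blast
    qed
    ultimately have "\<forall>x\<in>gen (triples \<union> insert s T).
        \<exists>c\<in>(\<lambda>(c, k). c + zmul k s) ` (C \<times> {0..2}). x - c \<in> triples" by blast
    moreover have "(\<lambda>(c, k). c + zmul k s) ` (C \<times> {0..2}) \<subseteq> A"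
      using C insert.prems A by (auto intro!: subgrp_add zmul_closed)
    moreover have "finite ((\<lambda>(c, k::int). c + zmul k s) ` (C \<times> {0..2}))" using C by simp
    ultimately show ?case by blast
  qed
  have "S \<subseteq> A" using S gen_superset by blast
  from claim[OF S(1) this]
  obtain C where C: "finite C" "C \<subseteq> A" "\<forall>x\<in>gen (triples \<union> S). \<exists>c\<in>C. x - c \<in> triples"
    by (elim exE conjE)
  have "A \<subseteq> gen (triples \<union> S)" using S(2) gen_mono[of S "triples \<union> S"] by auto
  then have "\<exists>c\<in>C. x - c \<in> triples" if "x \<in> A" for x using C(3) that by blast
  then show ?thesis by (rule that[OF C(1,2)])
qed

end

section \<open>Series with torsion free abelian factors\<close>

text \<open>The series is infinite and need not reach the trivial group. The cutoff \<open>d\<close>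
  only limits the factors on which \<open>H\<close> is required to act trivially modulo 3.\<close>

locale torsion_free_series =
  fixes K :: "nat \<Rightarrow> 'a::group_add set" and d :: nat
  assumes K: "subgrp (K i)" and K_Suc: "K (Suc i) \<subseteq> K i" and K_normal: "normalizes (K 0) (K i)"
    and K_comm: "x \<in> K i \<Longrightarrow> y \<in> K i \<Longrightarrow> comm x y \<in> K (Suc i)"
    and K_tf: "x \<in> K i \<Longrightarrow> n \<noteq> 0 \<Longrightarrow> zmul n x \<in> K (Suc i) \<Longrightarrow> x \<in> K (Suc i)"
    and K_fg: "fg (K i)" and K_nofree: "nofree (K 0)"
begin

lemma K_mono: "i \<le> j \<Longrightarrow> K j \<subseteq> K i"
  using K_Suc by (rule lift_Suc_antimono_le)

lemma K_0: "K i \<subseteq> K 0"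
  by (rule K_mono) simp

sublocale quot: abelian_quotient "K i" "K (Suc i)" for i
  using K K_Suc K_comm by unfold_locales auto

text \<open>A congruence subgroup of level 3: the kernel of the action of \<open>K 0\<close> on the
  finite quotients of the factors by their triples.\<close>

definition H :: "'a set" where
  "H = {g \<in> K 0. \<forall>i<d. \<forall>x\<in>K i. comm g x \<in> quot.triples i}"

lemma conj_triples: "g \<in> K 0 \<Longrightarrow> x \<in> quot.triples i \<Longrightarrow> conj_by g x \<in> quot.triples i"
  using K_normal by (intro quot.conj_by_triples) (auto simp: normalizes_def)

lemma H_subset: "H \<subseteq> K 0"
  by (auto simp: H_def)

lemma subgrp_H: "subgrp H"
proof -
  define St where "St i x = {g \<in> K 0. comm g x \<in> quot.triples i}" for i x
  have n: "normalizes (K 0) (quot.triples i)" for i by (simp add: normalizes_def conj_triples)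
  have st: "subgrp (St i x)" for i x
    unfolding St_def by (rule subgrp_comm_stabilizer[OF K quot.subgrp_triples n])
  have H: "g \<in> H \<longleftrightarrow> g \<in> K 0 \<and> (\<forall>i<d. \<forall>x\<in>K i. g \<in> St i x)" for g
    by (auto simp: H_def St_def)
  show ?thesis
  proof (rule subgrpI)
    show "0 \<in> H" unfolding H using subgrp_0[OF st] subgrp_0[OF K] by auto
    show "x + y \<in> H" if "x \<in> H" "y \<in> H" for x y
      using that unfolding H using subgrp_add[OF st] subgrp_add[OF K] by auto
    show "- x \<in> H" if "x \<in> H" for x
      using that unfolding H using subgrp_uminus[OF st] subgrp_uminus[OF K] by auto
  qed
qed

text \<open>Two elements inducing the same maps on the finitely many classes differ by an element of
  \<open>H\<close>. \<open>P g\<close> tabulates these maps on representatives, and \<open>R\<close>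
  contains one element for each table.\<close>

lemma H_finite_index: "\<exists>R. finite R \<and> R \<subseteq> K 0 \<and> (\<forall>g\<in>K 0. \<exists>r\<in>R. - r + g \<in> H)"
proof -
  have "\<forall>i. \<exists>C. finite C \<and> C \<subseteq> K i \<and> (\<forall>x\<in>K i. \<exists>c\<in>C. x - c \<in> quot.triples i)"
    using quot.finite_mod_triples[OF K_fg] by metis
  then obtain C where C: "\<And>i. finite (C i)" "\<And>i. C i \<subseteq> K i"
    "\<And>i x. x \<in> K i \<Longrightarrow> \<exists>c\<in>C i. x - c \<in> quot.triples i" by metis
  have conjK: "g \<in> K 0 \<Longrightarrow> x \<in> K i \<Longrightarrow> conj_by g x \<in> K i" for g x i
    using K_normal by (auto simp: normalizes_def)
  define p where "p g i c = (SOME c'. c' \<in> C i \<and> conj_by g c - c' \<in> quot.triples i)" for g i c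
  have p: "p g i c \<in> C i" "conj_by g c - p g i c \<in> quot.triples i" if "g \<in> K 0" "c \<in> C i" for g i c
  proof -
    have "\<exists>c'. c' \<in> C i \<and> conj_by g c - c' \<in> quot.triples i"
      using C(3)[OF conjK[OF that(1)]] C(2) that(2) by blast
    from someI_ex[OF this] show "p g i c \<in> C i" "conj_by g c - p g i c \<in> quot.triples i"
      by (auto simp: p_def)
  qed
  define P where "P g = (\<lambda>i\<in>{..<d}. \<lambda>c\<in>C i. p g i c)" for g
  have "P ` K 0 \<subseteq> (\<Pi>\<^sub>E i\<in>{..<d}. \<Pi>\<^sub>E c\<in>C i. C i)" using p by (auto simp: P_def)
  moreover have "finite (\<Pi>\<^sub>E i\<in>{..<d}. \<Pi>\<^sub>E c\<in>C i. C i)" using C(1) by (intro finite_PiE) auto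
  ultimately have fin: "finite (P ` K 0)" by (rule finite_subset)
  define R where "R = inv_into (K 0) P ` (P ` K 0)"
  have "\<exists>r\<in>R. - r + g \<in> H" if g: "g \<in> K 0" for g
  proof -
    define r where "r = inv_into (K 0) P (P g)"
    have r: "r \<in> R" "r \<in> K 0" "P r = P g"
      using g by (auto simp: R_def r_def inv_into_into f_inv_into_f)
    have "comm (- r + g) x \<in> quot.triples i" if i: "i < d" and x: "x \<in> K i" for i x
    proof -
      obtain c where c: "c \<in> C i" "x - c \<in> quot.triples i" using C(3)[OF x] by blast
      have pe: "p g i c = p r i c" using fun_cong[OF fun_cong[OF r(3), of i], of c] i c by (simp add: P_def)
      note Q = quot.subgrp_triples[of i]
      have "conj_by g x - conj_by g c \<in> quot.triples i" "conj_by r x - conj_by r c \<in> quot.triples i"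
        using conj_triples[OF _ c(2)] g r by (auto simp: conj_by_diff)
      then have "conj_by g x - p g i c \<in> quot.triples i" "conj_by r x - p g i c \<in> quot.triples i"
        using subgrp_add[OF Q, of "conj_by g x - conj_by g c" "conj_by g c - p g i c"]
          subgrp_add[OF Q, of "conj_by r x - conj_by r c" "conj_by r c - p r i c"]
          p(2)[OF g c(1)] p(2)[OF r(2) c(1)] by (simp_all add: pe add_diff_eq)
      then have "conj_by g x - conj_by r x \<in> quot.triples i"
        using subgrp_diff[OF Q, of "conj_by g x - p g i c" "conj_by r x - p g i c"]
        by (simp add: diff_conv_add_uminus minus_add add.assoc del: add_uminus_conv_diff)
      then have "conj_by (- r) (conj_by g x - conj_by r x) \<in> quot.triples i"
        using conj_triples subgrp_uminus[OF K r(2)] by blast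
      then show ?thesis by (simp add: comm_eq_conj_by conj_by_diff conj_by_conj_by)
    qed
    moreover have "- r + g \<in> K 0" using g r K subgrp_closed by blast
    ultimately show ?thesis using r(1) by (auto simp: H_def)
  qed
  moreover have "R \<subseteq> K 0" by (auto simp: R_def inv_into_into)
  moreover have "finite R" using fin by (simp add: R_def)
  ultimately show ?thesis by blast
qed

text \<open>Modulo \<open>K (Suc i)\<close> this is the upper central series for the action of
  \<open>H\<close> on the factor \<open>K i / K (Suc i)\<close>: each term is the preimage of the
  invariants over the previous one.\<close>

primrec F :: "nat \<Rightarrow> nat \<Rightarrow> 'a set" where
  "F i 0 = K (Suc i)"
| "F i (Suc l) = {x \<in> K i. \<forall>h\<in>H. comm h x \<in> F i l}"

lemma F_subset: "F i l \<subseteq> K i"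
  using K_Suc by (cases l) auto

lemma conj_K: "g \<in> K 0 \<Longrightarrow> x \<in> K i \<Longrightarrow> conj_by g x \<in> K i"
  using K_normal by (auto simp: normalizes_def)

lemma comm_K: "g \<in> K 0 \<Longrightarrow> x \<in> K i \<Longrightarrow> comm g x \<in> K i"
  using conj_K subgrp_diff[OF K] by (simp add: comm_eq_conj_by)

lemma F_Suc: "F i l \<subseteq> F i (Suc l)"
proof (induction l)
  case 0
  then show ?case using comm_K[of _ _ "Suc i"] H_subset subsetD[OF K_Suc] by auto
next
  case (Suc l)
  then show ?case by auto
qed

lemma F_lower: "K (Suc i) \<subseteq> F i l"
proof (induction l)
  case (Suc l)
  then show ?case using F_Suc[of i l] by (rule subset_trans)
qed simp

text \<open>The quotients of \<open>K i\<close> by all \<open>F i l\<close> must stay torsion free,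
  because the unipotency result will be applied to each of them. The property passes on because
  \<open>comm h\<close> is additive modulo \<open>F i l\<close>.\<close>

lemma F_facts: "subgrp (F i l) \<and> (\<forall>x n. x \<in> K i \<longrightarrow> n \<noteq> 0 \<longrightarrow> zmul n x \<in> F i l \<longrightarrow> x \<in> F i l)"
proof (induction l)
  case 0
  then show ?case using K K_tf by auto
next
  case (Suc l)
  interpret fq: abelian_quotient "K i" "F i l"
    using Suc K F_subset F_lower K_comm by unfold_locales blast+
  have HK: "h \<in> K 0" if "h \<in> H" for h using that H_subset by blast
  have "subgrp (F i (Suc l))"
    unfolding subgrp_def
  proof (intro conjI ballI)
    show "0 \<in> F i (Suc l)" using subgrp_0[OF K] subgrp_0[OF fq.B] by (simp add: comm_def)
    fix x y assume xy: "x \<in> F i (Suc l)" "y \<in> F i (Suc l)"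
    have "comm h (x - y) \<in> F i l" if h: "h \<in> H" for h
    proof -
      have "fq.eqv (comm h (x - y)) (comm h x - comm h y)"
        using xy conj_K[OF HK[OF h]] by (intro fq.eqv_comm_diff) auto
      moreover have "fq.eqv (comm h x - comm h y) 0"
        using xy h subgrp_diff[OF fq.B] by (simp add: fq.eqv_0_iff)
      ultimately show ?thesis using fq.eqv_trans fq.eqv_0_iff by blast
    qed
    then show "x - y \<in> F i (Suc l)" using xy subgrp_diff[OF K] by simp
  qed
  moreover have "x \<in> F i (Suc l)" if x: "x \<in> K i" "n \<noteq> 0" "zmul n x \<in> F i (Suc l)" for x n
  proof -
    have "comm h x \<in> F i l" if h: "h \<in> H" for h
    proof -
      note cx = conj_K[OF HK[OF h] x(1)]
      have mx: "- x \<in> K i" by (rule subgrp_uminus[OF K x(1)])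
      have "fq.eqv (zmul n (conj_by h x + - x)) (zmul n (conj_by h x) + zmul n (- x))"
        by (rule fq.eqv_zmul_distrib[OF cx mx])
      also have "zmul n (conj_by h x) + zmul n (- x) = comm h (zmul n x)"
        by (simp add: comm_eq_conj_by conj_by_zmul zmul_minus_right)
      finally have "fq.eqv (zmul n (comm h x)) (comm h (zmul n x))" by (simp add: comm_eq_conj_by)
      moreover have "fq.eqv (comm h (zmul n x)) 0" using x(3) h by (simp add: fq.eqv_0_iff)
      ultimately have "zmul n (comm h x) \<in> F i l" using fq.eqv_trans fq.eqv_0_iff by blast
      then show ?thesis using Suc x(2) comm_K[OF HK[OF h] x(1)] by blast
    qed
    then show ?thesis using x by simp
  qed
  ultimately show ?case by blast
qed

lemmas subgrp_F = F_facts[THEN conjunct1]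

lemma F_normal: "normalizes H (F i l)"
  unfolding normalizes_def
proof (intro ballI)
  fix h x assume "h \<in> H" "x \<in> F i l"
  moreover have "comm h x \<in> F i l" using calculation F_Suc[of i l] by auto
  ultimately show "conj_by h x \<in> F i l" using subgrp_add[OF subgrp_F] by (simp add: conj_by_eq_comm)
qed

lemma unipotent_F:
  assumes "i < d" "t \<in> H" "x \<in> K i"
  shows "\<exists>e. (comm t ^^ e) x \<in> F i l"
proof -
  have t: "t \<in> K 0" using assms(2) H_subset by blast
  interpret unipotent_action "K i" "F i l" "K 0" t x
  proof
    show "\<exists>y\<in>K i. comm t x - zmul 3 y \<in> F i l" if "x \<in> K i" for x
      using assms that F_lower by (force simp: H_def quot.triples_def quot.eqv_def)
    show "comm x y \<in> F i l" if "x \<in> K i" "y \<in> K i" for x y using K_comm[OF that] F_lower by blast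
  qed (use K K_0 K_fg K_nofree subgrp_F F_subset F_lower F_facts F_normal assms t conj_K
      in \<open>auto simp: normalizes_def\<close>)
  show ?thesis by (rule unipotent)
qed

definition fixed :: "nat \<Rightarrow> nat \<Rightarrow> 'a set \<Rightarrow> 'a set" where
  "fixed i l N = {x \<in> K i. \<forall>n\<in>N. comm n x \<in> F i l}"

lemma fixed_gen:
  assumes "N \<subseteq> H"
  shows "fixed i l (gen N) = fixed i l N"
proof
  show "fixed i l (gen N) \<subseteq> fixed i l N" using gen_superset[of N] by (auto simp: fixed_def)
  show "fixed i l N \<subseteq> fixed i l (gen N)"
  proof
    fix x assume x: "x \<in> fixed i l N"
    have "gen N \<subseteq> {g \<in> H. comm g x \<in> F i l}"
      using x assms
      by (intro gen_minimal subgrp_comm_stabilizer subgrp_H subgrp_F F_normal) (auto simp: fixed_def)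
    then show "x \<in> fixed i l (gen N)" using x by (auto simp: fixed_def)
  qed
qed

text \<open>Since \<open>- t\<close> conjugates \<open>N\<close> into itself, \<open>t\<close>
  preserves the invariants of \<open>N\<close>.\<close>

lemma fixed_comm:
  assumes "N \<subseteq> H" "t \<in> H" "\<And>n. n \<in> N \<Longrightarrow> conj_by (- t) n \<in> N" "x \<in> fixed i l N"
  shows "comm t x \<in> fixed i l N"
proof -
  interpret fq: abelian_quotient "K i" "F i l"
    using K subgrp_F F_subset F_lower K_comm by unfold_locales blast+
  have t: "t \<in> K 0" and x: "x \<in> K i" using assms H_subset by (auto simp: fixed_def)
  have "comm n (comm t x) \<in> F i l" if n: "n \<in> N" for n
  proof -
    have n0: "n \<in> K 0" using n assms H_subset by blast
    have "fq.eqv (comm n (conj_by t x - x)) (comm n (conj_by t x) - comm n x)"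
      using t n0 x by (intro fq.eqv_comm_diff conj_K)
    moreover have "comm n (conj_by t x) \<in> F i l"
      using assms(3)[OF n] assms(2,4) F_normal[of i l]
      by (auto simp: comm_conj_by fixed_def normalizes_def)
    moreover have "comm n x \<in> F i l" using assms(4) n by (simp add: fixed_def)
    ultimately have "fq.eqv (comm n (comm t x)) (comm n (conj_by t x) - comm n x)"
      "fq.eqv (comm n (conj_by t x) - comm n x) 0"
      using subgrp_diff[OF fq.B] by (auto simp: comm_eq_conj_by[of t] fq.eqv_0_iff)
    then show ?thesis using fq.eqv_trans fq.eqv_0_iff by blast
  qed
  then show ?thesis using comm_K[OF t x] by (simp add: fixed_def)
qed

text \<open>Finitely many elements suffice modulo the next level: \<open>?E\<close> contains all
  commutators of \<open>K j\<close>, so Milnor's argument makes it finitely generated.\<close>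

lemma H_level_generators:
  "\<exists>T. finite T \<and> T \<subseteq> H \<inter> K j \<and> H \<inter> K j \<subseteq> gen (T \<union> (H \<inter> K (Suc j)))"
proof -
  have HK: "subgrp (H \<inter> K i)" for i
    by (rule subgrp_Int[OF subgrp_H K])
  have nK: "normalizes (H \<inter> K j) (K (Suc j))"
    using H_subset conj_K by (auto simp: normalizes_def)
  let ?E = "{a + b | a b. a \<in> H \<inter> K j \<and> b \<in> K (Suc j)}"
  have E: "subgrp ?E" by (rule subgrp_sum_normal[OF HK K nK])
  have KE: "K (Suc j) \<subseteq> ?E"
  proof
    fix x assume "x \<in> K (Suc j)"
    then have "0 + x \<in> ?E" using subgrp_0[OF HK] by blast
    then show "x \<in> ?E" by simp
  qed
  have HE: "H \<inter> K j \<subseteq> ?E"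
  proof
    fix x assume "x \<in> H \<inter> K j"
    then have "x + 0 \<in> ?E" using subgrp_0[OF K] by blast
    then show "x \<in> ?E" by simp
  qed
  have "?E \<subseteq> K j" using K_Suc[of j] subgrp_add[OF K[of j]] by blast
  then have "fg ?E"
    using KE K_comm by (intro fg_between_derived[OF K_fg nofree_subset[OF K_nofree K_0] K E]) blast+
  then obtain S where S: "finite S" "gen S = ?E" by (auto simp: fg_def)
  have "\<forall>s\<in>S. \<exists>a. a \<in> H \<inter> K j \<and> (\<exists>b\<in>K (Suc j). s = a + b)" using S gen_superset[of S] by blast
  from bchoice[OF this] obtain f where f: "\<forall>s\<in>S. f s \<in> H \<inter> K j \<and> (\<exists>b\<in>K (Suc j). s = f s + b)" ..
  let ?T = "f ` S"
  have T: "finite ?T" "?T \<subseteq> H \<inter> K j" using S f by auto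
  have gT: "gen ?T \<subseteq> H \<inter> K j" by (rule gen_minimal[OF T(2) HK])
  have s1: "subgrp {a + b | a b. a \<in> gen ?T \<and> b \<in> K (Suc j)}"
    using gT nK by (intro subgrp_sum_normal subgrp_gen K) (auto simp: normalizes_def)
  have s2: "S \<subseteq> {a + b | a b. a \<in> gen ?T \<and> b \<in> K (Suc j)}"
    using f gen_superset[of ?T] by blast
  have EE: "?E \<subseteq> {a + b | a b. a \<in> gen ?T \<and> b \<in> K (Suc j)}"
    using gen_minimal[OF s2 s1] unfolding S(2) .
  have "H \<inter> K j \<subseteq> gen (?T \<union> (H \<inter> K (Suc j)))"
  proof
    fix y assume y: "y \<in> H \<inter> K j"
    then obtain a b where ab: "a \<in> gen ?T" "b \<in> K (Suc j)" "y = a + b"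
      using HE EE by blast
    have "b \<in> H" using y ab gT subgrp_add_cancel_left[OF subgrp_H, of a b] by auto
    then show "y \<in> gen (?T \<union> (H \<inter> K (Suc j)))"
      using ab gen_mono[of ?T "?T \<union> (H \<inter> K (Suc j))"] gen_superset[of "?T \<union> (H \<inter> K (Suc j))"]
      by (auto intro!: subgrp_add[OF subgrp_gen])
  qed
  then show ?thesis using T by blast
qed

text \<open>The step of Engel and Kolchin. Generators of \<open>H \<inter> K j\<close> are added one
  by one. Commutators fall into \<open>H \<inter> K (Suc j)\<close>, so each new generator
  normalizes the group generated so far and preserves its invariants, where a unipotent map has a
  nonzero fixed vector.\<close>

lemma fixed_level_step:
  assumes "i < d" "x \<in> fixed i l (H \<inter> K (Suc j))" "x \<notin> F i l"
  shows "\<exists>y. y \<in> fixed i l (H \<inter> K j) \<and> y \<notin> F i l"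
proof -
  obtain T where T: "finite T" "T \<subseteq> H \<inter> K j" "H \<inter> K j \<subseteq> gen (T \<union> (H \<inter> K (Suc j)))"
    using H_level_generators[of j] by (elim exE conjE)
  have "\<exists>y. y \<in> fixed i l (T' \<union> (H \<inter> K (Suc j))) \<and> y \<notin> F i l" if "T' \<subseteq> T" "finite T'" for T'
    using that(2,1)
  proof (induction T' rule: finite_induct)
    case empty
    then show ?case using assms by auto
  next
    case (insert t T')
    let ?N = "gen (T' \<union> (H \<inter> K (Suc j)))"
    have sub: "T' \<union> (H \<inter> K (Suc j)) \<subseteq> H" using insert.prems T(2) by auto
    then obtain y where y: "y \<in> fixed i l ?N" "y \<notin> F i l" using insert fixed_gen[OF sub] by auto
    have t: "t \<in> H" "t \<in> K j" using insert.prems T by auto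
    have NH: "?N \<subseteq> H" by (rule gen_minimal[OF sub subgrp_H])
    have conjN: "conj_by (- t) n \<in> ?N" if "n \<in> ?N" for n
      using that
    proof (rule conj_by_gen[OF _ _ subgrp_gen])
      fix s assume s: "s \<in> T' \<union> (H \<inter> K (Suc j))"
      have sj: "s \<in> H" "s \<in> K j" using s insert.prems T K_Suc by auto
      have "comm (- t) s \<in> H \<inter> K (Suc j)"
        using t sj subgrp_H K_comm subgrp_uminus[OF K] by (auto intro!: comm_closed subgrp_uminus)
      then show "conj_by (- t) s \<in> ?N"
        using s unfolding conj_by_eq_comm by (intro subgrp_add[OF subgrp_gen]) (auto intro!: hull_inc)
    qed
    have it: "(comm t ^^ e) y \<in> fixed i l ?N" for e
      using y(1) by (induction e) (auto intro!: fixed_comm[OF NH t(1) conjN])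
    have "y \<in> K i" using y(1) by (simp add: fixed_def)
    from unipotent_F[OF assms(1) t(1) this, of l] obtain e where e: "(comm t ^^ e) y \<in> F i l" ..
    \<comment> \<open>The last iterate of \<open>comm t\<close> that is still outside
      \<open>F i l\<close> is invariant under \<open>t\<close> as well.\<close>
    define m where "m = (LEAST e. (comm t ^^ e) y \<in> F i l)"
    have m: "(comm t ^^ m) y \<in> F i l" unfolding m_def using e by (rule LeastI)
    then obtain m' where m': "m = Suc m'" using y(2) by (cases m) auto
    have "(comm t ^^ m') y \<notin> F i l" using m' unfolding m_def by (intro not_less_Least) simp
    moreover have "(comm t ^^ m') y \<in> fixed i l (insert t T' \<union> (H \<inter> K (Suc j)))"
      using it[of m'] m m' fixed_gen[OF sub] by (auto simp: fixed_def)
    ultimately show ?case by blast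
  qed
  then obtain y where y: "y \<in> fixed i l (T \<union> (H \<inter> K (Suc j)))" "y \<notin> F i l" using T by blast
  have "T \<union> (H \<inter> K (Suc j)) \<subseteq> H" using T by auto
  from fixed_gen[OF this] y have "y \<in> fixed i l (gen (T \<union> (H \<inter> K (Suc j))))" by simp
  then have "y \<in> fixed i l (H \<inter> K j)" using T(3) by (auto simp: fixed_def)
  then show ?thesis using y by blast
qed

text \<open>\<open>H \<inter> K i\<close> acts trivially on \<open>K i / K (Suc i)\<close>, because
  that factor is abelian. From there the invariance of a suitable element is extended level by level
  up to \<open>H \<inter> K 0 = H\<close>.\<close>

lemma F_strict:
  assumes "i < d" "F i l \<noteq> K i"
  shows "F i (Suc l) \<noteq> F i l"
proof -
  obtain x where x: "x \<in> K i" "x \<notin> F i l" using assms F_subset by blast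
  have "x \<in> fixed i l (H \<inter> K i)" using x K_comm subsetD[OF F_lower] by (auto simp: fixed_def)
  have "\<exists>y. y \<in> fixed i l (H \<inter> K j) \<and> y \<notin> F i l" if "j \<le> i" for j
    using that
  proof (induction rule: inc_induct)
    case base
    then show ?case using x \<open>x \<in> fixed i l (H \<inter> K i)\<close> by blast
  next
    case (step n)
    then show ?case using fixed_level_step[OF assms(1)] by blast
  qed
  then obtain y where "y \<in> fixed i l (H \<inter> K 0)" "y \<notin> F i l" by blast
  moreover have "H \<inter> K 0 = H" using H_subset by auto
  ultimately have "y \<in> F i (Suc l)" "y \<notin> F i l" by (auto simp: fixed_def)
  then show ?thesis by blast
qed

lemma F_top:
  assumes "i < d"
  shows "\<exists>l. F i l = K i"
proof -
  have "\<exists>n. \<forall>m. F i m \<subseteq> F i n"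
    by (rule ascending_chain_stops[where X = "F i" and L = "K i", OF K_fg nofree_subset[OF K_nofree K_0] K])
      (simp_all add: F_Suc F_subset subgrp_F K_comm del: F.simps(2))
  then obtain n where "F i (Suc n) \<subseteq> F i n" by blast
  then show ?thesis using F_strict[OF assms, of n] F_Suc[of i n] by blast
qed

text \<open>The central series of the factors are concatenated: once \<open>C N\<close> lies in
  \<open>K i\<close>, it is intersected with \<open>F i s\<close>, \<open>F i (s - 1)\<close> and so
  on, down to \<open>F i 0 = K (Suc i)\<close>.\<close>

lemma H_central_series:
  assumes "i \<le> d"
  shows "\<exists>C N. C 0 = H \<and> C N \<subseteq> K i \<and>
    (\<forall>n::nat. subgrp (C n) \<and> C (Suc n) \<subseteq> C n \<and> (\<forall>x\<in>C n. \<forall>h\<in>H. comm x h \<in> C (Suc n)))"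
  using assms
proof (induction i)
  case 0
  show ?case using subgrp_H H_subset comm_closed[OF subgrp_H] by (intro exI[of _ "\<lambda>_. H"]) auto
next
  case (Suc i)
  then have i: "i < d" by simp
  obtain C N where C0: "C 0 = H" "C N \<subseteq> K i" and C: "\<And>n::nat. subgrp (C n)" "\<And>n. C (Suc n) \<subseteq> C n"
    "\<And>n x h. x \<in> C n \<Longrightarrow> h \<in> H \<Longrightarrow> comm x h \<in> C (Suc n)"
    using Suc by auto
  obtain s where s: "F i s = K i" using F_top[OF i] by blast
  \<comment> \<open>Both descriptions agree at \<open>n = N\<close>, since \<open>F i s\<close> is
    all of \<open>K i\<close>. Truncated subtraction keeps the series constant from
    \<open>N + s\<close> on.\<close>
  define D where "D n = (if n \<le> N then C n else C N \<inter> F i (s - (n - N)))" for n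
  have DN: "D n = C N \<inter> F i (s - (n - N))" if "n \<ge> N" for n
    using that C0 s by (cases "n = N") (auto simp: D_def)
  have Fc: "comm x h \<in> F i (l - 1)" if "x \<in> F i l" "h \<in> H" for x h l
  proof -
    have "x \<in> F i (Suc (l - 1))" using that F_Suc[of i 0] by (cases l) auto
    then have "comm h x \<in> F i (l - 1)" using that(2) by simp
    then show ?thesis using subgrp_uminus[OF subgrp_F] by (metis uminus_comm)
  qed
  have sub: "subgrp (D n)" for n
    by (simp add: D_def C(1) subgrp_F subgrp_Int)
  have dec: "D (Suc n) \<subseteq> D n" for n
  proof (cases "n < N")
    case True
    then have "D (Suc n) = C (Suc n)" "D n = C n" by (simp_all add: D_def)
    then show ?thesis using C(2)[of n] by simp
  next
    case False
    then have *: "D (Suc n) = C N \<inter> F i (s - (Suc n - N))" "D n = C N \<inter> F i (s - (n - N))"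
      by (simp_all only: DN not_less le_SucI)
    have "F i (s - (Suc n - N)) \<subseteq> F i (s - (n - N))"
      by (rule lift_Suc_mono_le[of "F i", OF F_Suc]) simp
    then show ?thesis unfolding * by (rule Int_mono[OF order_refl])
  qed
  have cm: "comm x h \<in> D (Suc n)" if "x \<in> D n" "h \<in> H" for x h n
  proof (cases "n < N")
    case False
    then have x: "x \<in> C N" "x \<in> F i (s - (n - N))" using that DN by auto
    have "comm x h \<in> C N" using C(2,3) x(1) that(2) by blast
    moreover have "comm x h \<in> F i (s - (n - N) - 1)" by (rule Fc[OF x(2) that(2)])
    moreover have "s - (n - N) - 1 = s - (Suc n - N)" using False by simp
    ultimately show ?thesis using False by (simp add: DN)
  next
    case True
    then have "D (Suc n) = C (Suc n)" "D n = C n" by (simp_all add: D_def)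
    then show ?thesis using C(3)[of x n h] that by simp
  qed
  have "D 0 = H" "D (N + s) \<subseteq> K (Suc i)" using C0 by (simp add: D_def) (simp add: DN)
  then show ?case
    using sub dec cm by (intro exI[of _ D] exI[of _ "N + s"]) simp
qed

end

section \<open>Homeomorphisms of the line supported in the unit interval\<close>

text \<open>Extension by the identity makes composition total, so these maps form a type of class
  \<open>group_add\<close>. Continuity follows from being monotone and onto.\<close>

typedef homeo = "{f :: real \<Rightarrow> real. strict_mono f \<and> surj f \<and> (\<forall>x. x < 0 \<or> 1 < x \<longrightarrow> f x = x)}"
  morphisms app Homeo
  by (rule exI[of _ id]) (auto simp: strict_mono_def)

lemma app_less_iff [simp]: "app f x < app f y \<longleftrightarrow> x < y"
  using app[of f] by (simp add: strict_mono_less)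

lemma app_le_iff [simp]: "app f x \<le> app f y \<longleftrightarrow> x \<le> y"
  using app[of f] by (simp add: strict_mono_less_eq)

lemma app_eq_iff [simp]: "app f x = app f y \<longleftrightarrow> x = y"
  using app[of f] by (simp add: strict_mono_eq)

lemma surj_app: "surj (app f)"
  using app[of f] by simp

lemma inj_app: "inj (app f)"
  by (rule injI) simp

lemma app_outside: "x < 0 \<or> 1 < x \<Longrightarrow> app f x = x"
  using app[of f] by auto

lemma homeo_eqI: "(\<And>x. app f x = app g x) \<Longrightarrow> f = g"
  by (metis app_inject ext)

instantiation homeo :: group_add
begin

definition zero_homeo :: homeo where "0 = Homeo id"
definition plus_homeo :: "homeo \<Rightarrow> homeo \<Rightarrow> homeo" where "f + g = Homeo (app f \<circ> app g)"
definition uminus_homeo :: "homeo \<Rightarrow> homeo" where "- f = Homeo (inv_into UNIV (app f))"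
definition minus_homeo :: "homeo \<Rightarrow> homeo \<Rightarrow> homeo" where "f - g = f + - (g :: homeo)"

lemma app_0 [simp]: "app 0 x = x"
  by (simp add: zero_homeo_def Homeo_inverse strict_mono_def)

lemma app_add [simp]: "app (f + g) x = app f (app g x)"
proof -
  have "app f \<circ> app g \<in> {f. strict_mono f \<and> surj f \<and> (\<forall>x. x < 0 \<or> 1 < x \<longrightarrow> f x = x)}"
    using comp_surj[OF surj_app[of g] surj_app[of f]] by (simp add: strict_mono_def app_outside)
  then show ?thesis by (simp add: plus_homeo_def Homeo_inverse)
qed

lemma app_uminus: "app (- f) = inv_into UNIV (app f)"
proof -
  have inv: "app f (inv_into UNIV (app f) x) = x" for x by (simp add: surj_app surj_f_inv_f)
  have "inv_into UNIV (app f) \<in> {f. strict_mono f \<and> surj f \<and> (\<forall>x. x < 0 \<or> 1 < x \<longrightarrow> f x = x)}"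
  proof (intro CollectI conjI allI impI)
    show "strict_mono (inv_into UNIV (app f))"
      using app_less_iff[of f "inv_into UNIV (app f) x" "inv_into UNIV (app f) y" for x y] inv by (auto simp: strict_mono_def)
    show "surj (inv_into UNIV (app f))" by (simp add: inj_app inj_imp_surj_inv)
    show "inv_into UNIV (app f) x = x" if "x < 0 \<or> 1 < x" for x
      using app_outside[OF that, of f] inv_f_f[OF inj_app, of f x] by simp
  qed
  then show ?thesis by (simp add: uminus_homeo_def Homeo_inverse)
qed

instance
proof
  fix a b c :: homeo
  show "a + b + c = a + (b + c)" "0 + a = a" "a + 0 = a" "a + - b = a - b"
    by (simp_all add: homeo_eqI minus_homeo_def)
  show "- a + a = 0" by (rule homeo_eqI) (simp add: app_uminus inj_app)
qed

end

lemma app_uminus_app [simp]: "app (- f) (app f x) = x"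
  by (simp add: app_uminus inj_app)

lemma app_app_uminus [simp]: "app f (app (- f) x) = x"
  by (simp add: app_uminus surj_app surj_f_inv_f)

lemma app_uminus_less_iff: "app (- f) x < y \<longleftrightarrow> x < app f y"
  by (metis app_app_uminus app_less_iff)

lemma less_app_uminus_iff: "y < app (- f) x \<longleftrightarrow> app f y < x"
  by (metis app_app_uminus app_less_iff)

lemma app_uminus_eq_iff: "app (- f) x = y \<longleftrightarrow> x = app f y"
  by (metis app_app_uminus app_uminus_app)

lemma app_conj_by: "app (conj_by g f) (app g x) = app g (app f x)"
  by (simp add: conj_by_def diff_conv_add_uminus del: add_uminus_conv_diff)

lemma isCont_app: "isCont (app f) x"
proof -
  have "app f ` UNIV = UNIV" by (rule surj_app)
  then have "continuous_on UNIV (app f)"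
    by (intro continuous_onI_mono) auto
  then show ?thesis by (simp add: continuous_on_eq_continuous_at)
qed

lemma app_zmul_fixed: "app f x = x \<Longrightarrow> app (zmul n f) x = x"
  by (induction n rule: int_induct[where k=0]) (simp_all add: zmul_plus_1 zmul_minus_1 app_uminus_eq_iff)

section \<open>Components of the complement of the fixed point set\<close>

definition Fix :: "homeo set \<Rightarrow> real set" where
  "Fix K = {x. \<forall>g\<in>K. app g x = x}"

lemma closed_Fix: "closed (Fix K)"
proof -
  have "closed {x. app g x = x}" for g
    by (intro closed_Collect_eq continuous_at_imp_continuous_on ballI isCont_app continuous_intros)
  then have "closed (\<Inter>g\<in>K. {x. app g x = x})" by blast
  moreover have "(\<Inter>g\<in>K. {x. app g x = x}) = Fix K" by (auto simp: Fix_def)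
  ultimately show ?thesis by simp
qed

lemma Fix_gen: "Fix (gen S) = Fix S"
proof
  show "Fix (gen S) \<subseteq> Fix S" using gen_superset[of S] by (auto simp: Fix_def)
  show "Fix S \<subseteq> Fix (gen S)"
  proof
    fix x assume x: "x \<in> Fix S"
    have "subgrp {g. app g x = x}" by (rule subgrpI) (auto simp: app_uminus_eq_iff)
    moreover have "S \<subseteq> {g. app g x = x}" using x by (auto simp: Fix_def)
    ultimately show "x \<in> Fix (gen S)" using gen_minimal by (auto simp: Fix_def)
  qed
qed

text \<open>\<open>a\<close> and \<open>b\<close> are the endpoints of a component of the complement
  of \<open>Fix K\<close>.\<close>

definition gap :: "homeo set \<Rightarrow> real \<Rightarrow> real \<Rightarrow> bool" where
  "gap K a b \<longleftrightarrow> a < b \<and> a \<in> Fix K \<and> b \<in> Fix K \<and> (\<forall>x. a < x \<longrightarrow> x < b \<longrightarrow> x \<notin> Fix K)"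

lemma outside_Fix: "x < 0 \<or> 1 < x \<Longrightarrow> x \<in> Fix K"
  by (simp add: Fix_def app_outside)

lemma gap_bounds: "gap K a b \<Longrightarrow> 0 \<le> a \<and> b \<le> 1"
proof (rule ccontr)
  assume c: "gap K a b" and "\<not> (0 \<le> a \<and> b \<le> 1)"
  then consider "a < 0" | "1 < b" by linarith
  then show False
  proof cases
    case 1
    then obtain x where "a < x" "x < min 0 b" using c dense[of a "min 0 b"] by (auto simp: gap_def)
    then show False using c outside_Fix[of x K] by (auto simp: gap_def)
  next
    case 2
    then obtain x where "max 1 a < x" "x < b" using c dense[of "max 1 a" b] by (auto simp: gap_def)
    then show False using c outside_Fix[of x K] by (auto simp: gap_def)
  qed
qed

lemma gap_exists:
  assumes "x \<notin> Fix K"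
  obtains a b where "gap K a b" "a < x" "x < b"
proof -
  have x: "0 \<le> x" "x \<le> 1" using assms outside_Fix[of x K] by linarith+
  let ?L = "Fix K \<inter> {..x}" and ?U = "Fix K \<inter> {x..}"
  \<comment> \<open>Everything is the identity outside \<open>{0..1}\<close>, so -1 and 2 are common
    fixed points and both sets are nonempty.\<close>
  have m: "-1 \<in> ?L" "2 \<in> ?U" using x by (auto intro: outside_Fix)
  have L: "Sup ?L \<in> ?L" using m closed_Fix by (intro closed_contains_Sup) auto
  have U: "Inf ?U \<in> ?U" using m closed_Fix by (intro closed_contains_Inf) auto
  have "y \<notin> Fix K" if "Sup ?L < y" "y < Inf ?U" for y
  proof
    assume y: "y \<in> Fix K"
    have "y \<le> Sup ?L" if "y \<le> x" using y that by (intro cSup_upper) auto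
    moreover have "Inf ?U \<le> y" if "x \<le> y" using y that by (intro cInf_lower) auto
    ultimately show False using that by linarith
  qed
  moreover have "Sup ?L < x" "x < Inf ?U" using L U assms by (auto simp: less_le)
  ultimately have "gap K (Sup ?L) (Inf ?U)" using L U by (auto simp: gap_def)
  then show ?thesis using \<open>Sup ?L < x\<close> \<open>x < Inf ?U\<close> that by blast
qed

lemma gap_left_le: "gap K a b \<Longrightarrow> c \<in> Fix K \<Longrightarrow> c < b \<Longrightarrow> c \<le> a"
  by (meson gap_def not_le)

lemma gap_right_le: "gap K a b \<Longrightarrow> c \<in> Fix K \<Longrightarrow> a < c \<Longrightarrow> b \<le> c"
  by (meson gap_def not_le)

lemma gap_overlap_eq:
  assumes "gap K a b" "gap K c d" "a < d" "c < b"
  shows "a = c \<and> b = d"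
proof -
  have "c \<le> a" "a \<le> c" "b \<le> d" "d \<le> b"
    using assms gap_left_le[of K a b c] gap_left_le[of K c d a] gap_right_le[of K a b d]
      gap_right_le[of K c d b] by (auto simp: gap_def)
  then show ?thesis by simp
qed

text \<open>\<open>g\<close> normalizes \<open>K\<close>, hence permutes its common fixed points and
  with them the components.\<close>

lemma gap_image:
  assumes "gap K a b" "\<And>k. k \<in> K \<Longrightarrow> conj_by g k \<in> K" "\<And>k. k \<in> K \<Longrightarrow> conj_by (- g) k \<in> K"
  shows "gap K (app g a) (app g b)"
proof -
  have F: "app g x \<in> Fix K \<longleftrightarrow> x \<in> Fix K" for x
  proof
    assume "x \<in> Fix K"
    show "app g x \<in> Fix K"
      unfolding Fix_def
    proof (intro CollectI ballI)
      fix k assume k: "k \<in> K"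
      have "app k (app g x) = app (conj_by g (conj_by (- g) k)) (app g x)" by simp
      also have "\<dots> = app g x"
        unfolding app_conj_by using \<open>x \<in> Fix K\<close> assms(3)[OF k] by (simp add: Fix_def)
      finally show "app k (app g x) = app g x" .
    qed
  next
    assume x: "app g x \<in> Fix K"
    show "x \<in> Fix K"
      unfolding Fix_def
    proof (intro CollectI ballI)
      fix k assume k: "k \<in> K"
      have "app g (app k x) = app (conj_by g k) (app g x)" by (simp only: app_conj_by)
      also have "\<dots> = app g x" using x assms(2)[OF k] by (simp add: Fix_def)
      finally show "app k x = x" by simp
    qed
  qed
  show ?thesis
    unfolding gap_def
  proof (intro conjI allI impI)
    show "app g a < app g b" "app g a \<in> Fix K" "app g b \<in> Fix K"
      using assms(1) F by (auto simp: gap_def)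
    fix x assume "app g a < x" "x < app g b"
    then have "a < app (- g) x" "app (- g) x < b"
      by (simp_all add: app_uminus_less_iff less_app_uminus_iff)
    then have "app (- g) x \<notin> Fix K" using assms(1) by (simp add: gap_def)
    then show "x \<notin> Fix K" using F[of "app (- g) x"] by simp
  qed
qed

definition fixes_in :: "homeo \<Rightarrow> real \<Rightarrow> real \<Rightarrow> bool" where
  "fixes_in g a b \<longleftrightarrow> (\<exists>x. a < x \<and> x < b \<and> app g x = x)"

lemma gap_single_iff: "gap K a b \<Longrightarrow> g \<in> K \<Longrightarrow> gap {g} a b \<longleftrightarrow> \<not> fixes_in g a b"
  by (auto simp: gap_def Fix_def fixes_in_def)

lemma gap_subset: "gap K a b \<Longrightarrow> L \<subseteq> K \<Longrightarrow> h \<in> L \<Longrightarrow> \<not> fixes_in h a b \<Longrightarrow> gap L a b"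
  unfolding gap_def Fix_def fixes_in_def by blast

lemma app_maps_gap: "gap K a b \<Longrightarrow> g \<in> K \<Longrightarrow> a < x \<Longrightarrow> x < b \<Longrightarrow> a < app g x \<and> app g x < b"
  using app_less_iff[of g a x] app_less_iff[of g x b] by (auto simp: gap_def Fix_def)

lemma gap_direction:
  assumes "gap {f} a b"
  shows "(\<forall>x. a < x \<longrightarrow> x < b \<longrightarrow> x < app f x) \<or> (\<forall>x. a < x \<longrightarrow> x < b \<longrightarrow> app f x < x)"
proof (rule ccontr)
  assume "\<not> ?thesis"
  then obtain x y where x: "a < x" "x < b" "app f x \<le> x" and y: "a < y" "y < b" "y \<le> app f y"
    by (auto simp: not_less)
  have c: "isCont (\<lambda>z. app f z - z) z" for z by (intro continuous_intros isCont_app)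
  have "\<exists>z. min x y \<le> z \<and> z \<le> max x y \<and> app f z - z = 0"
  proof (cases "x \<le> y")
    case True
    then show ?thesis using IVT[of "\<lambda>z. app f z - z" x 0 y] x y c by auto
  next
    case False
    then show ?thesis using IVT2[of "\<lambda>z. app f z - z" x 0 y] x y c by auto
  qed
  then obtain z where "min x y \<le> z" "z \<le> max x y" "app f z = z" by auto
  moreover have "a < z" "z < b" using x y calculation by auto
  ultimately show False using assms by (auto simp: gap_def Fix_def)
qed

lemma gap_uminus: "gap {f} a b \<Longrightarrow> gap {- f} a b"
  by (auto simp: gap_def Fix_def app_uminus_eq_iff)

text \<open>A bounded monotone orbit would converge to a fixed point inside the component. The
  exponent is an integer because \<open>- f\<close> is iterated when \<open>f\<close> moves points
  downwards.\<close>

lemma push_up: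
  assumes "gap {f} a b" "a < x" "x < b" "y < b"
  shows "\<exists>n. y < app (zmul n f) x"
proof -
  have up: "\<exists>n::nat. y < app (zmul (int n) f) x"
    if c: "gap {f} a b" and f: "\<And>x. a < x \<Longrightarrow> x < b \<Longrightarrow> x < app f x" for f
  proof (rule ccontr)
    assume "\<not> ?thesis"
    then have le: "app (zmul (int n) f) x \<le> y" for n by (simp add: not_less)
    define u where "u n = app (zmul (int n) f) x" for n
    have Suc: "u (Suc n) = app f (u n)" for n
      using zmul_plus_1[of "int n" f] by (simp add: u_def add.commute)
    have ab: "a < u n \<and> u n < b" for n
      using assms app_maps_gap[OF c] by (induction n) (auto simp: Suc, simp add: u_def, simp add: u_def)
    have inc: "incseq u" using ab f by (intro incseq_SucI) (simp add: Suc less_imp_le)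
    have "\<forall>i. u i \<le> y" using le by (simp add: u_def)
    with inc obtain l where l: "u \<longlonglongrightarrow> l" by (rule incseq_convergent)
    have "(\<lambda>n. app f (u n)) \<longlonglongrightarrow> app f l" by (rule isCont_tendsto_compose[OF isCont_app l])
    moreover have "(\<lambda>n. u (Suc n)) \<longlonglongrightarrow> l" using l by (rule LIMSEQ_Suc)
    ultimately have "app f l = l" using LIMSEQ_unique by (simp add: Suc)
    moreover have "l \<le> y" using l le by (intro LIMSEQ_le_const2[OF l]) (auto simp: u_def)
    moreover have "u 0 \<le> l" by (rule incseq_le[OF inc l])
    ultimately show False using c ab[of 0] assms by (auto simp: gap_def Fix_def)
  qed
  from gap_direction[OF assms(1)] show ?thesis
  proof
    assume "\<forall>x. a < x \<longrightarrow> x < b \<longrightarrow> x < app f x"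
    then show ?thesis using up[OF assms(1)] by blast
  next
    assume "\<forall>x. a < x \<longrightarrow> x < b \<longrightarrow> app f x < x"
    then have "x < app (- f) x" if "a < x" "x < b" for x using that by (simp add: less_app_uminus_iff)
    then obtain n :: nat where "y < app (zmul (int n) (- f)) x"
      using up[OF gap_uminus[OF assms(1)]] by blast
    then show ?thesis by (metis zmul_minus_right zmul_uminus)
  qed
qed

lemma push_down:
  assumes "gap {f} a b" "a < x" "x < b" "a < y" "y < b"
  shows "\<exists>n. app (zmul n f) x < y"
proof -
  obtain n where "x < app (zmul n f) y" using push_up[OF assms(1,4,5,3)] by blast
  then show ?thesis by (metis app_uminus_less_iff zmul_uminus)
qed

section \<open>Ping-pong and crossings\<close>

text \<open>\<open>f\<close> sends \<open>{c..b}\<close> above \<open>m\<close> and \<open>g\<close>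
  sends it below \<open>m\<close>, so the first letter of a word can be read off from the image of
  \<open>c\<close>, and \<open>f\<close>, \<open>g\<close> would generate a free
  subsemigroup.\<close>

lemma ping_pong:
  assumes "subgrp G" "nofree G" "f \<in> G" "g \<in> G" "c \<le> b"
    and f: "\<And>x. c \<le> x \<Longrightarrow> x \<le> b \<Longrightarrow> m < app f x \<and> app f x \<le> b"
    and g: "\<And>x. c \<le> x \<Longrightarrow> x \<le> b \<Longrightarrow> c \<le> app g x \<and> app g x < m"
    and m: "c \<le> m" "m \<le> b"
  shows False
proof -
  have maps: "c \<le> app (word f g w) c \<and> app (word f g w) c \<le> b" for w
  proof (induction w)
    case (Cons l w)
    then show ?case using f[of "app (word f g w) c"] g[of "app (word f g w) c"] m
      by (cases l) (auto simp: word_def)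
  qed (use assms(5) in \<open>simp add: word_def\<close>)
  have "word f g v \<noteq> word f g w" if "length v = length w" "v \<noteq> w" for v w
    using that
  proof (induction v w rule: list_induct2)
    case (Cons k v l w)
    show ?case
    proof (cases "k = l")
      case True
      then show ?thesis using Cons by (simp add: word_def)
    next
      case False
      show ?thesis
      proof
        assume "word f g (k # v) = word f g (l # w)"
        then have e: "app (word f g (k # v)) c = app (word f g (l # w)) c" by simp
        show False
          using False e f[OF maps[of v, THEN conjunct1] maps[of v, THEN conjunct2]]
            g[OF maps[of v, THEN conjunct1] maps[of v, THEN conjunct2]]
            f[OF maps[of w, THEN conjunct1] maps[of w, THEN conjunct2]]
            g[OF maps[of w, THEN conjunct1] maps[of w, THEN conjunct2]]
          by (cases k; cases l) (auto simp: word_def)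
      qed
    qed
  qed simp
  then show False using assms(2-4) unfolding nofree_def by blast
qed

text \<open>A power of \<open>f\<close> fixes \<open>b\<close> and pushes \<open>c\<close> beyond
  some \<open>m\<close> between them; a power of \<open>g\<close> fixes \<open>c\<close> and pushes
  \<open>b\<close> below \<open>m\<close>. This is the ping-pong configuration on
  \<open>{c..b}\<close>.\<close>

lemma no_crossing:
  assumes "subgrp G" "nofree G" "f \<in> G" "g \<in> G" "gap {f} a b" "gap {g} c d" "a < c" "c < b" "b < d"
  shows False
proof -
  obtain m where m: "c < m" "m < b" using dense assms(8) by blast
  obtain n where n: "m < app (zmul n f) c" using push_up[OF assms(5), of c m] assms m by auto
  obtain k where k: "app (zmul k g) b < m" using push_down[OF assms(6), of b m] assms m by auto
  have fb: "app (zmul n f) b = b" using assms(5) by (intro app_zmul_fixed) (auto simp: gap_def Fix_def)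
  have gc: "app (zmul k g) c = c" using assms(6) by (intro app_zmul_fixed) (auto simp: gap_def Fix_def)
  show False
  proof (rule ping_pong[OF assms(1,2), of "zmul n f" "zmul k g" c b m])
    show "m < app (zmul n f) x \<and> app (zmul n f) x \<le> b" if "c \<le> x" "x \<le> b" for x
      using that n fb app_le_iff[of "zmul n f" c x] app_le_iff[of "zmul n f" x b] by linarith
    show "c \<le> app (zmul k g) x \<and> app (zmul k g) x < m" if "c \<le> x" "x \<le> b" for x
      using that k gc app_le_iff[of "zmul k g" c x] app_le_iff[of "zmul k g" x b] by linarith
  qed (use assms m zmul_closed in auto)
qed

text \<open>Among the components of single generators around a point of the gap take a longest one.
  A generator moving one of its endpoints has a component there that either crosses it or is a
  longer one containing it; both are impossible.\<close>

lemma gap_generator: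
  assumes G: "subgrp G" "nofree G" and S: "finite S" "S \<subseteq> G" and c: "gap (gen S) a b"
  shows "\<exists>s\<in>S. gap {s} a b"
proof -
  obtain x where x: "a < x" "x < b" using c dense[of a b] by (auto simp: gap_def)
  \<comment> \<open>Each generator has at most one component around \<open>x\<close>, so a maximal
    length exists.\<close>
  define P where "P = {(s, p, q). s \<in> S \<and> gap {s} p q \<and> p < x \<and> x < q}"
  have "P \<subseteq> (\<Union>s\<in>S. {s} \<times> {(p, q). gap {s} p q \<and> p < x \<and> x < q})" by (auto simp: P_def)
  moreover have "finite {(p, q). gap {s} p q \<and> p < x \<and> x < q}" for s
  proof (cases "\<exists>p q. gap {s} p q \<and> p < x \<and> x < q")
    case True
    then obtain p q where pq: "gap {s} p q" "p < x" "x < q" by blast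
    have "{(p, q). gap {s} p q \<and> p < x \<and> x < q} \<subseteq> {(p, q)}"
      using gap_overlap_eq[OF _ pq(1)] pq(2,3) by fastforce
    then show ?thesis by (rule finite_subset) simp
  next
    case False
    then have "{(p, q). gap {s} p q \<and> p < x \<and> x < q} = {}" by auto
    then show ?thesis by (simp only: finite.emptyI)
  qed
  ultimately have finP: "finite P" using S(1) by (auto intro: finite_subset)
  have FS: "Fix (gen S) = Fix S" by (rule Fix_gen)
  have "x \<notin> Fix S" using c x FS by (simp add: gap_def)
  then obtain s0 where s0: "s0 \<in> S" "x \<notin> Fix {s0}" by (auto simp: Fix_def)
  then obtain p0 q0 where "gap {s0} p0 q0" "p0 < x" "x < q0" using gap_exists by blast
  then have "P \<noteq> {}" using s0 by (auto simp: P_def)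
  define len where "len z = snd (snd z) - fst (snd z)" for z :: "homeo \<times> real \<times> real"
  have fin: "finite (len ` P)" "len ` P \<noteq> {}" using finP \<open>P \<noteq> {}\<close> by auto
  obtain z where z: "z \<in> P" "len z = Max (len ` P)" using Max_in[OF fin] by auto
  obtain s p q where spq: "z = (s, p, q)" by (cases z)
  have s: "s \<in> S" "gap {s} p q" "p < x" "x < q" using z spq by (auto simp: P_def)
  have max: "q' - p' \<le> q - p" if "t \<in> S" "gap {t} p' q'" "p' < x" "x < q'" for t p' q'
  proof -
    have "len (t, p', q') \<le> len z" unfolding z(2) using fin that by (intro Max_ge) (auto simp: P_def)
    then show ?thesis by (simp add: len_def spq)
  qed
  have "p \<in> Fix S"
  proof (rule ccontr)
    assume "p \<notin> Fix S"
    then obtain t where t: "t \<in> S" "p \<notin> Fix {t}" by (auto simp: Fix_def)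
    then obtain p' q' where t': "gap {t} p' q'" "p' < p" "p < q'" using gap_exists by blast
    have "\<not> q' < q" using no_crossing[OF G, of t s p' q' p q] t t' s S by auto
    then show False using max[OF t(1) t'(1)] t' s by auto
  qed
  moreover have "q \<in> Fix S"
  proof (rule ccontr)
    assume "q \<notin> Fix S"
    then obtain t where t: "t \<in> S" "q \<notin> Fix {t}" by (auto simp: Fix_def)
    then obtain p' q' where t': "gap {t} p' q'" "p' < q" "q < q'" using gap_exists by blast
    have "\<not> p < p'" using no_crossing[OF G, of s t p q p' q'] t t' s S by auto
    then show False using max[OF t(1) t'(1)] t' s by auto
  qed
  ultimately have pq: "p \<in> Fix (gen S)" "q \<in> Fix (gen S)" by (simp_all add: FS)
  have ab: "a \<in> Fix {s}" "b \<in> Fix {s}" using c s(1) gen_superset[of S] by (auto simp: gap_def Fix_def)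
  have "p \<le> a" using gap_left_le[OF c pq(1)] s x by auto
  moreover have "a \<le> p" using gap_left_le[OF s(2) ab(1)] s x by auto
  moreover have "b \<le> q" using gap_right_le[OF c pq(2)] s x by auto
  moreover have "q \<le> b" using gap_right_le[OF s(2) ab(2)] s x by auto
  ultimately show ?thesis using s by auto
qed

section \<open>Elements with a fixed point in a component\<close>

locale nofree_gap =
  fixes K :: "homeo set" and a b :: real
  assumes K: "subgrp K" "nofree K" and gap: "gap K a b"
begin

definition N :: "homeo set" where
  "N = {g \<in> K. fixes_in g a b}"

lemma ab: "a < b"
  using gap by (simp add: gap_def)

lemma maps: "g \<in> K \<Longrightarrow> a < x \<Longrightarrow> x < b \<Longrightarrow> a < app g x \<and> app g x < b"
  by (rule app_maps_gap[OF gap])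

lemma N_subset: "N \<subseteq> K"
  by (auto simp: N_def)

text \<open>If \<open>f + g\<close> had no fixed point in the component, this would be a component
  of the group generated by \<open>f\<close> and \<open>g\<close>, hence of one of the two, but both
  have a fixed point in it.\<close>

lemma subgrp_N: "subgrp N"
proof (rule subgrpI)
  have "fixes_in 0 a b" using dense[OF ab] by (auto simp: fixes_in_def)
  then show "0 \<in> N" using subgrp_0[OF K(1)] by (simp add: N_def)
  show "- g \<in> N" if "g \<in> N" for g
    using that subgrp_uminus[OF K(1)] by (auto simp: N_def fixes_in_def app_uminus_eq_iff)
  fix f g assume f: "f \<in> N" and g: "g \<in> N"
  show "f + g \<in> N"
  proof (rule ccontr)
    assume "f + g \<notin> N"
    then have fg: "\<not> fixes_in (f + g) a b" "f \<in> K" "g \<in> K"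
      using f g subgrp_add[OF K(1)] by (auto simp: N_def)
    let ?L = "gen {f, g}"
    have LK: "?L \<subseteq> K" using fg by (intro gen_minimal K) auto
    have "f + g \<in> ?L" by (intro subgrp_add[OF subgrp_gen] hull_inc) auto
    then have "gap ?L a b" by (rule gap_subset[OF gap LK _ fg(1)])
    then obtain s where "s \<in> {f, g}" "gap {s} a b"
      using gap_generator[OF K, of "{f, g}"] fg by auto
    then show False using f g by (auto simp: gap_def Fix_def fixes_in_def N_def)
  qed
qed

lemma conj_N: "h \<in> K \<Longrightarrow> g \<in> N \<Longrightarrow> conj_by h g \<in> N"
proof -
  assume h: "h \<in> K" and g: "g \<in> N"
  then obtain x where x: "a < x" "x < b" "app g x = x" by (auto simp: N_def fixes_in_def)
  have "app (conj_by h g) (app h x) = app h x" by (simp add: app_conj_by x)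
  then show ?thesis
    using maps[OF h x(1,2)] h g conj_by_closed[OF K(1)] by (auto simp: N_def fixes_in_def)
qed

text \<open>Elements of \<open>K\<close> are either comparable or congruent modulo \<open>N\<close>,
  so this becomes a total order on the quotient, invariant under translation from both
  sides.\<close>

definition lt :: "homeo \<Rightarrow> homeo \<Rightarrow> bool" where
  "lt u v \<longleftrightarrow> (\<forall>x. a < x \<longrightarrow> x < b \<longrightarrow> app u x < app v x)"

lemma lt_add_left: "lt (w + u) (w + v) \<longleftrightarrow> lt u v"
  by (simp add: lt_def)

lemma lt_add_right: "lt u v \<Longrightarrow> w \<in> K \<Longrightarrow> lt (u + w) (v + w)"
  using maps by (simp add: lt_def)

lemma lt_trans: "lt u v \<Longrightarrow> lt v w \<Longrightarrow> lt u w"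
  unfolding lt_def by (meson less_trans)

lemma lt_irrefl: "\<not> lt u u"
  using dense[OF ab] by (auto simp: lt_def)

lemma lt_cases: "u \<in> K \<Longrightarrow> v \<in> K \<Longrightarrow> lt u v \<or> lt v u \<or> - u + v \<in> N"
proof -
  assume "u \<in> K" "v \<in> K"
  then have k: "- u + v \<in> K" using K by (simp add: subgrp_closed)
  have "lt u v \<or> lt v u" if "\<not> fixes_in (- u + v) a b"
  proof -
    have "gap {- u + v} a b" using gap_single_iff[OF gap k] that by simp
    from gap_direction[OF this] show ?thesis
      by (simp add: lt_def app_uminus_less_iff less_app_uminus_iff)
  qed
  then show ?thesis using k by (auto simp: N_def)
qed

text \<open>The order is well defined modulo \<open>N\<close>: \<open>u + k\<close> cannot lie below
  \<open>w\<close>, because at a fixed point of \<open>k\<close> it agrees with \<open>u\<close>,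
  and it cannot be congruent to \<open>w\<close>.\<close>

lemma lt_add_N:
  assumes "u \<in> K" "w \<in> K" "lt w u" "k \<in> N"
  shows "lt w (u + k)"
proof -
  obtain x where x: "a < x" "x < b" "app k x = x" using assms(4) by (auto simp: N_def fixes_in_def)
  have k: "k \<in> K" using assms(4) N_subset by blast
  have "- w + u \<notin> N"
  proof
    assume "- w + u \<in> N"
    then obtain y where "a < y" "y < b" "app u y = app w y"
      by (auto simp: N_def fixes_in_def app_uminus_eq_iff)
    then show False using assms(3) by (auto simp: lt_def)
  qed
  then have "- w + (u + k) \<notin> N"
    using subgrp_add_cancel_right[OF subgrp_N assms(4), of "- w + u"] by (simp add: add.assoc)
  moreover have "\<not> lt (u + k) w" using assms(3) x by (force simp: lt_def)
  ultimately show ?thesis using lt_cases[of w "u + k"] assms subgrp_add[OF K(1)] k by blast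
qed

lemma lt_weak: "u \<in> K \<Longrightarrow> v \<in> K \<Longrightarrow> w \<in> K \<Longrightarrow> lt w u \<Longrightarrow> lt w v \<or> lt v u"
  using lt_cases[of u v] lt_add_N[of u w "- u + v"] lt_trans[of w u v] by (auto simp: add.assoc[symmetric])

lemma zmul_mono:
  assumes "u \<in> K" "lt 0 u" "i < j"
  shows "lt (zmul i u) (zmul j u)"
  using assms(3)
proof (induction rule: int_gr_induct)
  case base
  have "lt (0 + zmul i u) (u + zmul i u)" by (intro lt_add_right assms zmul_closed K)
  then show ?case by (simp add: zmul_plus_1)
next
  case (step j)
  have "lt (0 + zmul j u) (u + zmul j u)" by (intro lt_add_right assms zmul_closed K)
  then show ?case using step lt_trans by (simp add: zmul_plus_1)
qed

text \<open>\<open>push_up\<close> compares at one point only, which excludes the opposite order;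
  one more multiple of \<open>u\<close> turns this into domination on the whole component.\<close>

lemma archimedean:
  assumes "u \<in> K" "v \<in> K" "lt 0 u"
  shows "\<exists>n. lt v (zmul n u)"
proof -
  have "gap {u} a b" using assms gap by (force simp: lt_def gap_def Fix_def)
  obtain x where x: "a < x" "x < b" using dense[OF ab] by blast
  obtain n where n: "app v x < app (zmul n u) x"
    using push_up[OF \<open>gap {u} a b\<close> x] maps[OF assms(2) x] by blast
  then have "\<not> lt (zmul n u) v" using x by (auto simp: lt_def not_less intro: less_imp_le)
  moreover have "lt (zmul n u) (zmul (n + 1) u)" by (rule zmul_mono[OF assms(1,3)]) simp
  ultimately have "lt v (zmul (n + 1) u)"
    using lt_weak[of "zmul (n + 1) u" v "zmul n u"] assms zmul_closed[OF K(1)] by blast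
  then show ?thesis by blast
qed

text \<open>\<open>m\<close> is the integer part of \<open>v\<close> measured in units of
  \<open>u\<close>; the archimedean property for \<open>- v\<close> bounds the candidates from
  below.\<close>

lemma floor_exists:
  assumes "u \<in> K" "v \<in> K" "lt 0 u"
  shows "\<exists>m. \<not> lt v (zmul m u) \<and> lt v (zmul (m + 1) u)"
proof -
  obtain n where n: "lt v (zmul n u)" using archimedean[OF assms] by blast
  obtain k where k: "lt (- v) (zmul k u)"
    using archimedean[of u "- v"] assms subgrp_uminus[OF K(1)] by blast
  have "lt (v + - v + zmul (- k) u) (v + zmul k u + zmul (- k) u)"
    using k assms by (intro lt_add_right zmul_closed K) (simp_all only: lt_add_left)
  then have lb: "lt (zmul (- k) u) v" by (simp add: add.assoc flip: zmul_add)
  have ge: "- k < j" if "lt v (zmul j u)" for j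
  proof (rule ccontr)
    assume "\<not> - k < j"
    then have "j < - k \<or> j = - k" by linarith
    then have "lt v (zmul (- k) u)" using that zmul_mono[OF assms(1,3), of j "- k"] lt_trans by auto
    then show False using lb lt_trans lt_irrefl by blast
  qed
  define P where "P i \<longleftrightarrow> lt v (zmul (- k + int i) u)" for i
  have "P (nat (n + k))" using n ge[OF n] by (simp add: P_def)
  then have ex: "P (LEAST i. P i)" by (rule LeastI)
  define i where "i = (LEAST i. P i)"
  have i: "P i" using ex by (simp add: i_def)
  have "i \<noteq> 0"
  proof
    assume "i = 0"
    with i have "lt v (zmul (- k) u)" by (simp add: P_def)
    from ge[OF this] show False by simp
  qed
  then obtain j where j: "i = Suc j" by (cases i) auto
  have "\<not> P j" using j unfolding i_def by (intro not_less_Least) simp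
  then have "\<not> lt v (zmul (- k + int j) u)" "lt v (zmul (- k + int j + 1) u)"
    using i by (simp_all add: P_def j ac_simps)
  then show ?thesis by blast
qed

text \<open>Two multiples of the same \<open>c\<close> commute, and this survives modulo the normal
  subgroup \<open>N\<close>.\<close>

lemma comm_in_N_of_cyclic:
  assumes "c \<in> K" "f = zmul m c + r" "g = zmul n c + s" "r \<in> N" "s \<in> N"
  shows "comm f g \<in> N"
proof -
  have normal: "comm r y \<in> N" if "r \<in> N" "y \<in> K" for r y
  proof -
    have "comm y r \<in> N"
      using conj_N[OF that(2,1)] that(1) subgrp_diff[OF subgrp_N] by (simp add: comm_eq_conj_by)
    then show ?thesis using subgrp_uminus[OF subgrp_N] by (metis uminus_comm)
  qed
  have z: "zmul i c \<in> K" for i using zmul_closed[OF K(1) assms(1)] .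
  have gK: "g \<in> K" using assms N_subset z subgrp_add[OF K(1)] by auto
  have "comm (zmul n c) (zmul m c) = 0"
    using zmul_commute[of n c m] by (simp add: comm_def)
  then have "comm g (zmul m c) \<in> N"
    unfolding assms(3) comm_add_left
    using conj_N[OF z normal[OF assms(5) z]] subgrp_0[OF subgrp_N] by simp
  then have "comm (zmul m c) g \<in> N" using subgrp_uminus[OF subgrp_N] by (metis uminus_comm)
  then show ?thesis
    unfolding assms(2) comm_add_left
    using subgrp_add[OF subgrp_N conj_N[OF z normal[OF assms(4) gK]]] by blast
qed

text \<open>Hoelder's argument: \<open>K / N\<close> is bi-ordered by \<^const>\<open>lt\<close> and archimedean, hence abelian.\<close>

lemma not_lt_0_comm:
  assumes "f \<in> K" "g \<in> K"
  shows "\<not> lt 0 (comm f g)"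
proof
  let ?c = "comm f g"
  assume pos: "lt 0 ?c"
  have c: "?c \<in> K" by (rule comm_closed[OF K(1) assms])
  have z: "zmul i u \<in> K" if "u \<in> K" for i u using zmul_closed[OF K(1) that] .
  \<comment> \<open>Let \<open>m\<close> and \<open>n\<close> be the integer parts of
    \<open>f\<close> and \<open>g\<close> in units of \<open>u\<close>. Then \<open>f + g\<close>
    lies below m + n + 2 units and \<open>g + f\<close> not below m + n, so the commutator is less
    than two units.\<close>
  have large: "lt ?c (zmul 2 u)" if u: "u \<in> K" "lt 0 u" for u
  proof (rule ccontr)
    assume le: "\<not> lt ?c (zmul 2 u)"
    obtain m where m: "\<not> lt f (zmul m u)" "lt f (zmul (m + 1) u)"
      using floor_exists[OF u(1) assms(1) u(2)] by blast
    obtain n where n: "\<not> lt g (zmul n u)" "lt g (zmul (n + 1) u)"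
      using floor_exists[OF u(1) assms(2) u(2)] by blast
    have "lt (f + g) (f + zmul (n + 1) u)" using n by (simp add: lt_add_left)
    also have "lt (f + zmul (n + 1) u) (zmul (m + 1) u + zmul (n + 1) u)"
      by (intro lt_add_right m z u)
    finally (lt_trans) have "lt (f + g) (zmul (2 + (n + m)) u)"
      by (simp add: ac_simps flip: zmul_add)
    moreover have "f + g = ?c + (g + f)"
      by (simp add: comm_def diff_conv_add_uminus add.assoc del: add_uminus_conv_diff)
    ultimately have "lt (?c + (g + f)) (zmul 2 u + zmul (n + m) u)" by (simp only: zmul_add)
    moreover have "\<not> lt (?c + (g + f)) (?c + zmul (n + m) u)"
    proof
      assume "lt (?c + (g + f)) (?c + zmul (n + m) u)"
      then have *: "lt (g + f) (zmul n u + zmul m u)" by (simp add: lt_add_left zmul_add)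
      have "lt (g + f) (g + zmul m u) \<or> lt (g + zmul m u) (zmul n u + zmul m u)"
        using * assms u z by (intro lt_weak) (auto intro!: subgrp_add[OF K(1)])
      then show False
      proof
        assume "lt (g + f) (g + zmul m u)"
        then show False using m by (simp add: lt_add_left)
      next
        assume "lt (g + zmul m u) (zmul n u + zmul m u)"
        from lt_add_right[OF this z[OF u(1), of "- m"]]
        show False using n by (simp add: add.assoc flip: zmul_add)
      qed
    qed
    ultimately have "lt (?c + zmul (n + m) u) (zmul 2 u + zmul (n + m) u)"
      using assms u z c lt_weak[of "zmul 2 u + zmul (n + m) u" "?c + zmul (n + m) u" "?c + (g + f)"]
      by (auto intro!: subgrp_add[OF K(1)])
    from lt_add_right[OF this z[OF u(1), of "- (n + m)"]]
    show False using le by (simp add: add.assoc flip: zmul_add)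
  qed
  \<comment> \<open>Nothing lies strictly between 0 and \<open>?c\<close>: for such an
    \<open>r\<close>, applying \<open>large\<close> to \<open>r\<close> and to
    \<open>- r + ?c\<close> would make each smaller than the other. So \<open>?c\<close> generates
    \<open>K\<close> modulo \<open>N\<close>, and the quotient is abelian.\<close>
  have cyclic: "\<exists>m r. h = zmul m ?c + r \<and> r \<in> N" if h: "h \<in> K" for h
  proof -
    obtain m where m: "\<not> lt h (zmul m ?c)" "lt h (zmul (m + 1) ?c)"
      using floor_exists[OF c h pos] by blast
    define r where "r = - zmul m ?c + h"
    have hr: "h = zmul m ?c + r" by (simp add: r_def add.assoc[symmetric])
    have r: "r \<in> K" using h z[OF c] K by (simp add: r_def subgrp_closed)
    have "\<not> lt r 0" using m(1) lt_add_left[of "zmul m ?c" r 0] by (simp add: hr)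
    moreover have "\<not> lt 0 r"
    proof
      assume "lt 0 r"
      have "lt (zmul m ?c + r) (zmul m ?c + ?c)" using m(2) zmul_add[of m 1 ?c] by (simp add: hr)
      then have "lt r ?c" by (simp add: lt_add_left)
      define e where "e = - r + ?c"
      have ce: "?c = r + e" by (simp add: e_def add.assoc[symmetric])
      have e: "e \<in> K" using r c K by (simp add: e_def subgrp_closed)
      have "lt (r + 0) (r + e)" using \<open>lt r ?c\<close> ce by simp
      then have "lt 0 e" by (simp only: lt_add_left)
      have two: "zmul 2 v = v + v" for v :: homeo using zmul_plus_1[of 1 v] by simp
      have "lt (r + e) (r + r)" using large[OF r \<open>lt 0 r\<close>] ce by (simp add: two)
      then have "lt e r" by (simp add: lt_add_left)
      have "lt (r + e) (e + e)" using large[OF e \<open>lt 0 e\<close>] ce by (simp add: two)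
      from lt_add_right[OF this subgrp_uminus[OF K(1) e]]
      have "lt r e" by (simp add: add.assoc)
      then show False using \<open>lt e r\<close> lt_trans lt_irrefl by blast
    qed
    ultimately have "r \<in> N" using lt_cases[of 0 r] r subgrp_0[OF K(1)] by auto
    then show ?thesis using hr by blast
  qed
  obtain m r n s where "f = zmul m ?c + r" "r \<in> N" "g = zmul n ?c + s" "s \<in> N"
    using cyclic assms by metis
  then have "?c \<in> N" using comm_in_N_of_cyclic[OF c] by blast
  then show False using pos by (auto simp: N_def fixes_in_def lt_def)
qed

lemma comm_in_N:
  assumes "f \<in> K" "g \<in> K"
  shows "comm f g \<in> N"
proof -
  have "\<not> lt (comm f g) 0"
  proof
    assume "lt (comm f g) 0"
    then have "lt 0 (comm g f)"
      using lt_add_left[of "comm g f" "comm f g" 0] by (simp flip: uminus_comm[of g f])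
    then show False using not_lt_0_comm assms by blast
  qed
  then show ?thesis
    using lt_cases[of 0 "comm f g"] not_lt_0_comm[OF assms] comm_closed[OF K(1) assms] subgrp_0[OF K(1)]
    by auto
qed

end

section \<open>The descending series of a group of homeomorphisms\<close>

definition descend :: "homeo set \<Rightarrow> homeo set" where
  "descend K = {g \<in> K. \<forall>a b. gap K a b \<longrightarrow> fixes_in g a b}"

lemma descend_subset: "descend K \<subseteq> K"
  by (auto simp: descend_def)

lemma descend_eq: "descend K = {g \<in> K. \<forall>a b. gap K a b \<longrightarrow> g \<in> nofree_gap.N K a b}" if "subgrp K" "nofree K"
  using that nofree_gap.N_def[of K] by (auto simp: descend_def nofree_gap_def)

lemma subgrp_descend:
  assumes "subgrp K" "nofree K"
  shows "subgrp (descend K)"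
proof -
  have N: "subgrp (nofree_gap.N K a b)" if "gap K a b" for a b
    using assms that nofree_gap.subgrp_N[of K a b] by (simp add: nofree_gap_def)
  show ?thesis
    unfolding descend_eq[OF assms]
    using subgrp_0[OF N] subgrp_add[OF N] subgrp_uminus[OF N] assms(1)
    by (intro subgrpI) (auto simp: subgrp_closed)
qed

lemma comm_in_descend:
  assumes "subgrp K" "nofree K" "f \<in> K" "g \<in> K"
  shows "comm f g \<in> descend K"
  using assms nofree_gap.comm_in_N[of K _ _ f g] comm_closed[of K f g]
  by (simp add: descend_eq nofree_gap_def)

text \<open>Without fixed points all points move in one direction, and this persists under
  iteration. It is the source of the torsion freeness of the factors.\<close>

lemma gap_zmul_fixes_in:
  assumes gx: "gap {x} a b" and n: "n \<noteq> 0"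
  shows "\<not> fixes_in (zmul n x) a b"
proof
  assume "fixes_in (zmul n x) a b"
  then have "fixes_in (zmul \<bar>n\<bar> x) a b"
    by (cases "n \<ge> 0") (auto simp: fixes_in_def zmul_uminus app_uminus_eq_iff)
  then obtain y where y: "a < y" "y < b" "app (zmul \<bar>n\<bar> x) y = y" by (auto simp: fixes_in_def)
  define k where "k = nat \<bar>n\<bar>"
  have k: "k > 0" "app (zmul (int k) x) y = y" using y n by (auto simp: k_def)
  then obtain j where j: "k = Suc j" by (cases k) auto
  have maps: "a < app (zmul (int j) x) y \<and> app (zmul (int j) x) y < b" for j
    using y app_maps_gap[OF gx] zmul_plus_1[of "int j" x for j]
    by (induction j) (auto simp: add.commute)
  have step: "app (zmul (int (Suc j)) x) y = app x (app (zmul (int j) x) y)" for j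
    using zmul_plus_1[of "int j" x] by (simp add: add.commute)
  from gap_direction[OF gx] show False
  proof
    assume up: "\<forall>z. a < z \<longrightarrow> z < b \<longrightarrow> z < app x z"
    have "y < app (zmul (int (Suc j)) x) y" for j
      using up maps y by (induction j) (auto simp: step simp del: of_nat_Suc intro: less_trans)
    from this[of j] show False using k j by simp
  next
    assume up: "\<forall>z. a < z \<longrightarrow> z < b \<longrightarrow> app x z < z"
    have "app (zmul (int (Suc j)) x) y < y" for j
    proof (induction j)
      case 0
      then show ?case using up y by (simp add: step)
    next
      case (Suc j)
      have "app x (app (zmul (int (Suc j)) x) y) < app (zmul (int (Suc j)) x) y"
        using up maps[of "Suc j"] by blast
      then show ?case using Suc unfolding step[of "Suc j"] by (rule less_trans)
    qed
    from this[of j] show False using k j by simp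
  qed
qed

lemma descend_torsion_free:
  assumes "x \<in> K" "n \<noteq> 0" "zmul n x \<in> descend K"
  shows "x \<in> descend K"
proof -
  have "fixes_in x a b" if g: "gap K a b" for a b
    using gap_single_iff[OF g assms(1)] gap_zmul_fixes_in[OF _ assms(2), of x a b] assms(3) g
    by (auto simp: descend_def)
  then show ?thesis using assms(1) by (simp add: descend_def)
qed

text \<open>\<open>G\<close> permutes the components of \<open>K\<close>, and a fixed point of
  \<open>x\<close> in one component is carried to a fixed point of the conjugate in its
  image.\<close>

lemma conj_by_descend:
  assumes "subgrp G" "normalizes G K" "g \<in> G" "x \<in> descend K"
  shows "conj_by g x \<in> descend K"
proof -
  have x: "x \<in> K" using assms(4) descend_subset by blast
  have "fixes_in (conj_by g x) a b" if "gap K a b" for a b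
  proof -
    have "gap K (app (- g) a) (app (- g) b)"
      using that assms normalizesD[OF assms(2)] subgrp_uminus[OF assms(1)] by (intro gap_image) auto
    then obtain y where y: "app (- g) a < y" "y < app (- g) b" "app x y = y"
      using assms(4) by (auto simp: descend_def fixes_in_def)
    have "app (conj_by g x) (app g y) = app g y" by (simp add: app_conj_by y)
    then show ?thesis using y by (auto simp: fixes_in_def app_uminus_less_iff less_app_uminus_iff)
  qed
  then show ?thesis using normalizesD[OF assms(2,3) x] by (simp add: descend_def)
qed

definition levels :: "homeo set \<Rightarrow> nat \<Rightarrow> homeo set" where
  "levels G n = (descend ^^ n) G"

lemma levels_0 [simp]: "levels G 0 = G" and levels_Suc: "levels G (Suc n) = descend (levels G n)"
  by (simp_all add: levels_def)

text \<open>Each level contains the commutators of the preceding one, so Milnor's argument hands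
  finite generation down the series.\<close>

lemma torsion_free_series_levels:
  assumes "subgrp G" "nofree G" "fg G"
  shows "torsion_free_series (levels G)"
proof -
  have *: "subgrp (levels G n) \<and> nofree (levels G n) \<and> fg (levels G n) \<and> normalizes G (levels G n)" for n
  proof (induction n)
    case 0
    then show ?case using assms conj_by_closed[OF assms(1)] by (simp add: normalizes_def)
  next
    case (Suc n)
    let ?K = "levels G n"
    have K: "subgrp ?K" "nofree ?K" "fg ?K" "normalizes G ?K" using Suc by auto
    have "fg (descend ?K)"
      using comm_in_descend[OF K(1,2)] subgrp_descend[OF K(1,2)]
      by (intro fg_between_derived[OF K(3,2,1) _ descend_subset])
    then show ?case
      using subgrp_descend[OF K(1,2)] nofree_subset[OF K(2) descend_subset]
        conj_by_descend[OF assms(1) K(4)] by (simp add: levels_Suc normalizes_def)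
  qed
  show ?thesis
    by unfold_locales
      (use * assms descend_subset comm_in_descend descend_torsion_free in \<open>auto simp: levels_Suc\<close>)
qed

section \<open>Counting and averaging estimates\<close>

text \<open>The parameters with the same quotient lie in a run of \<open>(N - 1) div n + 1\<close>
  integers, and \<open>n \<le> N\<close> absorbs the rounding into the factor 2.\<close>

lemma card_div_fibre_le:
  fixes N n c :: nat
  assumes "1 \<le> n" "n \<le> N"
  shows "real (card {t. t < N \<and> n * t div N = c}) \<le> 2 * real N / real n"
proof (cases "{t. t < N \<and> n * t div N = c} = {}")
  case False
  let ?T = "{t. t < N \<and> n * t div N = c}"
  define t0 where "t0 = Min ?T"
  have t0: "t0 \<in> ?T" "\<And>t. t \<in> ?T \<Longrightarrow> t0 \<le> t" using False Min_in[of ?T] Min_le[of ?T] by (simp_all add: t0_def)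
  have N: "N > 0" using assms by simp
  have "?T \<subseteq> {t0..t0 + (N - 1) div n}"
  proof
    fix t assume t: "t \<in> ?T"
    have "n * t < (c + 1) * N" using t dividend_less_times_div[OF N, of "n * t"] by (auto simp: algebra_simps)
    moreover have "c * N \<le> n * t0" using t0(1) by (metis (mono_tags, lifting) div_times_less_eq_dividend mem_Collect_eq)
    ultimately have "n * (t - t0) < N" using N by (simp add: diff_mult_distrib2)
    then have "(t - t0) * n \<le> N - 1" by (simp add: mult.commute)
    then have "t - t0 \<le> (N - 1) div n" using assms(1) by (simp add: less_eq_div_iff_mult_less_eq)
    then show "t \<in> {t0..t0 + (N - 1) div n}" using t0(2)[OF t] by auto
  qed
  then have "card ?T \<le> card {t0..t0 + (N - 1) div n}" by (intro card_mono) auto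
  then have c: "card ?T \<le> (N - 1) div n + 1" by simp
  have "n * ((N - 1) div n) \<le> N - 1" by simp
  then have "n * ((N - 1) div n + 1) \<le> 2 * N"
    unfolding distrib_left mult_1_right using assms by linarith
  then have "n * card ?T \<le> 2 * N" using c by (meson le_trans mult_le_mono2)
  then have "real n * real (card ?T) \<le> 2 * real N"
    by (metis of_nat_le_iff of_nat_mult of_nat_numeral)
  then show ?thesis using assms by (simp add: field_simps)
next
  case True
  show ?thesis unfolding True by simp
qed

text \<open>At each position the earlier entries prescribe the value of \<open>\<phi>\<close>, which
  leaves at most \<open>B\<close> choices. The dependence on the prefix is essential: walks will be
  compared in coordinate \<open>i\<close> only when their earlier coordinates agree.\<close>

lemma card_lists_determined:
  fixes E :: "'a list set" and B :: real
  assumes "finite T" "\<And>\<theta>. \<theta> \<in> E \<Longrightarrow> length \<theta> = k \<and> set \<theta> \<subseteq> T" "B \<ge> 0"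
    and fibre: "\<And>c. real (card {t \<in> T. \<phi> t = c}) \<le> B"
    and det: "\<And>\<theta> \<theta>' i. \<theta> \<in> E \<Longrightarrow> \<theta>' \<in> E \<Longrightarrow> i < k \<Longrightarrow> take i \<theta> = take i \<theta>' \<Longrightarrow> \<phi> (\<theta> ! i) = \<phi> (\<theta>' ! i)"
  shows "real (card E) \<le> B ^ k"
  using assms(2) det
proof (induction k arbitrary: E)
  case 0
  then have "E \<subseteq> {[]}" by auto
  then have "card E \<le> card {[] :: 'a list}" by (intro card_mono) auto
  then show ?case by simp
next
  case (Suc k)
  have fin: "finite E"
    by (rule finite_subset[OF _ finite_lists_length_eq[OF assms(1), of "Suc k"]])
      (use Suc.prems(1) in auto)
  show ?case
  proof (cases "E = {}")
    case False
    then obtain \<theta>0 where \<theta>0: "\<theta>0 \<in> E" by blast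
    define c where "c = \<phi> (\<theta>0 ! 0)"
    define S where "S t = {\<theta>. t # \<theta> \<in> E}" for t
    have hd: "\<phi> (\<theta> ! 0) = c" if "\<theta> \<in> E" for \<theta>
      unfolding c_def using Suc.prems(2)[OF that \<theta>0, of 0] by simp
    have sub: "E \<subseteq> (\<Union>t\<in>{t \<in> T. \<phi> t = c}. (#) t ` S t)"
    proof
      fix \<theta> assume \<theta>: "\<theta> \<in> E"
      then obtain t \<theta>' where e: "\<theta> = t # \<theta>'" using Suc.prems(1)[OF \<theta>] by (cases \<theta>) auto
      have "t \<in> T" "\<phi> t = c" using Suc.prems(1)[OF \<theta>] hd[OF \<theta>] by (auto simp: e)
      then show "\<theta> \<in> (\<Union>t\<in>{t \<in> T. \<phi> t = c}. (#) t ` S t)" using \<theta> by (auto simp: e S_def)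
    qed
    have finS: "finite (S t)" for t
      using finite_vimageI[OF fin, of "(#) t"] by (simp add: S_def vimage_def)
    have Sc: "real (card (S t)) \<le> B ^ k" for t
    proof (rule Suc.IH)
      show "length \<theta> = k \<and> set \<theta> \<subseteq> T" if "\<theta> \<in> S t" for \<theta>
        using Suc.prems(1)[of "t # \<theta>"] that by (auto simp: S_def)
      show "\<phi> (\<theta> ! i) = \<phi> (\<theta>' ! i)" if "\<theta> \<in> S t" "\<theta>' \<in> S t" "i < k" "take i \<theta> = take i \<theta>'" for \<theta> \<theta>' i
        using Suc.prems(2)[of "t # \<theta>" "t # \<theta>'" "Suc i"] that by (auto simp: S_def)
    qed
    have "card E \<le> card (\<Union>t\<in>{t \<in> T. \<phi> t = c}. (#) t ` S t)"
      using sub finS assms(1) by (intro card_mono) auto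
    also have "\<dots> \<le> (\<Sum>t\<in>{t \<in> T. \<phi> t = c}. card ((#) t ` S t))"
      using assms(1) by (intro card_UN_le) auto
    also have "\<dots> = (\<Sum>t\<in>{t \<in> T. \<phi> t = c}. card (S t))"
      by (intro sum.cong card_image) (auto simp: inj_on_def)
    finally have "real (card E) \<le> (\<Sum>t\<in>{t \<in> T. \<phi> t = c}. real (card (S t)))"
      by (metis of_nat_le_iff of_nat_sum)
    also have "\<dots> \<le> (\<Sum>t\<in>{t \<in> T. \<phi> t = c}. B ^ k)" by (intro sum_mono Sc)
    also have "\<dots> = real (card {t \<in> T. \<phi> t = c}) * B ^ k" by simp
    also have "\<dots> \<le> B * B ^ k" using fibre assms(3) by (intro mult_right_mono) auto
    finally show ?thesis by simp
  qed (use assms(3) in simp)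
qed

lemma sum_disjoint_intervals_le:
  fixes P :: "(real \<times> real) set"
  assumes "finite P" "\<And>p. p \<in> P \<Longrightarrow> 0 \<le> fst p \<and> fst p < snd p \<and> snd p \<le> 1"
    and disj: "\<And>p q. p \<in> P \<Longrightarrow> q \<in> P \<Longrightarrow> p \<noteq> q \<Longrightarrow> snd p \<le> fst q \<or> snd q \<le> fst p"
  shows "(\<Sum>p\<in>P. snd p - fst p) \<le> 1"
proof -
  let ?I = "\<lambda>p :: real \<times> real. {fst p<..<snd p}"
  have "(\<Sum>p\<in>P. snd p - fst p) = (\<Sum>p\<in>P. measure lborel (?I p))"
    using assms(2) by (intro sum.cong) (auto simp: less_imp_le)
  also have "\<dots> = measure lborel (\<Union>p\<in>P. ?I p)"
  proof (rule measure_finite_Union[symmetric])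
    show "disjoint_family_on ?I P"
      unfolding disjoint_family_on_def
    proof (intro ballI impI)
      fix p q assume "p \<in> P" "q \<in> P" "p \<noteq> q"
      from disj[OF this] show "?I p \<inter> ?I q = {}" by auto
    qed
    show "emeasure lborel (?I p) \<noteq> \<infinity>" if "p \<in> P" for p using assms(2)[OF that] by simp
  qed (use assms(1) in auto)
  also have "\<dots> \<le> measure lborel {0..1::real}"
  proof (rule measure_mono_fmeasurable)
    show "(\<Union>p\<in>P. ?I p) \<subseteq> {0..1}"
    proof
      fix x assume "x \<in> (\<Union>p\<in>P. ?I p)"
      then obtain p where "p \<in> P" "fst p < x" "x < snd p" by auto
      then show "x \<in> {0..1}" using assms(2)[of p] by auto
    qed
    show "(\<Union>p\<in>P. ?I p) \<in> sets lborel" using assms(1) by (intro sets.finite_UN) auto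
    show "{0..1::real} \<in> fmeasurable lborel" by (intro fmeasurableI) simp_all
  qed
  finally show ?thesis by simp
qed

text \<open>Intervals of length at most \<open>\<epsilon>\<close> contribute at most
  \<open>\<epsilon> powr \<alpha>\<close> each. Longer ones contribute at most 1 each; by
  disjointness at most \<open>1 / \<epsilon>\<close> of them are distinct, and each occurs at most
  \<open>B\<close> times.\<close>

lemma sum_powr_lengths_le:
  fixes l r :: "'a \<Rightarrow> real"
  assumes fin: "finite \<Theta>" and lr: "\<And>\<theta>. \<theta> \<in> \<Theta> \<Longrightarrow> 0 \<le> l \<theta> \<and> l \<theta> < r \<theta> \<and> r \<theta> \<le> 1"
    and disj: "\<And>\<theta> \<theta>'. \<theta> \<in> \<Theta> \<Longrightarrow> \<theta>' \<in> \<Theta> \<Longrightarrow> l \<theta> < r \<theta>' \<Longrightarrow> l \<theta>' < r \<theta> \<Longrightarrow> l \<theta> = l \<theta>' \<and> r \<theta> = r \<theta>'"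
    and fibre: "\<And>\<theta>. \<theta> \<in> \<Theta> \<Longrightarrow> real (card {\<theta>' \<in> \<Theta>. l \<theta>' = l \<theta> \<and> r \<theta>' = r \<theta>}) \<le> B"
    and "\<epsilon> > 0" "\<alpha> > 0" "B \<ge> 0"
  shows "(\<Sum>\<theta>\<in>\<Theta>. (r \<theta> - l \<theta>) powr \<alpha>) \<le> real (card \<Theta>) * \<epsilon> powr \<alpha> + B / \<epsilon>"
proof -
  define Big where "Big = {\<theta> \<in> \<Theta>. r \<theta> - l \<theta> > \<epsilon>}"
  have finB: "finite Big" using fin by (simp add: Big_def)
  let ?p = "\<lambda>\<theta>. (l \<theta>, r \<theta>)"
  define P where "P = ?p ` Big"
  have finP: "finite P" using finB by (simp add: P_def)
  have "real (card P) * \<epsilon> = (\<Sum>p\<in>P. \<epsilon>)" by simp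
  also have "\<dots> \<le> (\<Sum>p\<in>P. snd p - fst p)" by (intro sum_mono) (auto simp: P_def Big_def)
  also have "\<dots> \<le> 1"
  proof (rule sum_disjoint_intervals_le[OF finP])
    show "0 \<le> fst p \<and> fst p < snd p \<and> snd p \<le> 1" if "p \<in> P" for p
      using that lr by (auto simp: P_def Big_def)
    show "snd p \<le> fst q \<or> snd q \<le> fst p" if pq: "p \<in> P" "q \<in> P" "p \<noteq> q" for p q
    proof -
      obtain \<theta> \<theta>' where "\<theta> \<in> \<Theta>" "p = ?p \<theta>" "\<theta>' \<in> \<Theta>" "q = ?p \<theta>'"
        using pq by (auto simp: P_def Big_def)
      then show ?thesis using disj[of \<theta> \<theta>'] pq(3) by fastforce
    qed
  qed
  finally have cP: "real (card P) \<le> 1 / \<epsilon>" using assms(5) by (simp add: field_simps)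
  have "card Big = (\<Sum>p\<in>P. card {\<theta> \<in> Big. ?p \<theta> = p})"
    unfolding P_def using sum.image_gen[OF finB, of "\<lambda>_. 1 :: nat" ?p] by simp
  then have "real (card Big) = (\<Sum>p\<in>P. real (card {\<theta> \<in> Big. ?p \<theta> = p}))" by simp
  also have "\<dots> \<le> (\<Sum>p\<in>P. B)"
  proof (rule sum_mono)
    fix p assume "p \<in> P"
    then obtain \<theta> where \<theta>: "\<theta> \<in> \<Theta>" "p = ?p \<theta>" by (auto simp: P_def Big_def)
    have "card {\<theta> \<in> Big. ?p \<theta> = p} \<le> card {\<theta>' \<in> \<Theta>. l \<theta>' = l \<theta> \<and> r \<theta>' = r \<theta>}"
      using fin \<theta> by (intro card_mono) (auto simp: Big_def)
    then show "real (card {\<theta> \<in> Big. ?p \<theta> = p}) \<le> B" using fibre[OF \<theta>(1)] by linarith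
  qed
  also have "\<dots> \<le> 1 / \<epsilon> * B" using mult_right_mono[OF cP assms(7)] by simp
  finally have cB: "real (card Big) \<le> B / \<epsilon>" by simp
  have "(\<Sum>\<theta>\<in>\<Theta>. (r \<theta> - l \<theta>) powr \<alpha>) \<le> (\<Sum>\<theta>\<in>\<Theta>. \<epsilon> powr \<alpha> + of_bool (\<theta> \<in> Big))"
  proof (rule sum_mono)
    fix \<theta> assume \<theta>: "\<theta> \<in> \<Theta>"
    show "(r \<theta> - l \<theta>) powr \<alpha> \<le> \<epsilon> powr \<alpha> + of_bool (\<theta> \<in> Big)"
    proof (cases "\<theta> \<in> Big")
      case True
      have "(r \<theta> - l \<theta>) powr \<alpha> \<le> 1 powr \<alpha>" using lr[OF \<theta>] assms(6) by (intro powr_mono2) auto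
      moreover have "0 \<le> \<epsilon> powr \<alpha>" by simp
      ultimately show ?thesis using True by (simp del: powr_ge_zero)
    next
      case False
      then show ?thesis using lr[OF \<theta>] \<theta> assms(6) by (auto simp: Big_def intro!: powr_mono2)
    qed
  qed
  also have "\<dots> = real (card \<Theta>) * \<epsilon> powr \<alpha> + real (card Big)"
  proof -
    have "{\<theta> \<in> \<Theta>. \<theta> \<in> Big} = Big" by (auto simp: Big_def)
    then show ?thesis using fin by (simp add: sum.distrib of_bool_def sum.If_cases Int_def)
  qed
  finally show ?thesis using cB by linarith
qed

lemma sum_inverse_squares_le: "(\<Sum>n = 1..N. 1 / real n ^ 2) \<le> 2"
proof -
  have le: "(\<Sum>n = 1..N. 1 / real n ^ 2) \<le> 2 - 1 / real N" if "N \<ge> 1" for N :: nat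
    using that
  proof (induction N rule: dec_induct)
    case (step n)
    have n: "real n \<ge> 1" using step by simp
    have "real n * real (Suc n) \<le> real (Suc n) ^ 2"
      unfolding power2_eq_square by (intro mult_right_mono) auto
    then have "1 / real (Suc n) ^ 2 \<le> 1 / (real n * real (Suc n))"
      using n by (intro divide_left_mono) auto
    also have "\<dots> = 1 / real n - 1 / real (Suc n)" using n by (simp add: field_simps)
    finally show ?case using step by simp
  qed simp
  have "0 \<le> 1 / real N" by simp
  then have "?thesis" if "N \<ge> 1" using le[OF that] by linarith
  then show ?thesis by (cases "N = 0") auto
qed

text \<open>The bound holds on average over \<open>\<Theta>\<close>, hence for some parameter. The
  factor 2 is the bound for the sum of inverse squares, so the result is uniform in
  \<open>N\<close>.\<close>

lemma exists_small_sum: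
  fixes L :: "nat \<Rightarrow> 'a \<Rightarrow> real"
  assumes fin: "finite \<Theta>" "\<Theta> \<noteq> {}"
    and avg: "\<And>n. 1 \<le> n \<Longrightarrow> n \<le> N \<Longrightarrow> (\<Sum>\<theta>\<in>\<Theta>. L n \<theta>) \<le> real (card \<Theta>) * (A / real n ^ 2)"
    and "A \<ge> 0"
  shows "\<exists>\<theta>\<in>\<Theta>. (\<Sum>n = 1..N. L n \<theta>) \<le> 2 * A"
proof (rule ccontr)
  assume "\<not> ?thesis"
  then have "(\<Sum>\<theta>\<in>\<Theta>. 2 * A) < (\<Sum>\<theta>\<in>\<Theta>. \<Sum>n = 1..N. L n \<theta>)"
    using fin by (intro sum_strict_mono) (auto simp: not_le)
  also have "\<dots> = (\<Sum>n = 1..N. \<Sum>\<theta>\<in>\<Theta>. L n \<theta>)" by (rule sum.swap)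
  also have "\<dots> \<le> (\<Sum>n = 1..N. real (card \<Theta>) * (A / real n ^ 2))" by (intro sum_mono avg) auto
  also have "\<dots> = real (card \<Theta>) * A * (\<Sum>n = 1..N. 1 / real n ^ 2)"
    by (simp add: sum_distrib_left)
  also have "\<dots> \<le> real (card \<Theta>) * A * 2"
    using assms(4) by (intro mult_left_mono sum_inverse_squares_le) auto
  finally show False by simp
qed

section \<open>Distortion\<close>

definition slope :: "homeo \<Rightarrow> real \<Rightarrow> real \<Rightarrow> real" where
  "slope f x y = (app f y - app f x) / (y - x)"

text \<open>A substitute for the Hoelder continuity of \<open>ln f'\<close> that does not mention derivatives.\<close>

definition bounded_distortion :: "real \<Rightarrow> homeo \<Rightarrow> real \<Rightarrow> bool" where
  "bounded_distortion \<alpha> f C \<longleftrightarrow> (\<forall>p q x y u v. 0 \<le> p \<longrightarrow> q \<le> 1 \<longrightarrow> p \<le> x \<longrightarrow> x < y \<longrightarrow> y \<le> q \<longrightarrow>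
     p \<le> u \<longrightarrow> u < v \<longrightarrow> v \<le> q \<longrightarrow> \<bar>ln (slope f x y) - ln (slope f u v)\<bar> \<le> C * (q - p) powr \<alpha>)"

lemma bounded_distortion_mono:
  assumes "bounded_distortion \<alpha> f C" "C \<le> C'"
  shows "bounded_distortion \<alpha> f C'"
  unfolding bounded_distortion_def
proof (intro allI impI)
  fix p q x y u v :: real
  assume "0 \<le> p" "q \<le> 1" "p \<le> x" "x < y" "y \<le> q" "p \<le> u" "u < v" "v \<le> q"
  then have "\<bar>ln (slope f x y) - ln (slope f u v)\<bar> \<le> C * (q - p) powr \<alpha>"
    using assms(1) unfolding bounded_distortion_def by blast
  also have "\<dots> \<le> C' * (q - p) powr \<alpha>" using assms(2) by (intro mult_right_mono) auto
  finally show "\<bar>ln (slope f x y) - ln (slope f u v)\<bar> \<le> C' * (q - p) powr \<alpha>" .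
qed

lemma slope_pos: "x < y \<Longrightarrow> slope f x y > 0"
  by (simp add: slope_def)

lemma app_bounds: "0 \<le> x \<Longrightarrow> 0 \<le> app f x" "x \<le> 1 \<Longrightarrow> app f x \<le> 1"
proof -
  show "0 \<le> app f x" if x: "0 \<le> x"
  proof (rule ccontr)
    assume "\<not> 0 \<le> app f x"
    then have n: "app f x < 0" by simp
    then have "app f (app f x) = app f x" by (intro app_outside) simp
    then have "app f x = x" by simp
    then show False using n x by simp
  qed
  show "app f x \<le> 1" if x: "x \<le> 1"
  proof (rule ccontr)
    assume "\<not> app f x \<le> 1"
    then have n: "app f x > 1" by simp
    then have "app f (app f x) = app f x" by (intro app_outside) simp
    then have "app f x = x" by simp
    then show False using n x by simp
  qed
qed

lemma slope_add:
  assumes "x < y"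
  shows "ln (slope (f + g) x y) = ln (slope f (app g x) (app g y)) + ln (slope g x y)"
proof -
  have "slope (f + g) x y = slope f (app g x) (app g y) * slope g x y"
    using assms by (simp add: slope_def)
  then show ?thesis
    using slope_pos[of x y g] slope_pos[of "app g x" "app g y" f] assms by (simp add: ln_mult)
qed

text \<open>The logarithm of the slope is additive under composition, so the distortions of the
  steps add up, each measured on the current image of the interval.\<close>

lemma distortion_along_path:
  fixes h w :: "nat \<Rightarrow> homeo"
  assumes h: "h 0 = 0" "\<And>n. h (Suc n) = w n + h n" and w: "\<And>n. bounded_distortion \<alpha> (w n) C"
    and ab: "0 \<le> a" "a < b" "b \<le> 1" and xy: "a \<le> x" "x < y" "y \<le> b" "a \<le> u" "u < v" "v \<le> b"
  shows "\<bar>ln (slope (h n) x y) - ln (slope (h n) u v)\<bar> \<le> C * (\<Sum>j<n. (app (h j) b - app (h j) a) powr \<alpha>)"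
proof (induction n)
  case 0
  then show ?case using xy h by (simp add: slope_def)
next
  case (Suc n)
  have "\<bar>ln (slope (w n) (app (h n) x) (app (h n) y)) - ln (slope (w n) (app (h n) u) (app (h n) v))\<bar>
      \<le> C * (app (h n) b - app (h n) a) powr \<alpha>"
    using w[of n] xy ab app_bounds[of _ "h n"] unfolding bounded_distortion_def by simp
  then show ?case using Suc xy by (simp add: h slope_add distrib_left)
qed

section \<open>Paths of intervals\<close>

text \<open>The walk with parameter \<open>\<theta>\<close> has applied the generator \<open>f i\<close> exactly \<open>\<lfloor>n \<theta>\<^sub>i / N\<rfloor>\<close>
  times at time \<open>n\<close>.\<close>

definition incr :: "nat \<Rightarrow> nat \<Rightarrow> nat \<Rightarrow> nat" where
  "incr N n t = Suc n * t div N - n * t div N"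

definition walk_step :: "(nat \<Rightarrow> homeo) \<Rightarrow> nat \<Rightarrow> nat \<Rightarrow> nat list \<Rightarrow> homeo" where
  "walk_step f N n \<theta> = sum_list (map (\<lambda>i. zmul (int (incr N n (\<theta> ! i))) (f i)) [0..<length \<theta>])"

primrec walk :: "(nat \<Rightarrow> homeo) \<Rightarrow> nat \<Rightarrow> nat list \<Rightarrow> nat \<Rightarrow> homeo" where
  "walk f N \<theta> 0 = 0"
| "walk f N \<theta> (Suc n) = walk_step f N n \<theta> + walk f N \<theta> n"

lemma div_le_Suc: "n * t div N \<le> Suc n * t div N"
  by (intro div_le_mono) simp

lemma incr_le_1: "t < N \<Longrightarrow> incr N n t \<le> 1"
proof -
  assume t: "t < N"
  have "Suc n * t div N \<le> (n * t + N) div N" using t by (intro div_le_mono) simp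
  also have "\<dots> = n * t div N + 1" using t by simp
  finally show ?thesis by (simp add: incr_def)
qed

text \<open>For parameters below \<open>N\<close> every increment is 0 or 1, so there are at most
  \<open>2 ^ k\<close> different steps, whatever \<open>N\<close> and \<open>n\<close> are. This
  lets one distortion constant serve all walks.\<close>

lemma finite_steps:
  "finite {walk_step f N n \<theta> | N n \<theta>. length \<theta> = k \<and> set \<theta> \<subseteq> {..<N}}"
proof -
  let ?s = "\<lambda>e. sum_list (map (\<lambda>i. zmul (int (e ! i)) (f i)) [0..<k])"
  have "{walk_step f N n \<theta> | N n \<theta>. length \<theta> = k \<and> set \<theta> \<subseteq> {..<N}} \<subseteq>
      ?s ` {e. set e \<subseteq> {..1::nat} \<and> length e = k}"
  proof clarify
    fix N n :: nat and \<theta> :: "nat list" assume \<theta>: "set \<theta> \<subseteq> {..<N}" "k = length \<theta>"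
    have "walk_step f N n \<theta> = ?s (map (incr N n) \<theta>)"
      unfolding walk_step_def \<theta>(2) by (intro arg_cong[of _ _ sum_list] map_cong) auto
    moreover have "incr N n t \<le> 1" if "t \<in> set \<theta>" for t using incr_le_1[of t N n] \<theta>(1) that by auto
    then have "set (map (incr N n) \<theta>) \<subseteq> {..1}" by auto
    ultimately show "walk_step f N n \<theta> \<in> (\<lambda>e. sum_list (map (\<lambda>i. zmul (int (e ! i)) (f i)) [0..<length \<theta>])) `
        {e. set e \<subseteq> {..1} \<and> length e = length \<theta>}" using \<theta>(2) by (intro image_eqI[of _ _ "map (incr N n) \<theta>"]) auto
  qed
  moreover have "finite {e. set e \<subseteq> {..1::nat} \<and> length e = k}" by (rule finite_lists_length_eq) simp
  ultimately show ?thesis by (rule finite_subset[OF _ finite_imageI])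
qed

lemma sum_list_closed: "subgrp A \<Longrightarrow> set xs \<subseteq> A \<Longrightarrow> sum_list xs \<in> A"
  by (induction xs) (auto simp: subgrp_0 subgrp_add)

lemma walk_step_split:
  assumes "i < length \<theta>"
  shows "walk_step f N n \<theta> = walk_step f N n (take i \<theta>) + zmul (int (incr N n (\<theta> ! i))) (f i) +
    sum_list (map (\<lambda>j. zmul (int (incr N n (\<theta> ! j))) (f j)) [Suc i..<length \<theta>])"
proof -
  have "[0..<length \<theta>] = [0..<i] @ i # [Suc i..<length \<theta>]"
    using assms by (metis le0 less_imp_le_nat upt_add_eq_append upt_conv_Cons le_add_diff_inverse)
  moreover have "walk_step f N n (take i \<theta>) = sum_list (map (\<lambda>j. zmul (int (incr N n (\<theta> ! j))) (f j)) [0..<i])"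
    unfolding walk_step_def using assms by (intro arg_cong[of _ _ sum_list] map_cong) auto
  ultimately show ?thesis by (simp add: walk_step_def add.assoc)
qed

text \<open>Modulo \<open>M\<close> the generators after \<open>f i\<close> disappear and
  \<open>f i\<close> commutes with everything, so its occurrences collect in front and the walk of
  the earlier coordinates remains.\<close>

lemma walk_mod_central:
  fixes H M :: "homeo set"
  assumes "normal_subgrp H M" and f: "\<And>j. j < length \<theta> \<Longrightarrow> f j \<in> H" and i: "i < length \<theta>"
    and central: "\<And>s. s \<in> H \<Longrightarrow> comm s (f i) \<in> M" and later: "\<And>j. i < j \<Longrightarrow> j < length \<theta> \<Longrightarrow> f j \<in> M"
  shows "normal_subgrp.eqv H M (walk f N \<theta> n) (zmul (int (n * (\<theta> ! i) div N)) (f i) + walk f N (take i \<theta>) n)"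
proof -
  interpret normal_subgrp H M by fact
  let ?z = "\<lambda>c. zmul (int c) (f i)"
  have zH: "?z c \<in> H" for c using f[OF i] by (rule zmul_closed[OF A])
  have stepH: "walk_step f N m (take i \<theta>) \<in> H" for m
    unfolding walk_step_def using f i by (intro sum_list_closed[OF A]) (auto intro!: zmul_closed[OF A])
  have pathH: "walk f N (take i \<theta>) m \<in> H" for m
    using stepH by (induction m) (auto intro!: subgrp_add[OF A] subgrp_0[OF A])
  show ?thesis
  proof (induction n)
    case 0
    then show ?case using eqv_refl subgrp_0[OF A] by simp
  next
    case (Suc n)
    let ?s = "walk_step f N n (take i \<theta>)" and ?e = "incr N n (\<theta> ! i)" and ?c = "n * (\<theta> ! i) div N"
    let ?r = "sum_list (map (\<lambda>j. zmul (int (incr N n (\<theta> ! j))) (f j)) [Suc i..<length \<theta>])"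
    let ?v = "walk f N (take i \<theta>) n"
    have "?r \<in> M" using later by (intro sum_list_closed[OF B]) (auto intro!: zmul_closed[OF B])
    then have r: "eqv ?r 0" by (simp add: eqv_0_iff)
    have "walk f N \<theta> (Suc n) = ?s + ?z ?e + ?r + walk f N \<theta> n" by (simp add: walk_step_split[OF i])
    also have "eqv \<dots> (?s + ?z ?e + 0 + (?z ?c + ?v))"
      by (intro eqv_add eqv_refl stepH zH r Suc)
    also have "\<dots> = ?s + ?z (?e + ?c) + ?v" by (simp add: zmul_add add.assoc)
    also have "?e + ?c = Suc n * (\<theta> ! i) div N" using div_le_Suc by (simp add: incr_def)
    also have "eqv (?s + ?z (Suc n * (\<theta> ! i) div N) + ?v) (?z (Suc n * (\<theta> ! i) div N) + ?s + ?v)"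
      by (intro eqv_add eqv_refl pathH eqv_sym[OF central_commute] stepH f i central)
    finally show ?case by (simp add: add.assoc)
  qed
qed

text \<open>Kopell's argument: \<open>h\<close> conjugates a map moving \<open>x\<close> far into a map close to the identity, although
  its distortion is bounded.\<close>

lemma kopell_contradiction:
  fixes E h :: homeo
  assumes ab: "0 \<le> a" "a < b" "b \<le> 1" and x: "a < x" "x < b"
    and E: "app E (app h a) = app h a" "app E (app h b) = app h b"
    and h: "\<And>y z. a < y \<Longrightarrow> y \<le> b \<Longrightarrow> a < z \<Longrightarrow> z \<le> b \<Longrightarrow> \<bar>ln (slope h a y) - ln (slope h a z)\<bar> \<le> D"
    and C: "bounded_distortion \<alpha> E C" "C * (app h b - app h a) powr \<alpha> \<le> 1"
    and far: "a + exp (D + 1) * (x - a) < app (conj_by (- h) E) x"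
  shows False
proof -
  define y where "y = app (conj_by (- h) E) x"
  have hy: "app h y = app E (app h x)" by (simp add: y_def conj_by_def)
  have "app h a < app E (app h x)" "app E (app h x) < app h b"
    using x E app_less_iff[of E "app h a" "app h x"] app_less_iff[of E "app h x" "app h b"] by auto
  then have y: "a < y" "y < b" using hy app_less_iff[of h a y] app_less_iff[of h y b] by auto
  have "\<bar>ln (slope E (app h a) (app h x)) - ln (slope E (app h a) (app h b))\<bar> \<le> C * (app h b - app h a) powr \<alpha>"
    using C(1) ab x app_bounds[of _ h] unfolding bounded_distortion_def by simp
  \<comment> \<open>\<open>E\<close> fixes both endpoints of the image interval, so its slope over
    the whole of it is 1 and serves as the reference value.\<close>
  moreover have "slope E (app h a) (app h b) = 1" using E ab by (simp add: slope_def)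
  ultimately have "ln (slope E (app h a) (app h x)) \<le> 1" using C(2) by simp
  moreover have "ln (slope E (app h a) (app h x)) = ln (app h y - app h a) - ln (app h x - app h a)"
    using x y E by (simp add: slope_def hy[symmetric] ln_div)
  moreover have "ln (slope h a y) = ln (app h y - app h a) - ln (y - a)"
    "ln (slope h a x) = ln (app h x - app h a) - ln (x - a)"
    using x y by (simp_all add: slope_def ln_div)
  moreover have "\<bar>ln (slope h a y) - ln (slope h a x)\<bar> \<le> D" using h x y by simp
  \<comment> \<open>Comparing \<open>x\<close> with \<open>y\<close> through \<open>h\<close> costs
    the distortion \<open>D\<close> of \<open>h\<close>, and 1 for \<open>E\<close>.\<close>
  ultimately have "ln (y - a) \<le> D + 1 + ln (x - a)" by linarith
  then have "exp (ln (y - a)) \<le> exp (D + 1 + ln (x - a))" by simp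
  also have "\<dots> = exp (D + 1) * (x - a)" using x by (simp add: exp_add)
  finally have "y - a \<le> exp (D + 1) * (x - a)" using y by simp
  then show False using far y_def by simp
qed

text \<open>Two different multiples of \<open>g\<close> share a coset, by pigeonhole.\<close>

lemma multiple_in_finite_index:
  assumes "subgrp H" "finite R" "\<And>g. g \<in> G \<Longrightarrow> \<exists>r\<in>R. - r + g \<in> H" "subgrp G" "g \<in> G"
  shows "\<exists>n>0. zmul n g \<in> H"
proof -
  have "\<forall>n::nat. \<exists>r. r \<in> R \<and> - r + zmul (int n) g \<in> H" using assms(3) zmul_closed[OF assms(4,5)] by blast
  then obtain r where r: "\<And>n::nat. r n \<in> R" "\<And>n. - r n + zmul (int n) g \<in> H" by metis
  have "\<not> inj r"
  proof
    assume "inj r"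
    then have "infinite (range r)" using finite_imageD by blast
    moreover have "range r \<subseteq> R" using r(1) by auto
    ultimately show False using assms(2) finite_subset by blast
  qed
  then obtain m n where mn: "r m = r n" "m \<noteq> n" by (auto simp: inj_def)
  have *: "zmul (int j - int i) g \<in> H" if "r i = r j" for i j
  proof -
    have "- (- r i + zmul (int i) g) + (- r j + zmul (int j) g) = - zmul (int i) g + zmul (int j) g"
      using that by (simp add: minus_add add.assoc)
    also have "\<dots> = zmul (int j - int i) g" using zmul_add[of "- int i" "int j" g] by (simp add: zmul_uminus)
    finally show ?thesis using r(2) subgrp_add[OF assms(1)] subgrp_uminus[OF assms(1)] by metis
  qed
  show ?thesis
  proof (cases "m < n")
    case True
    then show ?thesis using *[OF mn(1)] by (intro exI[of _ "int n - int m"]) simp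
  next
    case False
    then show ?thesis using *[OF mn(1)[symmetric]] mn(2) by (intro exI[of _ "int m - int n"]) simp
  qed
qed

section \<open>The length of the descending series is bounded\<close>

text \<open>These assumptions turn out to be contradictory: level \<open>k\<close> still moves the
  point \<open>x0\<close> although \<open>k\<close> has reached the bound.\<close>

locale deep_group =
  fixes G :: "homeo set" and \<alpha> :: real and k :: nat and x0 :: real
  assumes G: "subgrp G" "nofree G" "fg G" and \<alpha>: "\<alpha> > 0"
    and distortion: "g \<in> G \<Longrightarrow> \<exists>C. bounded_distortion \<alpha> g C"
    and moved: "x0 \<notin> Fix (levels G k)" and k: "real k \<ge> 2 / \<alpha> + 2"
begin

text \<open>The cutoff is \<open>Suc k\<close> because central elements are needed on all levels
  from 0 to \<open>k\<close>: those below \<open>k\<close> drive the walk, and the last one is for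
  Kopell's argument.\<close>

sublocale series: torsion_free_series "levels G" "Suc k"
  by (rule torsion_free_series_levels[OF G])

abbreviation H :: "homeo set" where "H \<equiv> series.H"

lemma HG: "H \<subseteq> G"
  using series.H_subset by simp

lemma level_nofree: "nofree (levels G i)"
  using nofree_subset[OF G(2)] series.K_0[of i] by simp

lemma Fix_mono: "i \<le> j \<Longrightarrow> Fix (levels G i) \<subseteq> Fix (levels G j)"
  using series.K_mono[of i j] by (auto simp: Fix_def)

definition lo :: "nat \<Rightarrow> real" where
  "lo i = (SOME p. \<exists>q. gap (levels G i) p q \<and> p < x0 \<and> x0 < q)"

definition hi :: "nat \<Rightarrow> real" where
  "hi i = (SOME q. gap (levels G i) (lo i) q \<and> lo i < x0 \<and> x0 < q)"

lemma lo_hi: "i \<le> k \<Longrightarrow> gap (levels G i) (lo i) (hi i)" "i \<le> k \<Longrightarrow> lo i < x0" "i \<le> k \<Longrightarrow> x0 < hi i"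
proof -
  assume i: "i \<le> k"
  have "x0 \<notin> Fix (levels G i)" using moved Fix_mono[OF i] by blast
  then obtain p q where "gap (levels G i) p q" "p < x0" "x0 < q" by (rule gap_exists)
  then have "\<exists>p q. gap (levels G i) p q \<and> p < x0 \<and> x0 < q" by blast
  from someI_ex[OF this] have "\<exists>q. gap (levels G i) (lo i) q \<and> lo i < x0 \<and> x0 < q" by (simp add: lo_def)
  from someI_ex[OF this] have "gap (levels G i) (lo i) (hi i) \<and> lo i < x0 \<and> x0 < hi i"
    unfolding hi_def .
  then show "gap (levels G i) (lo i) (hi i)" "lo i < x0" "x0 < hi i" by blast+
qed

lemma lo_hi_mono:
  assumes "i \<le> j" "j \<le> k"
  shows "lo i \<le> lo j" "hi j \<le> hi i"
proof -
  have g: "gap (levels G j) (lo j) (hi j)" "lo j < x0" "x0 < hi j"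
    "gap (levels G i) (lo i) (hi i)" "lo i < x0" "x0 < hi i" using assms lo_hi by auto
  then have "lo i \<in> Fix (levels G j)" "hi i \<in> Fix (levels G j)"
    using Fix_mono[OF assms(1)] by (auto simp: gap_def)
  then show "lo i \<le> lo j" "hi j \<le> hi i"
    using gap_left_le[OF g(1), of "lo i"] gap_right_le[OF g(1), of "hi i"] g by auto
qed

lemma fixes_in_Suc_level: "i \<le> k \<Longrightarrow> g \<in> levels G (Suc i) \<Longrightarrow> fixes_in g (lo i) (hi i)"
  using lo_hi(1) by (auto simp: levels_Suc descend_def)

lemma nofree_gap_level: "i \<le> k \<Longrightarrow> nofree_gap (levels G i) (lo i) (hi i)"
  using series.K level_nofree lo_hi(1) by (simp add: nofree_gap_def)

text \<open>Some generator of level \<open>i\<close> has no fixed point in the component, and a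
  multiple of it lies in \<open>H\<close>. Among such elements of \<open>H\<close> take one in
  \<open>F i l\<close> with \<open>l\<close> least: its commutators with \<open>H\<close> lie in
  \<open>H\<close> and one step lower in \<open>F\<close>, so minimality gives them fixed
  points.\<close>

lemma exists_central:
  assumes i: "i \<le> k"
  shows "\<exists>f. f \<in> H \<and> f \<in> levels G i \<and> gap {f} (lo i) (hi i) \<and> (\<forall>h\<in>H. fixes_in (comm h f) (lo i) (hi i))"
proof -
  obtain S where S: "finite S" "gen S = levels G i" using series.K_fg[of i] by (auto simp: fg_def)
  have SG: "S \<subseteq> G" using S gen_superset[of S] series.K_0[of i] by auto
  obtain s where s: "s \<in> S" "gap {s} (lo i) (hi i)"
    using gap_generator[OF G(1,2) S(1) SG, of "lo i" "hi i"] lo_hi(1)[OF i] S(2) by auto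
  obtain R where R: "finite R" "\<And>g. g \<in> G \<Longrightarrow> \<exists>r\<in>R. - r + g \<in> H"
    using series.H_finite_index by auto
  obtain n where n: "n > 0" "zmul n s \<in> H"
    using multiple_in_finite_index[OF series.subgrp_H R G(1), of s] s SG by auto
  have sK: "s \<in> levels G i" using s S gen_superset[of S] by auto
  then have nK: "zmul n s \<in> levels G i" by (rule zmul_closed[OF series.K])
  have nf: "\<not> fixes_in (zmul n s) (lo i) (hi i)" using gap_zmul_fixes_in[OF s(2)] n by simp
  obtain l where l: "series.F i l = levels G i" using series.F_top[of i] i by auto
  define P where "P l \<longleftrightarrow> (\<exists>f \<in> series.F i l \<inter> H. \<not> fixes_in f (lo i) (hi i))" for l
  have "P l" using n nK nf by (auto simp: P_def l)
  define m where "m = (LEAST l. P l)"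
  have m: "P m" unfolding m_def using \<open>P l\<close> by (rule LeastI)
  have "\<not> P 0" using fixes_in_Suc_level[OF i] by (auto simp: P_def)
  then have "m \<noteq> 0" using m by (cases m) auto
  then obtain m' where m': "m = Suc m'" by (cases m) auto
  have nm: "\<not> P m'" using m' unfolding m_def by (intro not_less_Least) simp
  obtain f where f: "f \<in> series.F i (Suc m')" "f \<in> H" "\<not> fixes_in f (lo i) (hi i)"
    using m m' unfolding P_def by blast
  have fK: "f \<in> levels G i" using f(1) by simp
  have "fixes_in (comm h f) (lo i) (hi i)" if h: "h \<in> H" for h
  proof (rule ccontr)
    assume "\<not> ?thesis"
    moreover have "comm h f \<in> series.F i m'" using f(1) h by simp
    moreover have "comm h f \<in> H" by (rule comm_closed[OF series.subgrp_H h f(2)])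
    ultimately show False using nm by (auto simp: P_def)
  qed
  moreover have "gap {f} (lo i) (hi i)" using gap_single_iff[OF lo_hi(1)[OF i] fK] f(3) by simp
  ultimately show ?thesis using f(2) fK by blast
qed

definition f :: "nat \<Rightarrow> homeo" where
  "f i = (SOME f. f \<in> H \<and> f \<in> levels G i \<and> gap {f} (lo i) (hi i) \<and>
     (\<forall>h\<in>H. fixes_in (comm h f) (lo i) (hi i)))"

lemma f: 
  assumes "i \<le> k"
  shows "f i \<in> H" "f i \<in> levels G i" "gap {f i} (lo i) (hi i)"
    "h \<in> H \<Longrightarrow> fixes_in (comm h (f i)) (lo i) (hi i)"
  using someI_ex[OF exists_central[OF assms]] by (auto simp: f_def)

abbreviation Q :: "nat \<Rightarrow> homeo set" where
  "Q i \<equiv> nofree_gap.N (levels G i) (lo i) (hi i)"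

lemma Q_iff: "i \<le> k \<Longrightarrow> g \<in> Q i \<longleftrightarrow> g \<in> levels G i \<and> fixes_in g (lo i) (hi i)"
  using nofree_gap.N_def[OF nofree_gap_level] by simp

lemma subgrp_Q: "i \<le> k \<Longrightarrow> subgrp (Q i)"
  by (rule nofree_gap.subgrp_N[OF nofree_gap_level])

lemma conj_level: "h \<in> H \<Longrightarrow> g \<in> levels G i \<Longrightarrow> conj_by h g \<in> levels G i"
  using series.conj_K[of h g i] HG by auto

text \<open>The normal core in \<open>H\<close> of the part of \<open>Q i\<close> inside
  \<open>H\<close>. It is needed because elements of \<open>H\<close> may move the component of
  level \<open>i\<close>, so they need not normalize \<open>Q i\<close>.\<close>

definition M :: "nat \<Rightarrow> homeo set" where
  "M i = {g \<in> H. \<forall>h\<in>H. conj_by h g \<in> Q i}"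

lemma M_subset_Q: "M i \<subseteq> Q i"
  using subgrp_0[OF series.subgrp_H] by (force simp: M_def)

lemma normal_M:
  assumes "i \<le> k"
  shows "normal_subgrp H (M i)"
proof
  note Q = subgrp_Q[OF assms]
  note H = series.subgrp_H
  show "subgrp H" by (rule H)
  show "subgrp (M i)"
  proof (rule subgrpI)
    show "0 \<in> M i" by (simp add: M_def subgrp_0[OF H] subgrp_0[OF Q])
    show "x + y \<in> M i" if "x \<in> M i" "y \<in> M i" for x y
      using that by (simp add: M_def subgrp_add[OF H] subgrp_add[OF Q] conj_by_add)
    show "- x \<in> M i" if "x \<in> M i" for x
      using that by (simp add: M_def subgrp_uminus[OF H] subgrp_uminus[OF Q] conj_by_uminus)
  qed
  show "M i \<subseteq> H" by (auto simp: M_def)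
  show "normalizes H (M i)"
    unfolding normalizes_def
    by (simp add: M_def conj_by_conj_by subgrp_add[OF H] conj_by_closed[OF H])
qed

text \<open>A conjugate of a commutator with \<open>f i\<close> is a difference of two such
  commutators, so all conjugates stay in \<open>Q i\<close>.\<close>

lemma f_central:
  assumes "i \<le> k" "s \<in> H"
  shows "comm s (f i) \<in> M i"
proof -
  have *: "comm h (f i) \<in> Q i" if "h \<in> H" for h
    using f(4)[OF assms(1) that] series.comm_K[of h "f i" i] that HG f(2)[OF assms(1)] Q_iff[OF assms(1)]
    by auto
  have "conj_by h (comm s (f i)) \<in> Q i" if h: "h \<in> H" for h
  proof -
    have "conj_by h (comm s (f i)) = comm (h + s) (f i) - comm h (f i)" by (simp add: comm_add_left)
    then show ?thesis
      using * h subgrp_add[OF series.subgrp_H h assms(2)] subgrp_diff[OF subgrp_Q[OF assms(1)]] by simp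
  qed
  moreover have "comm s (f i) \<in> H" by (rule comm_closed[OF series.subgrp_H assms(2) f(1)[OF assms(1)]])
  ultimately show ?thesis by (simp add: M_def)
qed

lemma f_later:
  assumes "i < j" "j \<le> k"
  shows "f j \<in> M i"
proof -
  have i: "i \<le> k" using assms by simp
  have fj: "f j \<in> levels G (Suc i)" using f(2)[OF assms(2)] series.K_mono[of "Suc i" j] assms(1) by auto
  have "conj_by h (f j) \<in> Q i" if "h \<in> H" for h
    using conj_level[OF that fj] fixes_in_Suc_level[OF i] series.K_Suc[of i] Q_iff[OF i] by auto
  then show ?thesis using f(1)[OF assms(2)] by (simp add: M_def)
qed

lemma gap_conj: "h \<in> H \<Longrightarrow> gap (levels G i) p q \<Longrightarrow> gap (levels G i) (app h p) (app h q)"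
  using conj_level subgrp_uminus[OF series.subgrp_H] by (intro gap_image) auto

text \<open>If the image of the innermost component meets it, \<open>u\<close> maps the component of
  level \<open>Suc i\<close> to itself, since components are permuted. This component is strictly
  smaller than that of level \<open>i\<close>, because \<open>f (Suc i)\<close> has a fixed point in
  the latter and none in the former; so one of its endpoints is the fixed point sought.\<close>

lemma overlap_fixes_in:
  assumes "u \<in> H" "i < k" "app u (lo k) < hi k" "lo k < app u (hi k)"
  shows "fixes_in u (lo i) (hi i)"
proof -
  have ik: "Suc i \<le> k" "i \<le> k" using assms(2) by auto
  let ?p = "lo (Suc i)" and ?q = "hi (Suc i)"
  note g = lo_hi(1)[OF ik(1)]
  have n: "?p \<le> lo k" "hi k \<le> ?q" using lo_hi_mono[OF ik(1)] by auto
  have "app u ?p \<le> app u (lo k)" "app u (hi k) \<le> app u ?q" using n by simp_all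
  then have eq: "app u ?p = ?p \<and> app u ?q = ?q"
    using gap_overlap_eq[OF gap_conj[OF assms(1) g] g] assms(3,4) n by linarith
  have "fixes_in (f (Suc i)) (lo i) (hi i)"
    using fixes_in_Suc_level[OF ik(2)] f(2)[OF ik(1)] by blast
  moreover have "\<not> fixes_in (f (Suc i)) ?p ?q"
    using gap_single_iff[OF g f(2)[OF ik(1)]] f(3)[OF ik(1)] by simp
  ultimately have "?p \<noteq> lo i \<or> ?q \<noteq> hi i" by metis
  moreover have "lo i \<le> ?p" "?q \<le> hi i" using lo_hi_mono[of i "Suc i"] ik by auto
  moreover have "?p < ?q" using g by (simp add: gap_def)
  ultimately have "(lo i < ?p \<and> ?p < hi i) \<or> (lo i < ?q \<and> ?q < hi i)" by linarith
  then show ?thesis using eq by (auto simp: fixes_in_def)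
qed

lemma walk_in_H:
  assumes "length \<theta> \<le> k"
  shows "walk f N \<theta> n \<in> H"
proof -
  have "walk_step f N m \<theta> \<in> H" for m
    unfolding walk_step_def using f(1) assms
    by (intro sum_list_closed series.subgrp_H) (auto intro!: zmul_closed[OF series.subgrp_H])
  then show ?thesis
    by (induction n) (auto intro!: subgrp_add[OF series.subgrp_H] subgrp_0[OF series.subgrp_H])
qed

text \<open>For equal prefixes the walks differ, modulo \<open>M i\<close>, by a multiple of
  \<open>f i\<close> whose exponent is the difference of the two counts. Overlap gives this
  difference a fixed point in the component of level \<open>i\<close>, which a nonzero multiple of
  \<open>f i\<close> lacks.\<close>

lemma walk_separation:
  assumes "length \<theta> = k" "length \<theta>' = k" "i < k" "take i \<theta> = take i \<theta>'"
    and o: "app (walk f N \<theta> n) (lo k) < app (walk f N \<theta>' n) (hi k)"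
      "app (walk f N \<theta>' n) (lo k) < app (walk f N \<theta> n) (hi k)"
  shows "n * (\<theta> ! i) div N = n * (\<theta>' ! i) div N"
proof -
  have ik: "i \<le> k" using assms(3) by simp
  interpret nm: normal_subgrp H "M i" by (rule normal_M[OF ik])
  let ?P = "walk f N \<theta> n" and ?P' = "walk f N \<theta>' n" and ?v = "walk f N (take i \<theta>) n"
  let ?c = "int (n * (\<theta> ! i) div N)" and ?c' = "int (n * (\<theta>' ! i) div N)"
  note fi = f(1,2,3)[OF ik]
  have P: "?P \<in> H" "?P' \<in> H" "?v \<in> H" using walk_in_H assms by auto
  have e: "nm.eqv ?P (zmul ?c (f i) + ?v)" "nm.eqv ?P' (zmul ?c' (f i) + ?v)"
    using walk_mod_central[OF normal_M[OF ik], of \<theta> f i N n] walk_mod_central[OF normal_M[OF ik], of \<theta>' f i N n]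
      assms f(1) f_central[OF ik] f_later by auto
  let ?u = "- ?P + ?P'"
  have u: "?u \<in> H" using P series.subgrp_H by (auto simp: subgrp_closed)
  have "nm.eqv ?u (- (zmul ?c (f i) + ?v) + (zmul ?c' (f i) + ?v))"
    by (intro nm.eqv_add nm.eqv_uminus e)
  also have "\<dots> = - ?v + (zmul (?c' - ?c) (f i) + ?v)"
    using zmul_add[of "- ?c" ?c' "f i"] by (simp add: minus_add zmul_uminus add.assoc[symmetric] diff_conv_add_uminus del: add_uminus_conv_diff)
  also have "nm.eqv (- ?v + (zmul (?c' - ?c) (f i) + ?v)) (- ?v + (?v + zmul (?c' - ?c) (f i)))"
    using P(3) fi(1) f_central[OF ik P(3)] subgrp_uminus[OF series.subgrp_H]
    by (intro nm.eqv_add nm.eqv_refl nm.central_commute) auto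
  finally have d: "?u - zmul (?c' - ?c) (f i) \<in> Q i"
    using M_subset_Q[of i] by (auto simp: nm.eqv_def)
  have z: "zmul (?c' - ?c) (f i) \<in> levels G i" by (rule zmul_closed[OF series.K fi(2)])
  have "?u \<in> levels G i"
    using d Q_iff[OF ik] subgrp_add[OF series.K _ z, of "?u - zmul (?c' - ?c) (f i)"] by simp
  moreover have "fixes_in ?u (lo i) (hi i)"
    using o by (intro overlap_fixes_in u assms(3)) (simp_all add: app_uminus_less_iff less_app_uminus_iff)
  ultimately have "?u \<in> Q i" using Q_iff[OF ik] by simp
  then have "zmul (?c' - ?c) (f i) \<in> Q i"
    using d subgrp_add[OF subgrp_Q[OF ik] subgrp_uminus[OF subgrp_Q[OF ik] d], of ?u]
    by (simp add: diff_conv_add_uminus minus_add add.assoc del: add_uminus_conv_diff)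
  then have "fixes_in (zmul (?c' - ?c) (f i)) (lo i) (hi i)" using Q_iff[OF ik] by simp
  then have "?c' - ?c = 0" using gap_zmul_fixes_in[OF fi(3)] by blast
  then show ?thesis by simp
qed

definition len :: "nat \<Rightarrow> nat \<Rightarrow> nat list \<Rightarrow> real" where
  "len N n \<theta> = app (walk f N \<theta> n) (hi k) - app (walk f N \<theta> n) (lo k)"

definition Params :: "nat \<Rightarrow> nat list set" where
  "Params N = {\<theta>. set \<theta> \<subseteq> {..<N} \<and> length \<theta> = k}"

lemma Params: "finite (Params N)" "card (Params N) = N ^ k"
  unfolding Params_def using finite_lists_length_eq[of "{..<N}" k] card_lists_length_eq[of "{..<N}" k] by auto

lemma lo_hi_k: "0 \<le> lo k" "lo k < hi k" "hi k \<le> 1"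
  using gap_bounds[OF lo_hi(1)[of k]] lo_hi(1)[of k] by (auto simp: gap_def)

lemma average_len:
  assumes n: "1 \<le> n" "n \<le> N"
  shows "(\<Sum>\<theta>\<in>Params N. len N n \<theta> powr \<alpha>) \<le> real (card (Params N)) * ((1 + 2 ^ k) / real n ^ 2)"
proof -
  let ?l = "\<lambda>\<theta>. app (walk f N \<theta> n) (lo k)" and ?r = "\<lambda>\<theta>. app (walk f N \<theta> n) (hi k)"
  \<comment> \<open>With this threshold \<open>\<epsilon> powr \<alpha>\<close> is the inverse
    square of \<open>n\<close>, and \<open>B / \<epsilon>\<close> is \<open>N ^ k\<close> times
    \<open>2 ^ k\<close> times \<open>n powr (2 / \<alpha> - k)\<close>, which the bound on
    \<open>k\<close> makes just as small.\<close>
  define \<epsilon> where "\<epsilon> = real n powr (- 2 / \<alpha>)"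
  define B where "B = (2 * real N / real n) ^ k"
  have "\<epsilon> powr \<alpha> = real n powr (- 2 / \<alpha> * \<alpha>)" unfolding \<epsilon>_def by (rule powr_powr)
  also have "- 2 / \<alpha> * \<alpha> = - 2" using \<alpha> by simp
  also have "real n powr (- 2) = 1 / real n ^ 2" using n by (simp add: powr_minus_divide powr_numeral)
  finally have e1: "\<epsilon> powr \<alpha> = 1 / real n ^ 2" .
  have fibre: "real (card {\<theta>' \<in> Params N. ?l \<theta>' = ?l \<theta> \<and> ?r \<theta>' = ?r \<theta>}) \<le> B" if "\<theta> \<in> Params N" for \<theta>
    unfolding B_def
  proof (rule card_lists_determined[where T = "{..<N}" and \<phi> = "\<lambda>t. n * t div N"])
    show "real (card {t \<in> {..<N}. n * t div N = c}) \<le> 2 * real N / real n" for c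
      using card_div_fibre_le[OF n, of c] by simp
    fix \<theta>1 \<theta>2 i
    assume "\<theta>1 \<in> {\<theta>' \<in> Params N. ?l \<theta>' = ?l \<theta> \<and> ?r \<theta>' = ?r \<theta>}"
      "\<theta>2 \<in> {\<theta>' \<in> Params N. ?l \<theta>' = ?l \<theta> \<and> ?r \<theta>' = ?r \<theta>}" "i < k" "take i \<theta>1 = take i \<theta>2"
    then show "n * (\<theta>1 ! i) div N = n * (\<theta>2 ! i) div N"
      using lo_hi_k by (intro walk_separation) (auto simp: Params_def)
  qed (auto simp: Params_def)
  have "(\<Sum>\<theta>\<in>Params N. (?r \<theta> - ?l \<theta>) powr \<alpha>) \<le> real (card (Params N)) * \<epsilon> powr \<alpha> + B / \<epsilon>"
  proof (rule sum_powr_lengths_le[OF Params(1) _ _ fibre])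
    show "0 \<le> ?l \<theta> \<and> ?l \<theta> < ?r \<theta> \<and> ?r \<theta> \<le> 1" for \<theta> using lo_hi_k app_bounds by simp
    fix \<theta> \<theta>' assume "\<theta> \<in> Params N" "\<theta>' \<in> Params N" and o: "?l \<theta> < ?r \<theta>'" "?l \<theta>' < ?r \<theta>"
    then have "walk f N \<theta> n \<in> H" "walk f N \<theta>' n \<in> H" by (auto simp: Params_def intro!: walk_in_H)
    then show "?l \<theta> = ?l \<theta>' \<and> ?r \<theta> = ?r \<theta>'"
      using gap_overlap_eq[OF gap_conj gap_conj o] lo_hi(1)[of k] by blast
  qed (use n \<alpha> in \<open>auto simp: \<epsilon>_def B_def\<close>)
  also have "\<epsilon> powr \<alpha> = 1 / real n ^ 2" by (rule e1)
  also have "B / \<epsilon> \<le> real (card (Params N)) * (2 ^ k / real n ^ 2)"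
  proof -
    have "B / \<epsilon> = real N ^ k * 2 ^ k * (real n powr (2 / \<alpha>) / real n ^ k)"
      using n by (simp add: B_def \<epsilon>_def powr_minus_divide power_mult_distrib power_divide)
    also have "real n powr (2 / \<alpha>) / real n ^ k = real n powr (2 / \<alpha> - real k)"
      using n by (simp add: powr_diff powr_realpow)
    also have "\<dots> \<le> real n powr (- 2)" using n k by (intro powr_mono) auto
    also have "real n powr (- 2) = 1 / real n ^ 2" using n by (simp add: powr_minus_divide powr_numeral)
    finally show ?thesis by (simp add: Params(2) mult_left_mono)
  qed
  finally show ?thesis by (simp add: len_def add_divide_distrib distrib_left)
qed

lemma contradiction: False
proof -
  let ?a = "lo k" and ?b = "hi k"
  define A :: real where "A = 1 + 2 ^ k"
  define W where "W = {walk_step f N n \<theta> | N n \<theta>. length \<theta> = k \<and> set \<theta> \<subseteq> {..<N}}"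
  have "W \<subseteq> G"
  proof
    fix w assume "w \<in> W"
    then obtain N n \<theta> where w: "w = walk_step f N n \<theta>" "length \<theta> = k" by (auto simp: W_def)
    have "f i \<in> G" if "i < length \<theta>" for i using f(1)[of i] HG that w(2) by auto
    then show "w \<in> G"
      unfolding w(1) walk_step_def
      by (intro sum_list_closed[OF G(1)]) (auto intro!: zmul_closed[OF G(1)])
  qed
  then have "\<forall>w\<in>W. \<exists>C. bounded_distortion \<alpha> w C" using distortion by blast
  from bchoice[OF this] obtain c where c: "\<forall>w\<in>W. bounded_distortion \<alpha> w (c w)" ..
  define C where "C = Max (insert 0 (c ` W))"
  have finW: "finite (insert 0 (c ` W))" unfolding W_def using finite_steps[of f k] by simp
  have C: "bounded_distortion \<alpha> w C" if "w \<in> W" for w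
    unfolding C_def using bounded_distortion_mono[OF c[rule_format, OF that]] finW that by (simp add: Max_ge)
  have C0: "C \<ge> 0" unfolding C_def using finW by (simp add: Max_ge)
  \<comment> \<open>The summand 1 covers time 0, which the average omits. \<open>D\<close> is fixed
    before \<open>E\<close> and \<open>N\<close> and does not depend on them.\<close>
  define D where "D = C * (1 + 2 * A)"
  have D0: "D \<ge> 0" using C0 by (simp add: D_def A_def)
  \<comment> \<open>\<open>g\<close> is \<open>f k\<close> or its inverse, whichever moves points
    upwards.\<close>
  obtain g where g: "g \<in> H" "g \<in> levels G k" "nofree_gap.lt ?a ?b 0 g"
    "\<And>h. h \<in> H \<Longrightarrow> comm h g \<in> Q k"
  proof -
    interpret ng: nofree_gap "levels G k" ?a ?b by (rule nofree_gap_level) simp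
    have fk: "f k \<in> H" "f k \<in> levels G k" "gap {f k} ?a ?b" using f[of k] by auto
    have cm: "comm h (f k) \<in> Q k" if "h \<in> H" for h
      using f_central[of k h] that M_subset_Q by auto
    have cm': "comm h (- f k) \<in> Q k" if h: "h \<in> H" for h
    proof -
      have "comm (- f k) h \<in> Q k"
        unfolding comm_uminus_left using h fk cm[OF h] subgrp_uminus[OF ng.subgrp_N]
        by (metis ng.conj_N subgrp_uminus series.K uminus_comm)
      then show ?thesis using subgrp_uminus[OF ng.subgrp_N] by (metis uminus_comm)
    qed
    from gap_direction[OF fk(3)] show ?thesis
    proof
      assume "\<forall>x. ?a < x \<longrightarrow> x < ?b \<longrightarrow> x < app (f k) x"
      then show ?thesis using fk cm by (intro that[of "f k"]) (auto simp: ng.lt_def)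
    next
      assume "\<forall>x. ?a < x \<longrightarrow> x < ?b \<longrightarrow> app (f k) x < x"
      then show ?thesis
        using fk cm' subgrp_uminus[OF series.subgrp_H] subgrp_uminus[OF series.K]
        by (intro that[of "- f k"]) (auto simp: ng.lt_def less_app_uminus_iff)
    qed
  qed
  interpret ng: nofree_gap "levels G k" ?a ?b by (rule nofree_gap_level) simp
  define x1 where "x1 = (?a + ?b) / 2"
  \<comment> \<open>Stretching the distance from \<open>x\<close> to the left endpoint by
    \<open>exp (D + 1)\<close> leads exactly to the midpoint \<open>x1\<close>, the target that
    Kopell's argument has to exceed.\<close>
  define x where "x = ?a + (x1 - ?a) * exp (- (D + 1))"
  have x1: "?a < x1" "x1 < ?b" using lo_hi_k by (auto simp: x1_def)
  define t where "t = (x1 - ?a) * exp (- (D + 1))"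
  have "t \<le> (x1 - ?a) * 1" unfolding t_def using x1 D0 by (intro mult_left_mono) auto
  moreover have "0 < t" unfolding t_def using x1 by simp
  moreover have "x = ?a + t" by (simp only: x_def t_def)
  ultimately have x: "?a < x" "x < ?b" using x1 by auto
  have one: "exp (D + 1) * exp (- (D + 1)) = 1" by (simp only: flip: exp_add) simp
  have "exp (D + 1) * (x - ?a) = (x1 - ?a) * (exp (D + 1) * exp (- (D + 1)))"
    unfolding x_def by (simp only: add_diff_cancel_left' ac_simps)
  then have xx1: "?a + exp (D + 1) * (x - ?a) = x1" unfolding one by simp
  have "gap {g} ?a ?b" using g(3) lo_hi(1)[of k] g(2) by (force simp: ng.lt_def gap_def Fix_def)
  then obtain m where m: "x1 < app (zmul m g) x" using push_up x x1 by blast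
  \<comment> \<open>Already \<open>m\<close> multiples carry \<open>x\<close> beyond
    \<open>x1\<close>. Conjugation by the walk changes \<open>E\<close> by an element of
    \<open>Q k\<close>, and the additional multiple of \<open>g\<close> absorbs this.\<close>
  define E where "E = zmul (m + 1) g"
  have EG: "E \<in> levels G k" unfolding E_def by (rule zmul_closed[OF series.K g(2)])
  then have "E \<in> G" using series.K_0[of k] by auto
  then obtain C' where C': "bounded_distortion \<alpha> E C'" using distortion by blast
  define C'' where "C'' = max C' 0"
  have C'': "bounded_distortion \<alpha> E C''" "C'' \<ge> 0"
    using bounded_distortion_mono[OF C'] by (auto simp: C''_def)
  \<comment> \<open>Some time up to \<open>N\<close> has length to the power \<open>\<alpha>\<close>
    at most \<open>2 * A / N\<close>; for this \<open>N\<close> the distortion of \<open>E\<close>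
    on that interval is at most 1.\<close>
  define N where "N = nat \<lceil>C'' * (2 * A)\<rceil> + 1"
  have N: "N \<ge> 1" "C'' * (2 * A) \<le> real N" by (auto simp: N_def) linarith
  obtain \<theta> where \<theta>: "\<theta> \<in> Params N" "(\<Sum>n = 1..N. len N n \<theta> powr \<alpha>) \<le> 2 * A"
  proof -
    have "Params N \<noteq> {}" using Params(2)[of N] N(1) by auto
    then have "\<exists>\<theta>\<in>Params N. (\<Sum>n = 1..N. len N n \<theta> powr \<alpha>) \<le> 2 * A"
      using average_len by (intro exists_small_sum Params(1)) (auto simp: A_def)
    then show ?thesis using that by blast
  qed
  have "\<exists>n\<in>{1..N}. len N n \<theta> powr \<alpha> \<le> 2 * A / real N"
  proof (rule ccontr)
    assume "\<not> ?thesis"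
    then have "(\<Sum>n = 1..N. 2 * A / real N) < (\<Sum>n = 1..N. len N n \<theta> powr \<alpha>)"
      using N(1) by (intro sum_strict_mono) (auto simp: not_le)
    then show False using \<theta>(2) N(1) by simp
  qed
  then obtain n where n: "1 \<le> n" "n \<le> N" "len N n \<theta> powr \<alpha> \<le> 2 * A / real N" by auto
  define h where "h = walk f N \<theta> n"
  have hH: "h \<in> H" using \<theta>(1) unfolding h_def by (intro walk_in_H) (simp add: Params_def)
  have nonneg: "0 \<le> len N j \<theta> powr \<alpha>" for j by simp
  have "(\<Sum>j<n. len N j \<theta> powr \<alpha>) \<le> (\<Sum>j\<in>insert 0 {1..N}. len N j \<theta> powr \<alpha>)"
    using n by (intro sum_mono2) auto
  also have "\<dots> = len N 0 \<theta> powr \<alpha> + (\<Sum>j = 1..N. len N j \<theta> powr \<alpha>)" by simp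
  also have "\<dots> \<le> 1 + 2 * A"
  proof -
    have "len N 0 \<theta> powr \<alpha> \<le> 1 powr \<alpha>"
      using lo_hi_k \<alpha> by (intro powr_mono2) (auto simp: len_def)
    then show ?thesis using \<theta>(2) by simp
  qed
  finally have S: "(\<Sum>j<n. len N j \<theta> powr \<alpha>) \<le> 1 + 2 * A" .
  have dist: "\<bar>ln (slope h ?a y) - ln (slope h ?a z)\<bar> \<le> D"
    if "?a < y" "y \<le> ?b" "?a < z" "z \<le> ?b" for y z
  proof -
    have "walk_step f N j \<theta> \<in> W" for j using \<theta>(1) by (auto simp: W_def Params_def)
    then have "\<bar>ln (slope h ?a y) - ln (slope h ?a z)\<bar> \<le> C * (\<Sum>j<n. len N j \<theta> powr \<alpha>)"
      unfolding h_def len_def using that lo_hi_k C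
      by (intro distortion_along_path[where w = "\<lambda>j. walk_step f N j \<theta>"]) auto
    also have "\<dots> \<le> D" unfolding D_def using S C0 by (rule mult_left_mono)
    finally show ?thesis .
  qed
  have gh: "gap (levels G k) (app h ?a) (app h ?b)" using gap_conj[OF hH] lo_hi(1)[of k] by simp
  have "C'' * (app h ?b - app h ?a) powr \<alpha> \<le> C'' * (2 * A / real N)"
    using n(3) C''(2) by (intro mult_left_mono) (auto simp: len_def h_def)
  also have "\<dots> \<le> 1" using N by (simp add: field_simps)
  finally have small: "C'' * (app h ?b - app h ?a) powr \<alpha> \<le> 1" .
  have "x1 < app (conj_by (- h) E) x"
  proof -
    have mh: "- h \<in> H" by (rule subgrp_uminus[OF series.subgrp_H hH])
    have normal: "normal_subgrp (levels G k) (Q k)"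
      using ng.subgrp_N ng.N_subset ng.conj_N series.K by unfold_locales (auto simp: normalizes_def)
    then interpret nq: normal_subgrp "levels G k" "Q k" .
    have "nq.eqv (conj_by (- h) g) g"
      using conj_level[OF mh g(2)] g(2) g(4)[OF mh] by (simp add: nq.eqv_def comm_eq_conj_by)
    then have "nq.eqv (conj_by (- h) E) E" unfolding E_def conj_by_zmul by (rule nq.eqv_zmul)
    then have "nq.eqv (- E) (- conj_by (- h) E)" using nq.eqv_uminus nq.eqv_sym by blast
    then have "- E + conj_by (- h) E \<in> Q k" by (simp add: nq.eqv_def)
    moreover have "ng.lt (zmul m g) E" unfolding E_def by (rule ng.zmul_mono[OF g(2,3)]) simp
    ultimately have "ng.lt (zmul m g) (E + (- E + conj_by (- h) E))"
      using EG zmul_closed[OF series.K g(2)] by (intro ng.lt_add_N)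
    then have "ng.lt (zmul m g) (conj_by (- h) E)" by (simp add: add.assoc[symmetric])
    then show ?thesis using m x unfolding ng.lt_def by (meson less_trans)
  qed
  then show False
    using lo_hi_k x gh EG C''(1) small xx1 dist
    by (intro kopell_contradiction[of ?a ?b x E h D \<alpha> C'']) (auto simp: gap_def Fix_def)
qed

end

theorem levels_trivial:
  assumes "subgrp G" "nofree G" "fg G" "\<alpha> > 0" "\<And>g. g \<in> G \<Longrightarrow> \<exists>C. bounded_distortion \<alpha> g C"
    and "real k \<ge> 2 / \<alpha> + 2"
  shows "levels G k = {0}"
proof -
  have "x \<in> Fix (levels G k)" for x
    using deep_group.contradiction[of G \<alpha> k x] assms by (auto simp: deep_group_def)
  then have "g = 0" if "g \<in> levels G k" for g
    using that by (intro homeo_eqI) (auto simp: Fix_def)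
  moreover have "0 \<in> levels G k"
    using torsion_free_series.K[OF torsion_free_series_levels[OF assms(1-3)]] subgrp_0 by blast
  ultimately show ?thesis by blast
qed

section \<open>Embedding a group into an additive group\<close>

locale additive_embedding = group E for E :: "('b, 'c) monoid_scheme" (structure) +
  fixes \<phi> :: "'b \<Rightarrow> 'a::group_add"
  assumes hom: "x \<in> carrier E \<Longrightarrow> y \<in> carrier E \<Longrightarrow> \<phi> (x \<otimes> y) = \<phi> x + \<phi> y"
    and inj: "inj_on \<phi> (carrier E)"
begin

abbreviation G :: "'a set" where "G \<equiv> \<phi> ` carrier E"

lemma \<phi>_one: "\<phi> \<one> = 0"
proof -
  have "\<phi> \<one> + \<phi> \<one> = \<phi> \<one> + 0" using hom[of \<one> \<one>] by simp
  then show ?thesis by (simp only: add_left_cancel)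
qed

lemma \<phi>_inv: "x \<in> carrier E \<Longrightarrow> \<phi> (inv x) = - \<phi> x"
proof -
  assume x: "x \<in> carrier E"
  have "\<phi> (inv x) + \<phi> x = 0" using hom[of "inv x" x] x \<phi>_one by simp
  then show ?thesis by (simp add: eq_neg_iff_add_eq_0)
qed

lemma subgrp_G: "subgrp G"
proof (rule subgrpI)
  show "0 \<in> G" using \<phi>_one by (metis imageI one_closed)
  fix x assume "x \<in> G"
  then obtain u where u: "u \<in> carrier E" "x = \<phi> u" by blast
  show "- x \<in> G" using u \<phi>_inv by (metis imageI inv_closed)
  fix y assume "y \<in> G"
  then obtain v where v: "v \<in> carrier E" "y = \<phi> v" by blast
  show "x + y \<in> G" using u v hom by (metis imageI m_closed)
qed

lemma image_generate: "S \<subseteq> carrier E \<Longrightarrow> \<phi> ` generate E S \<subseteq> gen (\<phi> ` S)"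
proof clarify
  fix x assume S: "S \<subseteq> carrier E" and "x \<in> generate E S"
  from this(2) show "\<phi> x \<in> gen (\<phi> ` S)"
  proof (induction rule: generate.induct)
    case one
    then show ?case using \<phi>_one subgrp_0[OF subgrp_gen] by simp
  next
    case (incl h)
    then show ?case by (simp add: hull_inc)
  next
    case (inv h)
    then have "\<phi> (inv h) = - \<phi> h" using S \<phi>_inv by blast
    then show ?case using inv by (simp add: hull_inc subgrp_uminus[OF subgrp_gen])
  next
    case (eng h1 h2)
    then have "h1 \<in> carrier E" "h2 \<in> carrier E" using generate_in_carrier[OF S] by auto
    then show ?case using eng hom subgrp_add[OF subgrp_gen] by simp
  qed
qed

lemma fg_image:
  assumes "finite S" "S \<subseteq> carrier E" "generate E S = carrier E"
  shows "fg G"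
proof -
  have "gen (\<phi> ` S) \<subseteq> G" using assms(2) by (intro gen_minimal subgrp_G) auto
  then have "gen (\<phi> ` S) = G" using image_generate[OF assms(2)] assms(3) by auto
  then show ?thesis using assms(1) unfolding fg_def by (intro exI[of _ "\<phi> ` S"]) simp
qed

lemma foldr_closed: "set xs \<subseteq> carrier E \<Longrightarrow> foldr (\<lambda>x y. x \<otimes> y) xs \<one> \<in> carrier E"
  by (induction xs) auto

lemma \<phi>_foldr: "set xs \<subseteq> carrier E \<Longrightarrow> \<phi> (foldr (\<lambda>x y. x \<otimes> y) xs \<one>) = sum_list (map \<phi> xs)"
  by (induction xs) (simp_all add: \<phi>_one hom foldr_closed)

lemma growth_fun_eq:
  assumes "S \<subseteq> carrier E"
  shows "growth_fun E S n = card {sum_list ys | ys. set ys \<subseteq> \<phi> ` S \<and> length ys \<le> n}"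
proof -
  let ?B = "{foldr (\<lambda>x y. x \<otimes> y) xs \<one> | xs. set xs \<subseteq> S \<and> length xs \<le> n}"
  have "?B \<subseteq> carrier E" using foldr_closed assms by blast
  then have "card (\<phi> ` ?B) = card ?B" using inj by (intro card_image) (rule inj_on_subset)
  moreover have "\<phi> ` ?B = {sum_list ys | ys. set ys \<subseteq> \<phi> ` S \<and> length ys \<le> n}"
  proof
    show "\<phi> ` ?B \<subseteq> {sum_list ys | ys. set ys \<subseteq> \<phi> ` S \<and> length ys \<le> n}"
    proof clarify
      fix xs assume xs: "set xs \<subseteq> S" "length xs \<le> n"
      then have "\<phi> (foldr (\<lambda>x y. x \<otimes> y) xs \<one>) = sum_list (map \<phi> xs)" using assms by (intro \<phi>_foldr) auto
      then show "\<exists>ys. \<phi> (foldr (\<lambda>x y. x \<otimes> y) xs \<one>) = sum_list ys \<and> set ys \<subseteq> \<phi> ` S \<and> length ys \<le> n"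
        using xs by (intro exI[of _ "map \<phi> xs"]) auto
    qed
    show "{sum_list ys | ys. set ys \<subseteq> \<phi> ` S \<and> length ys \<le> n} \<subseteq> \<phi> ` ?B"
    proof clarify
      fix ys assume ys: "set ys \<subseteq> \<phi> ` S" "length ys \<le> n"
      then have "ys \<in> map \<phi> ` lists S" using lists_image[of \<phi> S] by (metis in_lists_conv_set subsetD)
      then obtain xs where xs: "set xs \<subseteq> S" "ys = map \<phi> xs" by auto
      then have "\<phi> (foldr (\<lambda>x y. x \<otimes> y) xs \<one>) = sum_list ys" using assms by (simp add: \<phi>_foldr)
      then show "sum_list ys \<in> \<phi> ` ?B" using xs ys by (intro image_eqI[of _ _ "foldr (\<lambda>x y. x \<otimes> y) xs \<one>"]) auto
    qed
  qed
  ultimately show ?thesis by (simp add: growth_fun_def)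
qed

text \<open>If \<open>a\<close> and \<open>b\<close>, of word length below \<open>L\<close>,
  satisfied no relation between words of equal length, the ball of radius \<open>L * n\<close> would
  have at least \<open>2 ^ n\<close> elements, and a subsequence of the roots would stay above
  \<open>root L 2\<close>.\<close>

lemma nofree_of_subexponential_growth:
  assumes "subexponential_growth E"
  shows "nofree G"
proof -
  obtain S where S: "finite S" "S \<subseteq> carrier E" "\<forall>s\<in>S. inv s \<in> S" "generate E S = carrier E"
    and lim: "(\<lambda>n. root n (real (growth_fun E S n))) \<longlonglongrightarrow> 1"
    using assms by (auto simp: subexponential_growth_def symmetric_generating_set_def)
  let ?T = "\<phi> ` S"
  let ?B = "\<lambda>n. {sum_list ys | ys. set ys \<subseteq> ?T \<and> length ys \<le> n}"
  have finB: "finite (?B n)" for n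
  proof -
    have "?B n = sum_list ` {ys. set ys \<subseteq> ?T \<and> length ys \<le> n}" by auto
    then show ?thesis using finite_lists_length_le[of ?T n] S(1) by simp
  qed
  have words: "\<exists>ys. set ys \<subseteq> ?T \<and> g = sum_list ys" if g: "g \<in> G" for g
  proof -
    obtain x where x: "x \<in> generate E S" "g = \<phi> x" using g S(4) by auto
    from x(1) have "\<exists>ys. set ys \<subseteq> ?T \<and> \<phi> x = sum_list ys"
    proof (induction rule: generate.induct)
      case one
      then show ?case using \<phi>_one by (intro exI[of _ "[]"]) simp
    next
      case (incl h)
      then show ?case by (intro exI[of _ "[\<phi> h]"]) simp
    next
      case (inv h)
      then have "inv h \<in> S" using S(3) by blast
      then show ?case by (intro exI[of _ "[\<phi> (inv h)]"]) simp
    next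
      case (eng h1 h2)
      then obtain ys zs where "set ys \<subseteq> ?T" "\<phi> h1 = sum_list ys" "set zs \<subseteq> ?T" "\<phi> h2 = sum_list zs" by auto
      moreover have "h1 \<in> carrier E" "h2 \<in> carrier E" using eng.hyps generate_in_carrier[OF S(2)] by auto
      ultimately show ?case using hom by (intro exI[of _ "ys @ zs"]) simp
    qed
    then show ?thesis using x(2) by simp
  qed
  show ?thesis
    unfolding nofree_def
  proof (intro ballI, rule ccontr)
    fix a b assume ab: "a \<in> G" "b \<in> G"
      and no: "\<not> (\<exists>v w. length v = length w \<and> v \<noteq> w \<and> word a b v = word a b w)"
    obtain la lb where la: "set la \<subseteq> ?T" "a = sum_list la" and lb: "set lb \<subseteq> ?T" "b = sum_list lb"
      using words[OF ab(1)] words[OF ab(2)] by blast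
    \<comment> \<open>The successor keeps \<open>L\<close> positive even when both words are
      empty.\<close>
    define L where "L = Suc (max (length la) (length lb))"
    have in_B: "\<exists>ys. word a b v = sum_list ys \<and> set ys \<subseteq> ?T \<and> length ys \<le> L * length v" for v
    proof (induction v)
      case Nil
      then show ?case by (intro exI[of _ "[]"]) (simp add: word_def)
    next
      case (Cons c v)
      then obtain ys where ys: "word a b v = sum_list ys" "set ys \<subseteq> ?T" "length ys \<le> L * length v" by blast
      define zs where "zs = (if c then la else lb)"
      have "length zs \<le> L" "set zs \<subseteq> ?T" "sum_list zs = (if c then a else b)"
        using la lb by (auto simp: zs_def L_def)
      then have "word a b (c # v) = sum_list (zs @ ys)" "set (zs @ ys) \<subseteq> ?T" "length (zs @ ys) \<le> L * length (c # v)"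
        using ys by (auto simp: word_def)
      then show ?case by blast
    qed
    have grow: "2 ^ n \<le> growth_fun E S (L * n)" for n
    proof -
      let ?V = "{v :: bool list. set v \<subseteq> UNIV \<and> length v = n}"
      have "inj_on (word a b) ?V"
      proof (rule inj_onI)
        fix v w assume "v \<in> ?V" "w \<in> ?V" and e: "word a b v = word a b w"
        then have "length v = length w" by simp
        then show "v = w" using no e by blast
      qed
      moreover have "word a b ` ?V \<subseteq> ?B (L * n)" using in_B by auto
      ultimately have "card ?V \<le> card (?B (L * n))" using finB by (intro card_inj_on_le)
      moreover have "card ?V = 2 ^ n" using card_lists_length_eq[of "UNIV :: bool set" n] by simp
      ultimately show ?thesis by (simp add: growth_fun_eq[OF S(2)])
    qed
    have ge: "root L 2 \<le> root (L * n) (real (growth_fun E S (L * n)))" if "n \<ge> 1" for n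
    proof -
      have "root L 2 = root (L * n) (2 ^ n)"
        using that by (simp add: real_root_mult_exp real_root_power_cancel)
      also have "\<dots> \<le> root (L * n) (real (growth_fun E S (L * n)))"
      proof -
        have "real (2 ^ n) \<le> real (growth_fun E S (L * n))" by (rule of_nat_mono[OF grow])
        then show ?thesis using that by (intro real_root_le_mono) (auto simp: L_def)
      qed
      finally show ?thesis .
    qed
    have "strict_mono (\<lambda>n. L * n)" unfolding strict_mono_def L_def by (simp only: Suc_mult_less_cancel1 simp_thms)
    from LIMSEQ_subseq_LIMSEQ[OF lim this]
    have "(\<lambda>n. root (L * n) (real (growth_fun E S (L * n)))) \<longlonglongrightarrow> 1" by (simp add: o_def)
    then have "root L 2 \<le> 1" by (rule LIMSEQ_le_const) (use ge in auto)
    moreover have "root L 2 > 1" by (simp add: L_def)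
    ultimately show False by simp
  qed
qed

text \<open>The embedding carries the lower central series of the preimage \<open>N\<close> of
  \<open>P\<close> into the given central series, so it becomes trivial at \<open>m\<close>.\<close>

lemma almost_nilpotent_of_series:
  assumes P: "subgrp P" and R: "finite R" "R \<subseteq> G" "\<And>g. g \<in> G \<Longrightarrow> \<exists>r\<in>R. - r + g \<in> P"
    and C: "C 0 = P" "\<And>n::nat. subgrp (C n)" "\<And>n x h. x \<in> C n \<Longrightarrow> h \<in> P \<Longrightarrow> comm x h \<in> C (Suc n)"
      "C m \<subseteq> {0}"
  shows "almost_nilpotent E"
proof -
  define N where "N = {x \<in> carrier E. \<phi> x \<in> P}"
  have sub: "subgroup {x \<in> carrier E. \<phi> x \<in> A} E" if "subgrp A" for A
    using subgrp_0[OF that] subgrp_add[OF that] subgrp_uminus[OF that]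
    by (intro subgroupI) (auto simp: \<phi>_one hom \<phi>_inv)
  have N: "subgroup N E" unfolding N_def by (rule sub[OF P])
  define R' where "R' = {s \<in> carrier E. \<phi> s \<in> R}"
  have "finite R'" unfolding R'_def using finite_vimage_IntI[OF R(1) inj] by (simp add: vimage_def Int_def conj_commute)
  \<comment> \<open>\<open>R\<close> represents cosets from one side and \<open>rcosets\<close> asks
    for the other side; inversion exchanges them.\<close>
  have "rcosets N \<subseteq> (\<lambda>s. N #> inv s) ` R'"
  proof
    fix X assume "X \<in> rcosets N"
    then obtain a where a: "a \<in> carrier E" "X = N #> a" by (auto simp: RCOSETS_def)
    obtain r where r: "r \<in> R" "- r + - \<phi> a \<in> P" using R(3)[of "- \<phi> a"] a subgrp_uminus[OF subgrp_G] by blast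
    then obtain s where s: "s \<in> carrier E" "r = \<phi> s" using R(2) by blast
    have "- (- r + - \<phi> a) \<in> P" by (rule subgrp_uminus[OF P r(2)])
    then have "\<phi> (a \<otimes> s) \<in> P" using a s by (simp add: hom minus_add)
    then have "a \<otimes> s \<in> N" using a s by (simp add: N_def)
    moreover have "a = (a \<otimes> s) \<otimes> inv s" using a s by (simp add: m_assoc)
    ultimately have "a \<in> N #> inv s" unfolding r_coset_def by blast
    then have "N #> inv s = N #> a" using repr_independence[OF _ _ N] s by simp
    then show "X \<in> (\<lambda>s. N #> inv s) ` R'" using a s r by (auto simp: R'_def)
  qed
  then have "finite (rcosets N)" using \<open>finite R'\<close> by (rule finite_surj[rotated])
  moreover have "nilpotent_group (E\<lparr>carrier := N\<rparr>)"
  proof -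
    let ?EN = "E\<lparr>carrier := N\<rparr>"
    interpret EN: group ?EN by (rule subgroup.subgroup_is_group[OF N is_group])
    have inv: "inv\<^bsub>?EN\<^esub> x = inv x" if "x \<in> N" for x using m_inv_consistent[OF N that] .
    have "lower_central ?EN n \<subseteq> {x \<in> N. \<phi> x \<in> C n}" for n
    proof (induction n)
      case 0
      then show ?case using C(1) by (auto simp: N_def)
    next
      case (Suc n)
      let ?A = "{x \<in> N. \<phi> x \<in> C (Suc n)}"
      have "subgroup ?A ?EN"
      proof (rule subgroup_incl[OF _ N])
        have "?A = {x \<in> carrier E. \<phi> x \<in> P \<inter> C (Suc n)}" by (auto simp: N_def)
        then show "subgroup ?A E" using sub[OF subgrp_Int[OF P C(2)]] by simp
      qed auto
      moreover have "{x \<otimes>\<^bsub>?EN\<^esub> y \<otimes>\<^bsub>?EN\<^esub> inv\<^bsub>?EN\<^esub> x \<otimes>\<^bsub>?EN\<^esub> inv\<^bsub>?EN\<^esub> y | x y.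
          x \<in> lower_central ?EN n \<and> y \<in> carrier ?EN} \<subseteq> ?A"
      proof clarify
        fix x y assume x: "x \<in> lower_central ?EN n" and "y \<in> carrier ?EN"
        then have y: "y \<in> N" by simp
        have xN: "x \<in> N" "\<phi> x \<in> C n" using Suc x by auto
        have c: "x \<in> carrier E" "y \<in> carrier E" "\<phi> y \<in> P" using xN(1) y by (auto simp: N_def)
        let ?c = "x \<otimes> y \<otimes> inv x \<otimes> inv y"
        have "\<phi> ?c = comm (\<phi> x) (\<phi> y)" using c by (simp add: hom \<phi>_inv comm_def)
        then have "\<phi> ?c \<in> C (Suc n)" using C(3)[OF xN(2) c(3)] by simp
        moreover have "?c \<in> N"
          using xN(1) y N by (auto intro!: subgroup.m_closed subgroup.m_inv_closed)
        ultimately show "x \<otimes>\<^bsub>?EN\<^esub> y \<otimes>\<^bsub>?EN\<^esub> inv\<^bsub>?EN\<^esub> x \<otimes>\<^bsub>?EN\<^esub> inv\<^bsub>?EN\<^esub> y \<in> N \<and>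
            \<phi> (x \<otimes>\<^bsub>?EN\<^esub> y \<otimes>\<^bsub>?EN\<^esub> inv\<^bsub>?EN\<^esub> x \<otimes>\<^bsub>?EN\<^esub> inv\<^bsub>?EN\<^esub> y) \<in> C (Suc n)"
          by (simp add: inv[OF xN(1)] inv[OF y])
      qed
      ultimately show ?case by (simp add: EN.generate_subgroup_incl)
    qed
    moreover have "\<one> \<in> lower_central ?EN n" for n
      using EN.one_closed generate.one[of ?EN] by (cases n) auto
    moreover have "x = \<one>" if "x \<in> N" "\<phi> x = 0" for x
      using that inj_onD[OF inj, of x \<one>] by (simp add: \<phi>_one N_def)
    ultimately have "lower_central ?EN m = {\<one>\<^bsub>?EN\<^esub>}" using C(4) by fastforce
    then show ?thesis unfolding nilpotent_group_def using EN.is_group by blast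
  qed
  ultimately show ?thesis unfolding almost_nilpotent_def using N is_group by blast
qed

end

section \<open>Diffeomorphisms as homeomorphisms of the line\<close>

definition to_homeo :: "(real \<Rightarrow> real) \<Rightarrow> homeo" where
  "to_homeo f = Homeo (\<lambda>x. if x \<in> {0..1} then f x else x)"

lemma Diff_carrierD:
  assumes "f \<in> Diff_carrier \<alpha>"
  shows "f \<in> Bij {0..1}" "bij_betw f {0..1} {0..1}" "C1_on {0..1} f" "C1_on {0..1} (inv_into {0..1} f)"
    "strict_mono_on {0..1} f" "holder_on \<alpha> {0..1} (derivative_on {0..1} f)"
  using assms by (auto simp: Diff_carrier_def Bij_def)

lemma app_to_homeo:
  assumes "f \<in> Diff_carrier \<alpha>"
  shows "app (to_homeo f) x = (if x \<in> {0..1} then f x else x)"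
proof -
  note f = Diff_carrierD[OF assms]
  let ?g = "\<lambda>x. if x \<in> {0..1} then f x else x"
  have I: "f x \<in> {0..1}" if "x \<in> {0..1}" for x using f(2) that by (rule bij_betw_apply)
  have "strict_mono ?g"
  proof (rule strict_monoI)
    fix x y :: real assume "x < y"
    then consider "x \<in> {0..1}" "y \<in> {0..1}" | "x \<in> {0..1}" "y > 1" | "x < 0" "y \<in> {0..1}"
      | "x \<notin> {0..1}" "y \<notin> {0..1}" by fastforce
    then show "?g x < ?g y"
    proof cases
      case 1
      then show ?thesis using f(5) \<open>x < y\<close> by (simp add: strict_mono_on_def)
    next
      case 2
      then show ?thesis using I[of x] by auto
    next
      case 3
      then show ?thesis using I[of y] by auto
    qed (use \<open>x < y\<close> in auto)
  qed
  moreover have "surj ?g"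
  proof
    show "UNIV \<subseteq> range ?g"
    proof
      fix y :: real
      show "y \<in> range ?g"
      proof (cases "y \<in> {0..1}")
        case True
        then have "y \<in> f ` {0..1}" using f(2) by (simp add: bij_betw_def)
        then obtain x where "x \<in> {0..1}" "y = f x" by blast
        then show ?thesis by (intro range_eqI[of _ _ x]) simp
      qed (intro range_eqI[of _ _ y], auto)
    qed
  qed simp
  ultimately show ?thesis by (simp add: to_homeo_def Homeo_inverse)
qed

lemma to_homeo_compose:
  assumes "f \<in> Diff_carrier \<alpha>" "g \<in> Diff_carrier \<alpha>" "compose {0..1} f g \<in> Diff_carrier \<alpha>"
  shows "to_homeo (compose {0..1} f g) = to_homeo f + to_homeo g"
proof (rule homeo_eqI)
  fix x
  have "g x \<in> {0..1}" if "x \<in> {0..1}" using bij_betw_apply[OF Diff_carrierD(2)[OF assms(2)] that] .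
  then show "app (to_homeo (compose {0..1} f g)) x = app (to_homeo f + to_homeo g) x"
    using app_to_homeo[OF assms(1)] app_to_homeo[OF assms(2)] app_to_homeo[OF assms(3)] by (auto simp: compose_def)
qed

lemma inj_on_to_homeo: "inj_on to_homeo (Diff_carrier \<alpha>)"
proof (rule inj_onI)
  fix f g assume f: "f \<in> Diff_carrier \<alpha>" and g: "g \<in> Diff_carrier \<alpha>" and e: "to_homeo f = to_homeo g"
  have "f x = g x" if "x \<in> {0..1}" for x
    using arg_cong[OF e, of "\<lambda>h. app h x"] that by (simp only: app_to_homeo[OF f] app_to_homeo[OF g] if_True)
  then show "f = g"
    using Diff_carrierD(1)[OF f] Diff_carrierD(1)[OF g] by (intro extensionalityI[of _ "{0..1}"]) (auto simp: Bij_def)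
qed

lemma additive_embedding_Diff:
  assumes "\<alpha> > 0" "subgroup H (Diff \<alpha>)"
  shows "additive_embedding (Diff \<alpha>\<lparr>carrier := H\<rparr>) to_homeo"
proof -
  interpret group "Diff \<alpha>\<lparr>carrier := H\<rparr>"
    by (rule subgroup.subgroup_is_group[OF assms(2) group_Diff[OF assms(1)]])
  have HD: "H \<subseteq> Diff_carrier \<alpha>" using subgroup.subset[OF assms(2)] by (simp add: Diff_def)
  show ?thesis
  proof
    show "inj_on to_homeo (carrier (Diff \<alpha>\<lparr>carrier := H\<rparr>))"
      using inj_on_subset[OF inj_on_to_homeo HD] by simp
    fix f g assume "f \<in> carrier (Diff \<alpha>\<lparr>carrier := H\<rparr>)" "g \<in> carrier (Diff \<alpha>\<lparr>carrier := H\<rparr>)"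
    then have f: "f \<in> Diff_carrier \<alpha>" and g: "g \<in> Diff_carrier \<alpha>" using HD by auto
    have "f \<otimes>\<^bsub>Diff \<alpha>\<lparr>carrier := H\<rparr>\<^esub> g = compose {0..1} f g"
      using Diff_carrierD(1)[OF f] Diff_carrierD(1)[OF g] by (simp add: Diff_def BijGroup_def)
    then show "to_homeo (f \<otimes>\<^bsub>Diff \<alpha>\<lparr>carrier := H\<rparr>\<^esub> g) = to_homeo f + to_homeo g"
      using to_homeo_compose[OF f g Diff_carrier_comp[OF assms(1) f g]] by simp
  qed
qed

text \<open>The inverse is of class C1 as well, so its derivative is bounded, and the chain rule
  makes the two derivatives reciprocal.\<close>

lemma derivative_lower_bound:
  assumes "f \<in> Diff_carrier \<alpha>"
  shows "\<exists>m>0. \<forall>x\<in>{0..1}. m \<le> \<bar>derivative_on {0..1} f x\<bar>"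
proof -
  note f = Diff_carrierD[OF assms]
  let ?I = "{0..1::real}" and ?g = "inv_into {0..1} f"
  have fI: "f ` ?I \<subseteq> ?I" using f(2) by (simp add: bij_betw_def)
  obtain B where B: "B > 0" "\<And>x. x \<in> ?I \<Longrightarrow> \<bar>derivative_on ?I ?g x\<bar> \<le> B"
    using C1_on_bounded[OF f(4)] by metis
  have "1 / B \<le> \<bar>derivative_on ?I f x\<bar>" if x: "x \<in> ?I" for x
  proof -
    have "(?g \<circ> f) z = z" if "z \<in> ?I" for z using bij_betw_inv_into_left[OF f(2) that] by simp
    then have "derivative_on ?I (\<lambda>x. x) x = derivative_on ?I (?g \<circ> f) x"
      by (intro derivative_on_cong[OF C1_on_comp(1)[OF f(4,3) fI] _ x])
    moreover have "derivative_on ?I (\<lambda>x. x) x = 1" using x by (intro derivative_on_eq) auto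
    ultimately have "1 = derivative_on ?I ?g (f x) * derivative_on ?I f x"
      using C1_on_comp(2)[OF f(4,3) fI x] by simp
    then have "1 = \<bar>derivative_on ?I ?g (f x)\<bar> * \<bar>derivative_on ?I f x\<bar>" by (metis abs_mult abs_one)
    also have "\<dots> \<le> B * \<bar>derivative_on ?I f x\<bar>" using B(2)[OF subsetD[OF fI imageI[OF x]]] by (intro mult_right_mono) auto
    finally show ?thesis using B(1) by (simp add: field_simps)
  qed
  then show ?thesis using B(1) by (intro exI[of _ "1 / B"]) simp
qed

lemma ln_diff_le:
  assumes "0 < m" "m \<le> s" "m \<le> (t::real)"
  shows "\<bar>ln s - ln t\<bar> \<le> \<bar>s - t\<bar> / m"
proof -
  have le: "ln s - ln t \<le> \<bar>s - t\<bar> / m" if "m \<le> s" "m \<le> t" for s t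
  proof -
    have st: "s > 0" "t > 0" using that assms(1) by auto
    have "ln s - ln t = ln (s / t)" using st by (simp add: ln_div)
    also have "\<dots> \<le> s / t - 1" using st by (intro ln_le_minus_one) simp
    also have "\<dots> = (s - t) / t" using st by (simp add: field_simps)
    also have "\<dots> \<le> \<bar>s - t\<bar> / t" using st by (intro divide_right_mono) auto
    also have "\<dots> \<le> \<bar>s - t\<bar> / m" using that assms(1) by (intro divide_left_mono) auto
    finally show ?thesis .
  qed
  show ?thesis using le[OF assms(2,3)] le[OF assms(3,2)] by (simp add: abs_minus_commute abs_le_iff)
qed

text \<open>By the mean value theorem slopes are values of the derivative. These are bounded away
  from 0, where the logarithm is Lipschitz, so the Hoelder estimate carries over.\<close>

lemma bounded_distortion_to_homeo:
  assumes "\<alpha> > 0" and fD: "f \<in> Diff_carrier \<alpha>"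
  shows "\<exists>C. bounded_distortion \<alpha> (to_homeo f) C"
proof -
  note f = Diff_carrierD[OF fD]
  let ?d = "derivative_on {0..1} f"
  obtain m where m: "m > 0" "\<And>x. x \<in> {0..1} \<Longrightarrow> m \<le> \<bar>?d x\<bar>" using derivative_lower_bound[OF fD] by blast
  obtain C where C: "C \<ge> 0" "\<And>x y. x \<in> {0..1} \<Longrightarrow> y \<in> {0..1} \<Longrightarrow> \<bar>?d x - ?d y\<bar> \<le> C * \<bar>x - y\<bar> powr \<alpha>"
    using holder_onE[OF f(6)] by blast
  have mvt: "\<exists>z. x < z \<and> z < y \<and> slope (to_homeo f) x y = ?d z" if xy: "0 \<le> x" "x < y" "y \<le> 1" for x y
  proof -
    have "\<exists>z\<in>{x<..<y}. f y - f x = (\<lambda>h. ?d z * h) (y - x)"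
    proof (rule mvt_simple[OF xy(2)])
      fix z assume "x \<le> z" "z \<le> y"
      then have "(f has_real_derivative ?d z) (at z within {0..1})" using C1_on_derivative[OF f(3)] xy by simp
      then have "(f has_real_derivative ?d z) (at z within {x..y})" by (rule DERIV_subset) (use xy in auto)
      then show "(f has_derivative (\<lambda>h. ?d z * h)) (at z within {x..y})"
        by (simp add: has_field_derivative_def)
    qed
    then obtain z where "x < z" "z < y" "f y - f x = ?d z * (y - x)" by auto
    then show ?thesis using xy by (intro exI[of _ z]) (simp add: slope_def app_to_homeo[OF fD])
  qed
  have "bounded_distortion \<alpha> (to_homeo f) (C / m)"
    unfolding bounded_distortion_def
  proof (intro allI impI)
    fix p q x y u v :: real
    assume a: "0 \<le> p" "q \<le> 1" "p \<le> x" "x < y" "y \<le> q" "p \<le> u" "u < v" "v \<le> q"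
    obtain z where z: "x < z" "z < y" "slope (to_homeo f) x y = ?d z" using mvt[of x y] a by auto
    obtain w where w: "u < w" "w < v" "slope (to_homeo f) u v = ?d w" using mvt[of u v] a by auto
    have I: "z \<in> {0..1}" "w \<in> {0..1}" using z w a by auto
    \<comment> \<open>\<open>m\<close> bounds the derivative only in absolute value; the sign comes
      from the positivity of slopes.\<close>
    have "m \<le> slope (to_homeo f) x y" "m \<le> slope (to_homeo f) u v"
      using m(2)[OF I(1)] m(2)[OF I(2)] slope_pos[OF a(4), of "to_homeo f"] slope_pos[OF a(7), of "to_homeo f"]
      by (auto simp: z(3) w(3))
    then have "\<bar>ln (slope (to_homeo f) x y) - ln (slope (to_homeo f) u v)\<bar> \<le> \<bar>?d z - ?d w\<bar> / m"
      using ln_diff_le[OF m(1)] by (simp add: z(3) w(3))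
    also have "\<dots> \<le> C * \<bar>z - w\<bar> powr \<alpha> / m" using C(2)[OF I] m(1) by (intro divide_right_mono) auto
    also have "\<dots> \<le> C * (q - p) powr \<alpha> / m"
      using C(1) m(1) z w a assms(1) by (intro divide_right_mono mult_left_mono powr_mono2) auto
    finally show "\<bar>ln (slope (to_homeo f) x y) - ln (slope (to_homeo f) u v)\<bar> \<le> C / m * (q - p) powr \<alpha>" by simp
  qed
  then show ?thesis by blast
qed

theorem theoremB:
  fixes \<alpha> :: real and H :: "(real \<Rightarrow> real) set"
  assumes "\<alpha> > 0"
    and "subgroup H (Diff \<alpha>)"
    and "finitely_generated (Diff \<alpha>\<lparr>carrier := H\<rparr>)"
    and "subexponential_growth (Diff \<alpha>\<lparr>carrier := H\<rparr>)"
  shows "almost_nilpotent (Diff \<alpha>\<lparr>carrier := H\<rparr>)"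
proof -
  interpret emb: additive_embedding "Diff \<alpha>\<lparr>carrier := H\<rparr>" to_homeo
    by (rule additive_embedding_Diff[OF assms(1,2)])
  let ?G = "to_homeo ` carrier (Diff \<alpha>\<lparr>carrier := H\<rparr>)"
  have nf: "nofree ?G" by (rule emb.nofree_of_subexponential_growth[OF assms(4)])
  have fg: "fg ?G" using assms(3) emb.fg_image unfolding finitely_generated_def by blast
  have "H \<subseteq> Diff_carrier \<alpha>" using subgroup.subset[OF assms(2)] by (simp add: Diff_def)
  then have dist: "\<exists>C. bounded_distortion \<alpha> g C" if "g \<in> ?G" for g
    using that bounded_distortion_to_homeo[OF assms(1)] by auto
  define k where "k = nat \<lceil>2 / \<alpha> + 2\<rceil>"
  have "2 / \<alpha> + 2 \<le> real k" unfolding k_def by (rule real_nat_ceiling_ge)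
  then have trivial: "levels ?G k = {0}" using levels_trivial[OF emb.subgrp_G nf fg assms(1) dist] by blast
  \<comment> \<open>The cutoff is now the level just shown to be trivial, so the central series of
    \<open>H\<close> ends at 0.\<close>
  interpret series: torsion_free_series "levels ?G" k
    by (rule torsion_free_series_levels[OF emb.subgrp_G nf fg])
  obtain R where R: "finite R" "R \<subseteq> ?G" "\<And>g. g \<in> ?G \<Longrightarrow> \<exists>r\<in>R. - r + g \<in> series.H"
    using series.H_finite_index by auto
  obtain C m where C: "C 0 = series.H" "C m \<subseteq> levels ?G k" "\<And>n::nat. subgrp (C n)"
    "\<And>n x h. x \<in> C n \<Longrightarrow> h \<in> series.H \<Longrightarrow> comm x h \<in> C (Suc n)"
    using series.H_central_series[of k] by auto
  show ?thesis
    using emb.almost_nilpotent_of_series[OF series.subgrp_H R C(1,3,4)] C(2) trivial by simp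
qed

end
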